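(* Let $\eta,\kappa\in\{0,1,2,\dots\}\cup\{\infty\}$ with $\eta\ge2$, and let $S_{\boldsymbol\lambda}$ be a subnormal weighted shift on the directed tree $\mathscr T_{\eta,\kappa}$ with nonzero weights $\boldsymbol\lambda=\{\lambda_v\}_{v\in V_{\eta,\kappa}^\circ}\subseteq\mathbb C$. Suppose $e_0\in\mathcal D^\infty(S_{\boldsymbol\lambda})$ and (D) $\Big\{\sum_{i=1}^\eta\big|\prod_{j=1}^{n+1}\lambda_{i,j}\big|^2\Big\}_{n=0}^\infty$ is a determinate Stieltjes moment sequence. For a sequence $\{\mu_i\}_{i=1}^\eta$ of Borel probability measures on $\mathbb R_+$ consider the conditions $$(1)\ \int_0^\infty s^n\,d\mu_i(s)=\Big|\prod_{j=2}^{n+1}\lambda_{i,j}\Big|^2,\quad n\in\mathbb N,\ i\in J_\eta;$$ $$(2)\ \sum_{i=1}^\eta|\lambda_{i,1}|^2\int_0^\infty\frac1s\,d\mu_i(s)=1;$$ $$(3)\ \Big|\prod_{j=0}^{l-1}\lambda_{-j}\Big|^2\sum_{i=1}^\eta|\lambda_{i,1}|^2\int_0^\infty\frac1{s^{l+1}}\,d\mu_i(s)=1,\quad l\in J_{\kappa-1}$$ (with $J_{\kappa-1}=\mathbb N$ if $\kappa=\infty$). Then the following four assertions hold: (i) if $\kappa=0$, then there exists a sequence $\{\mu_i\}_{i=1}^\eta$ of Borel probability measures on $\mathbb R_+$ satisfying (1) and $\sum_{i=1}^\eta|\lambda_{i,1}|^2\int_0^\infty\frac1s\,d\mu_i(s)\le1$;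 (ii) if $0<\kappa<\infty$, then there exists a sequence $\{\mu_i\}_{i=1}^\eta$ of Borel probability measures on $\mathbb R_+$ satisfying (1), (2), (3) and $$\Big|\prod_{j=0}^{\kappa-1}\lambda_{-j}\Big|^2\sum_{i=1}^\eta|\lambda_{i,1}|^2\int_0^\infty\frac1{s^{\kappa+1}}\,d\mu_i(s)\le1;$$ (iii) if $0<\kappa<\infty$, then there exist a sequence $\{\mu_i\}_{i=1}^\eta$ of Borel probability measures on $\mathbb R_+$ and a Borel probability measure $\nu$ on $\mathbb R_+$ satisfying (1), $$\int_0^\infty s^n\,d\nu(s)=\Big|\prod_{j=\kappa-n}^{\kappa-1}\lambda_{-j}\Big|^2,\quad n\in J_\kappa,$$ and $$\int_\sigma s^\kappa\,d\nu(s)=\Big|\prod_{j=0}^{\kappa-1}\lambda_{-j}\Big|^2\sum_{i=1}^\eta|\lambda_{i,1}|^2\int_\sigma\frac1s\,d\mu_i(s)\quad\text{for every Borel set }\sigma\subseteq\mathbb R_+;$$ (iv) if $\kappa=\infty$, then there exists a sequence $\{\mu_i\}_{i=1}^\eta$ of Borel probability measures on $\mathbb R_+$ satisfying (1), (2) and (3). Moreover, if (in place of assuming (D)) $e_0\in\mathscr Q(S_{\boldsymbol\lambda})$, i.e. $\sum_{n=1}^\infty\Big(\sum_{i=1}^\eta\big|\prod_{j=1}^n\lambda_{i,j}\big|^2\Big)^{-1/(2n)}=\infty$, then (D) is satisfied.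
   Context: $\mathbb N=\{1,2,\dots\}$, $\mathbb R_+=[0,\infty)$. For $\iota\in\{0,1,2,\dots\}\cup\{\infty\}$, $J_\iota=\{k\in\mathbb N:k\le\iota\}$; sequences and sums indexed by $i=1,\dots,\eta$ are over $i\in J_\eta$. The directed tree $\mathscr T_{\eta,\kappa}=(V_{\eta,\kappa},E_{\eta,\kappa})$ has vertex set $V_{\eta,\kappa}=\{-k:k\in J_\kappa\}\sqcup\{0\}\sqcup\{(i,j):i\in J_\eta,\ j\in\mathbb N\}$ and edge set $E_{\eta,\kappa}=\{(-k,-k+1):k\in J_\kappa\}\sqcup\{(0,(i,1)):i\in J_\eta\}\sqcup\{((i,j),(i,j+1)):i\in J_\eta,\ j\in\mathbb N\}$, where an edge $(u,v)$ goes from the parent $u=\mathrm{par}(v)$ to the child $v$. If $\kappa<\infty$ the tree has root $-\kappa$; if $\kappa=\infty$ it is rootless. $V_{\eta,\kappa}^\circ$ is the set of non-root vertices. One writes $\lambda_{i,j}$ for $\lambda_{(i,j)}$. With $V=V_{\eta,\kappa}$, $\ell^2(V)$ is the Hilbert space of square summable complex functions on $V$, and $e_u$ is the characteristic function of $\{u\}$. The weighted shift $S_{\boldsymbol\lambda}$ with weights $\{\lambda_v\}_{v\in V^\circ}$ is the operator in $\ell^2(V)$ with domain $\{f\in\ell^2(V):\Lambda f\in\ell^2(V)\}$ and $S_{\boldsymbol\lambda}f=\Lambda f$, where $(\Lambda f)(v)=\lambda_vf(\mathrm{par}(v))$ for $v\in V^\circ$ and $(\Lambda f)(v)=0$ if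 $v$ is the root. For an operator $A$, $\mathcal D^\infty(A)=\bigcap_{n\ge0}\mathcal D(A^n)$, and $\mathscr Q(A)$ is the set of all $f\in\mathcal D^\infty(A)$ with $\sum_{n=1}^\infty\|A^nf\|^{-1/n}=\infty$. A densely defined operator $S$ in a complex Hilbert space $\mathcal H$ is subnormal if there are a complex Hilbert space $\mathcal K\supseteq\mathcal H$ (isometric embedding) and a normal (possibly unbounded) operator $N$ in $\mathcal K$ such that $Sh=Nh$ for all $h\in\mathcal D(S)$. A real sequence $\{t_n\}_{n=0}^\infty$ is a Stieltjes moment sequence if there is a positive Borel measure $\mu$ on $\mathbb R_+$ (a representing measure) with $t_n=\int_0^\infty s^n\,d\mu(s)$ for all $n\ge0$; it is determinate if it has only one representing measure. Conventions: $\frac10=\infty$, so finiteness of $\int_0^\infty\frac1s\,d\mu(s)$ forces $\mu(\{0\})=0$; $0\cdot\infty=0$; $\int_0^\infty$ is integration over $\mathbb R_+$. *)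

theory Defs
  imports "HOL-Probability.Probability" "HOL-Library.Extended_Nat" "HOL-Library.Function_Algebras"
begin

section \<open>Complex Hilbert spaces and operators in them\<close>

text \<open>A Hilbert space is a linear subspace \<^term>\<open>carr H\<close> of a type with additive group structure,
  so that function spaces such as \<open>\<ell>\<^sup>2(V)\<close> with a varying index set \<open>V\<close> are covered.
  The inner product is linear in the first argument.\<close>

record 'a hspace =
  carr :: "'a set"
  scl :: "complex \<Rightarrow> 'a \<Rightarrow> 'a"
  ip :: "'a \<Rightarrow> 'a \<Rightarrow> complex"

definition hnorm :: "'a hspace \<Rightarrow> 'a \<Rightarrow> real" where
  "hnorm H x = sqrt (Re (ip H x x))"

locale complex_hilbert_space = vector_space "scl H" for H :: "'a::ab_group_add hspace" +
  assumes subspace_carr: "subspace (carr H)"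
    and ip_cnj: "\<And>x y. x \<in> carr H \<Longrightarrow> y \<in> carr H \<Longrightarrow> ip H y x = cnj (ip H x y)"
    and ip_add: "\<And>x y z. x \<in> carr H \<Longrightarrow> y \<in> carr H \<Longrightarrow> z \<in> carr H \<Longrightarrow>
                   ip H (x + y) z = ip H x z + ip H y z"
    and ip_scale: "\<And>c x y. x \<in> carr H \<Longrightarrow> y \<in> carr H \<Longrightarrow> ip H (scl H c x) y = c * ip H x y"
    and ip_nonneg: "\<And>x. x \<in> carr H \<Longrightarrow> 0 \<le> Re (ip H x x)"
    and ip_eq_0: "\<And>x. x \<in> carr H \<Longrightarrow> ip H x x = 0 \<Longrightarrow> x = 0"
    and complete: "\<And>X. (\<And>n. X n \<in> carr H) \<Longrightarrow>
                     (\<And>e. e > 0 \<Longrightarrow> \<exists>M::nat. \<forall>m\<ge>M. \<forall>n\<ge>M. hnorm H (X m - X n) < e) \<Longrightarrow>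
                     \<exists>x\<in>carr H. (\<lambda>n. hnorm H (X n - x)) \<longlonglongrightarrow> 0"

text \<open>Operators are identified with their graphs. Thus the domain of \<open>T\<close> is \<^term>\<open>Domain T\<close>,
  the powers are \<^term>\<open>T ^^ n\<close>, and the product \<open>A B\<close> (first \<open>B\<close>, then \<open>A\<close>)
  is the relational composition \<^term>\<open>B O A\<close>.\<close>

definition linear_operator :: "'a::ab_group_add hspace \<Rightarrow> 'a rel \<Rightarrow> bool" where
  "linear_operator H T \<longleftrightarrow>
     T \<subseteq> carr H \<times> carr H \<and> single_valued T \<and> (0, 0) \<in> T \<and>
     (\<forall>x y x' y'. (x, y) \<in> T \<longrightarrow> (x', y') \<in> T \<longrightarrow> (x + x', y + y') \<in> T) \<and>
     (\<forall>c x y. (x, y) \<in> T \<longrightarrow> (scl H c x, scl H c y) \<in> T)"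

definition densely_defined :: "'a::ab_group_add hspace \<Rightarrow> 'a rel \<Rightarrow> bool" where
  "densely_defined H T \<longleftrightarrow> (\<forall>x\<in>carr H. \<forall>e>0. \<exists>y\<in>Domain T. hnorm H (x - y) < e)"

definition closed_operator :: "'a::ab_group_add hspace \<Rightarrow> 'a rel \<Rightarrow> bool" where
  "closed_operator H T \<longleftrightarrow>
     (\<forall>X Y. \<forall>x\<in>carr H. \<forall>y\<in>carr H. (\<forall>n. (X n, Y n) \<in> T) \<longrightarrow>
        (\<lambda>n. hnorm H (X n - x)) \<longlonglongrightarrow> 0 \<longrightarrow> (\<lambda>n. hnorm H (Y n - y)) \<longlonglongrightarrow> 0 \<longrightarrow> (x, y) \<in> T)"

definition adjoint_op :: "'a hspace \<Rightarrow> 'a rel \<Rightarrow> 'a rel" where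
  "adjoint_op H T =
     {(y, z). y \<in> carr H \<and> z \<in> carr H \<and> (\<forall>(x, w)\<in>T. ip H w y = ip H x z)}"

definition normal_operator :: "'a::ab_group_add hspace \<Rightarrow> 'a rel \<Rightarrow> bool" where
  "normal_operator H N \<longleftrightarrow>
     linear_operator H N \<and> densely_defined H N \<and> closed_operator H N \<and>
     N O adjoint_op H N = adjoint_op H N O N"

definition isometric_embedding ::
  "'a::ab_group_add hspace \<Rightarrow> 'b::ab_group_add hspace \<Rightarrow> ('a \<Rightarrow> 'b) \<Rightarrow> bool" where
  "isometric_embedding H K J \<longleftrightarrow>
     (\<forall>x\<in>carr H. J x \<in> carr K) \<and>
     (\<forall>x\<in>carr H. \<forall>y\<in>carr H. J (x + y) = J x + J y) \<and>
     (\<forall>c. \<forall>x\<in>carr H. J (scl H c x) = scl K c (J x)) \<and>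
     (\<forall>x\<in>carr H. \<forall>y\<in>carr H. ip K (J x) (J y) = ip H x y)"

text \<open>HOL cannot quantify existentially over types, so the type \<open>'k\<close> carrying the larger space is
  a parameter. In a theorem that assumes subnormality, \<open>'k\<close> is a free type variable; the
  assumption then reads: there is a normal extension in some Hilbert space whatsoever.\<close>

definition subnormal ::
  "'k::ab_group_add itself \<Rightarrow> 'a::ab_group_add hspace \<Rightarrow> 'a rel \<Rightarrow> bool" where
  "subnormal _ H S \<longleftrightarrow>
     linear_operator H S \<and> densely_defined H S \<and>
     (\<exists>(K :: 'k hspace) N J. complex_hilbert_space K \<and> normal_operator K N \<and>
        isometric_embedding H K J \<and> (\<forall>(f, g)\<in>S. (J f, J g) \<in> N))"

definition D_infinity :: "'a hspace \<Rightarrow> 'a rel \<Rightarrow> 'a set" where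
  "D_infinity H T = {f \<in> carr H. \<forall>n. f \<in> Domain (T ^^ n)}"

definition op_apply :: "'a rel \<Rightarrow> 'a \<Rightarrow> 'a" where
  "op_apply T f = (THE g. (f, g) \<in> T)"

text \<open>In \<^typ>\<open>ennreal\<close> we have \<open>inverse 0 = \<infinity>\<close>, and every series converges. The index of the
  series is shifted by one.\<close>

definition quasi_analytic :: "'a hspace \<Rightarrow> 'a rel \<Rightarrow> 'a set" where
  "quasi_analytic H T =
     {f \<in> D_infinity H T.
        (\<Sum>n. inverse (ennreal (root (Suc n) (hnorm H (op_apply (T ^^ Suc n) f))))) = \<infinity>}"

definition ell2 :: "'v set \<Rightarrow> ('v \<Rightarrow> complex) hspace" where
  "ell2 V =
     \<lparr>carr = {f. (\<forall>v. v \<notin> V \<longrightarrow> f v = 0) \<and> (\<lambda>v. (cmod (f v))\<^sup>2) summable_on V},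
      scl = (\<lambda>c f v. c * f v),
      ip = (\<lambda>f g. \<Sum>\<^sub>\<infinity>v\<in>V. f v * cnj (g v))\<rparr>"

definition unit_vec :: "'v \<Rightarrow> 'v \<Rightarrow> complex" where
  "unit_vec u = (\<lambda>v. if v = u then 1 else 0)"

section \<open>Weighted shifts on directed trees with one branching vertex\<close>

text \<open>\<open>Trunk k\<close> is the vertex \<open>-k\<close> (in particular \<open>Trunk 0\<close> is the branching vertex \<open>0\<close>),
  and \<open>Branch i j\<close> is the vertex \<open>(i, j)\<close>.\<close>

datatype vertex = Trunk nat | Branch nat nat

definition J_set :: "enat \<Rightarrow> nat set" where
  "J_set \<iota> = {k. 1 \<le> k \<and> enat k \<le> \<iota>}"

definition tree_V :: "enat \<Rightarrow> enat \<Rightarrow> vertex set" where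
  "tree_V \<eta> \<kappa> = {Trunk k | k. k \<in> J_set \<kappa>} \<union> {Trunk 0} \<union> {Branch i j | i j. i \<in> J_set \<eta> \<and> 1 \<le> j}"

definition tree_E :: "enat \<Rightarrow> enat \<Rightarrow> (vertex \<times> vertex) set" where
  "tree_E \<eta> \<kappa> =
     {(Trunk k, Trunk (k - 1)) | k. k \<in> J_set \<kappa>} \<union>
     {(Trunk 0, Branch i 1) | i. i \<in> J_set \<eta>} \<union>
     {(Branch i j, Branch i (j + 1)) | i j. i \<in> J_set \<eta> \<and> 1 \<le> j}"

definition tree_par :: "enat \<Rightarrow> enat \<Rightarrow> vertex \<Rightarrow> vertex" where
  "tree_par \<eta> \<kappa> v = (THE u. (u, v) \<in> tree_E \<eta> \<kappa>)"

definition tree_V_nonroot :: "enat \<Rightarrow> enat \<Rightarrow> vertex set" where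
  "tree_V_nonroot \<eta> \<kappa> = {v \<in> tree_V \<eta> \<kappa>. \<forall>k. \<kappa> = enat k \<longrightarrow> v \<noteq> Trunk k}"

definition Lambda_map ::
  "enat \<Rightarrow> enat \<Rightarrow> (vertex \<Rightarrow> complex) \<Rightarrow> (vertex \<Rightarrow> complex) \<Rightarrow> (vertex \<Rightarrow> complex)" where
  "Lambda_map \<eta> \<kappa> lam f =
     (\<lambda>v. if v \<in> tree_V_nonroot \<eta> \<kappa> then lam v * f (tree_par \<eta> \<kappa> v) else 0)"

definition weighted_shift ::
  "enat \<Rightarrow> enat \<Rightarrow> (vertex \<Rightarrow> complex) \<Rightarrow> (vertex \<Rightarrow> complex) rel" where
  "weighted_shift \<eta> \<kappa> lam =
     {(f, g). f \<in> carr (ell2 (tree_V \<eta> \<kappa>)) \<and> g \<in> carr (ell2 (tree_V \<eta> \<kappa>)) \<and>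
              g = Lambda_map \<eta> \<kappa> lam f}"

section \<open>Stieltjes moment sequences\<close>

definition Rplus_borel :: "real measure" where
  "Rplus_borel = restrict_space borel {0..}"

definition represents :: "real measure \<Rightarrow> (nat \<Rightarrow> real) \<Rightarrow> bool" where
  "represents \<mu> t \<longleftrightarrow>
     sets \<mu> = sets Rplus_borel \<and> (\<forall>n. has_bochner_integral \<mu> (\<lambda>s. s ^ n) (t n))"

definition stieltjes_moment_sequence :: "(nat \<Rightarrow> real) \<Rightarrow> bool" where
  "stieltjes_moment_sequence t \<longleftrightarrow> (\<exists>\<mu>. represents \<mu> t)"

definition determinate_stieltjes :: "(nat \<Rightarrow> real) \<Rightarrow> bool" where
  "determinate_stieltjes t \<longleftrightarrow>
     stieltjes_moment_sequence t \<and> (\<forall>\<mu> \<nu>. represents \<mu> t \<longrightarrow> represents \<nu> t \<longrightarrow> \<mu> = \<nu>)"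

definition borel_prob_Rplus :: "real measure \<Rightarrow> bool" where
  "borel_prob_Rplus \<mu> \<longleftrightarrow> prob_space \<mu> \<and> sets \<mu> = sets Rplus_borel"

section \<open>The conditions on weights and measures\<close>

text \<open>The sums over \<^term>\<open>J_set \<eta>\<close> may be infinite, and \<^const>\<open>infsum\<close> of a divergent real sum is 0;
  hence the explicit summability requirement.\<close>

definition cond_D :: "enat \<Rightarrow> (vertex \<Rightarrow> complex) \<Rightarrow> bool" where
  "cond_D \<eta> lam \<longleftrightarrow>
     (\<forall>n. (\<lambda>i. (cmod (\<Prod>j=1..n+1. lam (Branch i j)))\<^sup>2) summable_on J_set \<eta>) \<and>
     determinate_stieltjes (\<lambda>n. \<Sum>\<^sub>\<infinity>i\<in>J_set \<eta>. (cmod (\<Prod>j=1..n+1. lam (Branch i j)))\<^sup>2)"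

definition cond_1 :: "enat \<Rightarrow> (vertex \<Rightarrow> complex) \<Rightarrow> (nat \<Rightarrow> real measure) \<Rightarrow> bool" where
  "cond_1 \<eta> lam \<mu> \<longleftrightarrow>
     (\<forall>n\<ge>1. \<forall>i\<in>J_set \<eta>.
        has_bochner_integral (\<mu> i) (\<lambda>s. s ^ n) ((cmod (\<Prod>j=2..n+1. lam (Branch i j)))\<^sup>2))"

text \<open>The sum \<open>\<Sum>\<^sub>i |\<lambda>\<^sub>i\<^sub>,\<^sub>1|\<^sup>2 \<integral>\<^sub>\<sigma> s\<^sup>-\<^sup>m d\<mu>\<^sub>i(s)\<close> with values in \<open>[0, \<infinity>]\<close>; in \<^typ>\<open>ennreal\<close>
  we have \<open>1 / 0 = \<infinity>\<close> and \<open>0 * \<infinity> = 0\<close>.\<close>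

definition neg_moment_sum ::
  "enat \<Rightarrow> (vertex \<Rightarrow> complex) \<Rightarrow> (nat \<Rightarrow> real measure) \<Rightarrow> nat \<Rightarrow> real set \<Rightarrow> ennreal" where
  "neg_moment_sum \<eta> lam \<mu> m \<sigma> =
     (\<Sum>\<^sub>\<infinity>i\<in>J_set \<eta>. ennreal ((cmod (lam (Branch i 1)))\<^sup>2) *
        (\<integral>\<^sup>+s\<in>\<sigma>. (1 / ennreal (s ^ m)) \<partial>\<mu> i))"

definition cond_2 :: "enat \<Rightarrow> (vertex \<Rightarrow> complex) \<Rightarrow> (nat \<Rightarrow> real measure) \<Rightarrow> bool" where
  "cond_2 \<eta> lam \<mu> \<longleftrightarrow> neg_moment_sum \<eta> lam \<mu> 1 {0..} = 1"

definition cond_3 :: "enat \<Rightarrow> enat \<Rightarrow> (vertex \<Rightarrow> complex) \<Rightarrow> (nat \<Rightarrow> real measure) \<Rightarrow> bool" where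
  "cond_3 \<eta> \<kappa> lam \<mu> \<longleftrightarrow>
     (\<forall>l\<in>J_set (\<kappa> - 1).
        ennreal ((cmod (\<Prod>j<l. lam (Trunk j)))\<^sup>2) * neg_moment_sum \<eta> lam \<mu> (l + 1) {0..} = 1)"

end

theory Submission
  imports Defs "HOL-Computational_Algebra.Fundamental_Theorem_Algebra"
begin

text \<open>The theorem rests on two facts about moments. First, if \<open>S\<close> is subnormal and all powers of \<open>S\<close>
are defined at a vector \<open>f\<close>, then the numbers \<open>\<parallel>S\<^sup>n f\<parallel>\<^sup>2\<close> form a Stieltjes moment sequence. Second, a
determinate moment sequence forces any two measures that arise from it to coincide.

Apply the first fact to the basis vectors \<open>e\<close> at the vertices \<open>(i, 1)\<close> and \<open>-k\<close>. The iterates of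
the first one stay on one branch, so its measure \<open>\<mu>\<^sub>i\<close> has the moments asked for in \<open>cond_1\<close>.
For the second one let \<open>\<nu>\<^sub>k\<close> be the measure and \<open>C\<^sub>k\<close> the squared modulus of the product of the
weights on the path from \<open>-k\<close> to \<open>0\<close>. After \<open>k\<close> steps the shift has carried \<open>e\<close> at \<open>-k\<close> to a multiple of
\<open>e\<^sub>0\<close>, so for \<open>n > k\<close> the \<open>n\<close>-th moment of \<open>\<nu>\<^sub>k\<close> is \<open>C\<^sub>k\<close> times the squared norm of an iterate of
\<open>e\<^sub>0\<close>, which is a sum over the branches. Hence \<open>s\<^sup>k\<^sup>+\<^sup>1 d\<nu>\<^sub>k / C\<^sub>k\<close> and \<open>\<Sum>\<^sub>i |\<lambda>\<^sub>i\<^sub>,\<^sub>1|\<^sup>2 d\<mu>\<^sub>i\<close> represent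
the sequence in \<open>cond_D\<close>, and by determinacy they are the same measure. Dividing by powers of \<open>s\<close> turns
this identity into everything that is claimed: the sum with \<open>s\<^sup>-\<^sup>k\<^sup>-\<^sup>1\<close> is the mass of \<open>\<nu>\<^sub>k\<close> off \<open>0\<close>
divided by \<open>C\<^sub>k\<close>, which is at most \<open>1 / C\<^sub>k\<close>; the sum with \<open>s\<^sup>-\<^sup>k\<close> is the first moment of \<open>\<nu>\<^sub>k\<close>
divided by \<open>C\<^sub>k\<close>, which is known exactly; and the sum with \<open>s\<^sup>-\<^sup>1\<close> over a Borel set is the third
assertion. This is lemma \<open>negative_moment_identity\<close>.

For the first fact the spectral theorem is replaced by two elementary steps. On the common domain of
all powers of a normal operator \<open>N\<close>, the operators \<open>N\<close> and \<open>N*\<close> commute, so that \<open>\<parallel>N\<^sup>i\<^sup>+\<^sup>j f\<parallel>\<^sup>2\<close>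
is the inner product of \<open>(N*N)\<^sup>i f\<close> and \<open>(N*N)\<^sup>j f\<close>; this makes the Hankel forms of the sequence
and of the shifted sequence nonnegative (\<open>subnormal_stieltjes_positive\<close>). The subtle point is that
vectors in the domain of \<open>N\<close> lie in the domain of \<open>N*\<close> (\<open>Domain_subset_adj\<close>). Given the positivity,
Gauss quadrature produces finitely supported measures with the right moments up to any prescribed
order, and the selection theorem of Helly yields a limit (\<open>stieltjes_moment_existence\<close>).

The last claim is the determinacy criterion of Carleman. If two measures have the same moments, the
difference of the cosine transforms of their images under the square root has all derivatives zero
at the origin, and the moments bound these derivatives. The argument of Bang
(\<open>quasi_analytic_family_vanishes\<close>) shows that such a function vanishes, and the uniqueness theorem
of Levy identifies the measures. The divergence needed there concerns ratios of consecutive moments;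
so it is insensitive to an index shift, and it follows from the divergence of the Carleman series by
an inequality for geometric means (\<open>summable_geometric_means\<close>).\<close>

section \<open>Orthogonal projection in Hilbert spaces\<close>

context complex_hilbert_space
begin

lemma carr_zero [simp]: "0 \<in> carr H"
  using subspace_0[OF subspace_carr] .

lemma carr_add [simp]: "x \<in> carr H \<Longrightarrow> y \<in> carr H \<Longrightarrow> x + y \<in> carr H"
  using subspace_add[OF subspace_carr] .

lemma carr_scl [simp]: "x \<in> carr H \<Longrightarrow> scl H c x \<in> carr H"
  using subspace_scale[OF subspace_carr] .

lemma carr_diff [simp]: "x \<in> carr H \<Longrightarrow> y \<in> carr H \<Longrightarrow> x - y \<in> carr H"
  using subspace_diff[OF subspace_carr] .

lemma carr_sum: "(\<And>i. i \<in> I \<Longrightarrow> f i \<in> carr H) \<Longrightarrow> sum f I \<in> carr H"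
  using subspace_sum[OF subspace_carr] .

lemma ip_add_right:
  assumes "x \<in> carr H" "y \<in> carr H" "z \<in> carr H"
  shows "ip H x (y + z) = ip H x y + ip H x z"
  using assms ip_cnj[of x "y + z"] ip_cnj[of x y] ip_cnj[of x z] ip_add[of y z x]
  by (metis carr_add complex_cnj_add complex_cnj_cnj)

lemma ip_scale_right:
  assumes "x \<in> carr H" "y \<in> carr H"
  shows "ip H x (scl H c y) = cnj c * ip H x y"
  by (metis assms carr_scl complex_cnj_cnj complex_cnj_mult ip_cnj ip_scale)

lemma ip_zero_left [simp]: "x \<in> carr H \<Longrightarrow> ip H 0 x = 0"
  using ip_add[of 0 0 x] by simp

lemma ip_zero_right [simp]: "x \<in> carr H \<Longrightarrow> ip H x 0 = 0"
  using ip_add_right[of x 0 0] by simp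

lemma ip_diff:
  assumes "x \<in> carr H" "y \<in> carr H" "z \<in> carr H"
  shows "ip H (x - y) z = ip H x z - ip H y z"
  using ip_add[of "x - y" y z] assms by simp

lemma ip_diff_right:
  assumes "x \<in> carr H" "y \<in> carr H" "z \<in> carr H"
  shows "ip H x (y - z) = ip H x y - ip H x z"
  using ip_add_right[of x "y - z" z] assms by simp

lemma carr_minus [simp]: "x \<in> carr H \<Longrightarrow> - x \<in> carr H"
  using carr_diff[of 0 x] by simp

lemma ip_minus: "x \<in> carr H \<Longrightarrow> y \<in> carr H \<Longrightarrow> ip H (- x) y = - ip H x y"
  using ip_diff[of 0 x y] by simp

lemma ip_sum_left:
  assumes "\<And>i. i \<in> I \<Longrightarrow> f i \<in> carr H" "z \<in> carr H"
  shows "ip H (sum f I) z = (\<Sum>i\<in>I. ip H (f i) z)"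
  using assms by (induction I rule: infinite_finite_induct) (auto simp: ip_add carr_sum)

lemma ip_sum_right:
  assumes "\<And>i. i \<in> I \<Longrightarrow> f i \<in> carr H" "z \<in> carr H"
  shows "ip H z (sum f I) = (\<Sum>i\<in>I. ip H z (f i))"
  using assms by (induction I rule: infinite_finite_induct) (auto simp: ip_add_right carr_sum)

lemma ip_self: "x \<in> carr H \<Longrightarrow> ip H x x = of_real ((hnorm H x)\<^sup>2)"
  using ip_cnj[of x x] ip_nonneg[of x] unfolding hnorm_def
  by (simp add: complex_eq_iff)

lemma hnorm_nonneg [simp]: "x \<in> carr H \<Longrightarrow> 0 \<le> hnorm H x"
  using ip_nonneg[of x] unfolding hnorm_def by simp

lemma hnorm_eq_0: "x \<in> carr H \<Longrightarrow> hnorm H x = 0 \<longleftrightarrow> x = 0"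
  using ip_self[of x] ip_eq_0[of x] by (auto simp: hnorm_def)

lemma hnorm_sq: "x \<in> carr H \<Longrightarrow> (hnorm H x)\<^sup>2 = Re (ip H x x)"
  using ip_self[of x] by simp

lemma hnorm_scl:
  assumes x: "x \<in> carr H"
  shows "hnorm H (scl H c x) = cmod c * hnorm H x"
proof (rule power2_eq_imp_eq)
  have "ip H (scl H c x) (scl H c x) = (c * cnj c) * ip H x x"
    using x by (simp add: ip_scale ip_scale_right)
  also have "\<dots> = of_real ((cmod c)\<^sup>2 * (hnorm H x)\<^sup>2)"
    by (simp only: ip_self[OF x] complex_norm_square[symmetric] of_real_mult)
  finally show "(hnorm H (scl H c x))\<^sup>2 = (cmod c * hnorm H x)\<^sup>2"
    using x by (simp add: hnorm_sq[of "scl H c x"] power_mult_distrib)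
qed (use x in simp_all)

lemma hnorm_diff_sq:
  assumes "x \<in> carr H" "y \<in> carr H"
  shows "(hnorm H (x - y))\<^sup>2 = (hnorm H x)\<^sup>2 - 2 * Re (ip H x y) + (hnorm H y)\<^sup>2"
  using assms ip_cnj[of x y] by (simp add: hnorm_sq ip_diff ip_diff_right)

lemma hnorm_add_sq:
  assumes "x \<in> carr H" "y \<in> carr H"
  shows "(hnorm H (x + y))\<^sup>2 = (hnorm H x)\<^sup>2 + 2 * Re (ip H x y) + (hnorm H y)\<^sup>2"
  using assms ip_cnj[of x y] by (simp add: hnorm_sq ip_add ip_add_right)

lemma hnorm_minus_commute: "x \<in> carr H \<Longrightarrow> y \<in> carr H \<Longrightarrow> hnorm H (x - y) = hnorm H (y - x)"
  unfolding hnorm_def by (simp add: ip_diff ip_diff_right)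

lemma Cauchy_Schwarz:
  assumes x: "x \<in> carr H" and y: "y \<in> carr H"
  shows "cmod (ip H x y) \<le> hnorm H x * hnorm H y"
proof (cases "y = 0")
  case False
  define b where "b = (hnorm H y)\<^sup>2"
  define a where "a = ip H x y"
  have b: "b > 0" using False y hnorm_eq_0[of y] by (simp add: b_def)
  define c where "c = a / of_real b"
  have "0 \<le> (hnorm H (x - scl H c y))\<^sup>2" by simp
  also have "\<dots> = (hnorm H x)\<^sup>2 - 2 * Re (cnj c * a) + (cmod c)\<^sup>2 * b"
    using x y by (simp add: hnorm_diff_sq ip_scale_right hnorm_scl power_mult_distrib a_def b_def)
  also have "cnj c * a = of_real ((cmod a)\<^sup>2 / b)"
    unfolding c_def by (simp add: complex_norm_square mult.commute del: of_real_power)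
  also have "(cmod c)\<^sup>2 * b = (cmod a)\<^sup>2 / b"
    unfolding c_def using b by (simp add: norm_divide power_divide power2_eq_square)
  finally have "(cmod a)\<^sup>2 / b \<le> (hnorm H x)\<^sup>2" by simp
  then have "(cmod a)\<^sup>2 \<le> (hnorm H x * hnorm H y)\<^sup>2"
    using b by (simp add: field_simps power_mult_distrib b_def)
  then show ?thesis
    using x y by (simp add: a_def power2_le_iff_abs_le)
qed (use x in simp)

lemma hnorm_triangle:
  assumes x: "x \<in> carr H" and y: "y \<in> carr H"
  shows "hnorm H (x + y) \<le> hnorm H x + hnorm H y"
proof (rule power2_le_imp_le)
  have "Re (ip H x y) \<le> hnorm H x * hnorm H y"
    using Cauchy_Schwarz[OF x y] complex_Re_le_cmod order_trans by blast
  then show "(hnorm H (x + y))\<^sup>2 \<le> (hnorm H x + hnorm H y)\<^sup>2"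
    using x y by (simp add: hnorm_add_sq power2_sum)
qed (use x y in simp)

lemma ip_tendsto:
  assumes "\<And>n. X n \<in> carr H" "x \<in> carr H" "y \<in> carr H"
    and "(\<lambda>n. hnorm H (X n - x)) \<longlonglongrightarrow> 0"
  shows "(\<lambda>n. ip H (X n) y) \<longlonglongrightarrow> ip H x y"
proof -
  have "(\<lambda>n. ip H (X n) y - ip H x y) \<longlonglongrightarrow> 0"
  proof (rule Lim_null_comparison)
    show "\<forall>\<^sub>F n in sequentially. norm (ip H (X n) y - ip H x y) \<le> hnorm H (X n - x) * hnorm H y"
      using assms Cauchy_Schwarz by (simp add: ip_diff[symmetric])
    show "(\<lambda>n. hnorm H (X n - x) * hnorm H y) \<longlonglongrightarrow> 0"
      using tendsto_mult_left_zero[OF assms(4)] .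
  qed
  then show ?thesis by (simp add: LIM_zero_iff)
qed

lemma ip_tendsto_right:
  assumes "\<And>n. X n \<in> carr H" "x \<in> carr H" "y \<in> carr H"
    and "(\<lambda>n. hnorm H (X n - x)) \<longlonglongrightarrow> 0"
  shows "(\<lambda>n. ip H y (X n)) \<longlonglongrightarrow> ip H y x"
proof -
  have "cnj (ip H (X n) y) = ip H y (X n)" for n by (rule ip_cnj[OF assms(1) assms(3), symmetric])
  moreover have "cnj (ip H x y) = ip H y x" by (rule ip_cnj[OF assms(2) assms(3), symmetric])
  ultimately show ?thesis using tendsto_cnj[OF ip_tendsto[OF assms]] by simp
qed

lemma Cauchy_of_convergent:
  assumes "\<And>n. X n \<in> carr H" "x \<in> carr H" "(\<lambda>n. hnorm H (X n - x)) \<longlonglongrightarrow> 0" "e > 0"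
  shows "\<exists>M::nat. \<forall>m\<ge>M. \<forall>n\<ge>M. hnorm H (X m - X n) < e"
proof -
  obtain M where M: "\<And>n. n \<ge> M \<Longrightarrow> hnorm H (X n - x) < e / 2"
    using order_tendstoD(2)[OF assms(3), of "e / 2"] \<open>e > 0\<close>
    by (auto simp: eventually_sequentially)
  have "hnorm H (X m - X n) < e" if "m \<ge> M" "n \<ge> M" for m n
  proof -
    have "hnorm H (X m - X n) = hnorm H ((X m - x) + (x - X n))" by simp
    also have "\<dots> \<le> hnorm H (X m - x) + hnorm H (x - X n)"
      by (intro hnorm_triangle carr_diff assms(1,2))
    also have "hnorm H (x - X n) = hnorm H (X n - x)"
      by (rule hnorm_minus_commute[OF assms(2,1)])
    also have "hnorm H (X m - x) + hnorm H (X n - x) < e"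
      using M[OF that(1)] M[OF that(2)] by simp
    finally show ?thesis .
  qed
  then show ?thesis by blast
qed

text \<open>A minimizing sequence for the distance from \<open>p\<close> to \<open>G\<close> is Cauchy by the parallelogram law. The
projection \<open>q\<close> onto the closure of \<open>G\<close> comes with a sequence in \<open>G\<close> that tends to it. In this form
the lemma applies to a closed graph and also to the graph of a restriction of an operator.\<close>

lemma orthogonal_projection:
  assumes G: "subspace G" "G \<subseteq> carr H" and p: "p \<in> carr H"
  shows "\<exists>X q. (\<forall>n. X n \<in> G) \<and> q \<in> carr H \<and> (\<lambda>n::nat. hnorm H (X n - q)) \<longlonglongrightarrow> 0 \<and>
    (\<forall>g\<in>G. ip H (p - q) g = 0)"
proof -
  define d where "d = (INF g\<in>G. (hnorm H (p - g))\<^sup>2)"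
  have G0: "G \<noteq> {}" using subspace_0[OF G(1)] by blast
  have bdd: "bdd_below ((\<lambda>g. (hnorm H (p - g))\<^sup>2) ` G)"
    by (rule bdd_belowI2[of _ 0]) (rule zero_le_power2)
  have d_le: "d \<le> (hnorm H (p - g))\<^sup>2" if "g \<in> G" for g
    unfolding d_def using bdd that by (rule cINF_lower)
  have "\<exists>g\<in>G. (hnorm H (p - g))\<^sup>2 < d + 1 / real (Suc n)" for n
    unfolding d_def by (rule cINF_less_iff[OF G0 bdd, THEN iffD1]) simp
  then obtain X where X: "\<And>n. X n \<in> G" "\<And>n. (hnorm H (p - X n))\<^sup>2 < d + 1 / real (Suc n)"
    by metis
  have XH: "X n \<in> carr H" for n using X G by blast
  have dist: "(hnorm H (X m - X n))\<^sup>2 \<le> 2 * (1 / real (Suc m)) + 2 * (1 / real (Suc n))" for m n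
  proof -
    define u v where "u = p - X m" and "v = p - X n"
    have uv: "u \<in> carr H" "v \<in> carr H" using p XH by (auto simp: u_def v_def)
    define g where "g = scl H (1/2) (X m + X n)"
    have "g \<in> G" unfolding g_def using G X by (intro subspace_scale subspace_add)
    have "scl H 2 (p - g) = scl H 2 p - (X m + X n)"
      by (simp add: scale_right_diff_distrib g_def)
    also have "scl H 2 p = p + p"
      using scale_left_distrib[of 1 1 p] by simp
    finally have "scl H 2 (p - g) = u + v" by (simp add: u_def v_def)
    then have "(hnorm H (u + v))\<^sup>2 = 4 * (hnorm H (p - g))\<^sup>2"
      using hnorm_scl[of "p - g" 2] p \<open>g \<in> G\<close> G by (auto simp: power_mult_distrib)
    then have "(hnorm H (u + v))\<^sup>2 \<ge> 4 * d" using d_le[OF \<open>g \<in> G\<close>] by simp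
    moreover have "(hnorm H (u + v))\<^sup>2 + (hnorm H (u - v))\<^sup>2 = 2 * (hnorm H u)\<^sup>2 + 2 * (hnorm H v)\<^sup>2"
      using uv by (simp add: hnorm_add_sq hnorm_diff_sq)
    moreover have "hnorm H (u - v) = hnorm H (X m - X n)"
      unfolding u_def v_def using hnorm_minus_commute[OF XH XH] by simp
    moreover have "(hnorm H u)\<^sup>2 \<le> d + 1 / real (Suc m)" "(hnorm H v)\<^sup>2 \<le> d + 1 / real (Suc n)"
      unfolding u_def v_def using X(2) less_imp_le by auto
    ultimately show ?thesis by (smt (verit) power2_eq_square)
  qed
  have "\<exists>M::nat. \<forall>m\<ge>M. \<forall>n\<ge>M. hnorm H (X m - X n) < e" if "e > 0" for e
  proof -
    obtain M where M: "1 / real (Suc M) < e\<^sup>2 / 4"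
      using nat_approx_posE[of "e\<^sup>2 / 4"] \<open>e > 0\<close> by (metis zero_less_divide_iff zero_less_power zero_less_numeral)
    have "hnorm H (X m - X n) < e" if "m \<ge> M" "n \<ge> M" for m n
    proof -
      have "1 / real (Suc m) \<le> 1 / real (Suc M)" "1 / real (Suc n) \<le> 1 / real (Suc M)"
        using that by (auto intro!: divide_left_mono)
      then have "(hnorm H (X m - X n))\<^sup>2 < e\<^sup>2" using dist[of m n] M by simp
      then show ?thesis using \<open>e > 0\<close> by (simp add: power2_less_imp_less)
    qed
    then show ?thesis by blast
  qed
  then obtain q where q: "q \<in> carr H" "(\<lambda>n. hnorm H (X n - q)) \<longlonglongrightarrow> 0"
    using complete[of X] XH by blast
  have "ip H (p - q) g = 0" if g: "g \<in> G" for g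
  proof -
    have gH: "g \<in> carr H" using g G by blast
    \<comment> \<open>Adding \<open>s \<alpha>\<^sub>n g\<close> to \<open>X n\<close>, with \<open>\<alpha>\<^sub>n\<close> the
      inner product of \<open>p - X n\<close> and \<open>g\<close>, lowers the squared distance by at least
      \<open>s |\<alpha>\<^sub>n|\<^sup>2\<close> if \<open>s\<close> is this small.\<close>
    define s where "s = 1 / ((hnorm H g)\<^sup>2 + 1)"
    have pos: "0 < (hnorm H g)\<^sup>2 + 1" by (rule add_nonneg_pos) simp_all
    then have s: "s > 0" "s * (hnorm H g)\<^sup>2 < 1"
      unfolding s_def by (simp_all add: field_simps)
    define \<alpha> where "\<alpha> n = ip H (p - X n) g" for n
    have "(\<lambda>n. ip H p g - ip H (X n) g) \<longlonglongrightarrow> ip H p g - ip H q g"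
      using ip_tendsto[OF XH q(1) gH q(2)] by (intro tendsto_intros)
    then have \<alpha>: "\<alpha> \<longlonglongrightarrow> ip H (p - q) g"
      unfolding \<alpha>_def using p q XH gH by (simp add: ip_diff)
    have "s * (cmod (\<alpha> n))\<^sup>2 \<le> 1 / real (Suc n)" for n
    proof -
      define c where "c = of_real s * \<alpha> n"
      have "X n + scl H c g \<in> G" using G X g by (intro subspace_add subspace_scale)
      then have "d \<le> (hnorm H ((p - X n) - scl H c g))\<^sup>2" using d_le by (force simp: diff_diff_add)
      also have "\<dots> = (hnorm H (p - X n))\<^sup>2 - 2 * Re (cnj c * \<alpha> n) + (cmod c)\<^sup>2 * (hnorm H g)\<^sup>2"
        using p XH gH
        by (simp add: hnorm_diff_sq[of "p - X n"] ip_scale_right hnorm_scl power_mult_distrib \<alpha>_def)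
      also have "cnj c * \<alpha> n = of_real (s * (cmod (\<alpha> n))\<^sup>2)"
        unfolding c_def by (simp add: complex_norm_square mult_ac del: of_real_power)
      also have "(cmod c)\<^sup>2 = s * (s * (cmod (\<alpha> n))\<^sup>2)"
        unfolding c_def by (simp add: norm_mult power2_eq_square)
      finally have "d \<le> (hnorm H (p - X n))\<^sup>2 - 2 * (s * (cmod (\<alpha> n))\<^sup>2)
          + (s * (cmod (\<alpha> n))\<^sup>2) * (s * (hnorm H g)\<^sup>2)" by (simp add: mult_ac)
      moreover have "(s * (cmod (\<alpha> n))\<^sup>2) * (s * (hnorm H g)\<^sup>2) \<le> (s * (cmod (\<alpha> n))\<^sup>2) * 1"
        using s by (intro mult_left_mono) auto
      ultimately show ?thesis using X(2)[of n] by simp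
    qed
    moreover have "(\<lambda>n. 1 / real (Suc n)) \<longlonglongrightarrow> 0"
      using LIMSEQ_inverse_real_of_nat by (simp add: inverse_eq_divide)
    moreover have "(\<lambda>n. s * (cmod (\<alpha> n))\<^sup>2) \<longlonglongrightarrow> s * (cmod (ip H (p - q) g))\<^sup>2"
      using \<alpha> by (intro tendsto_intros)
    ultimately have "s * (cmod (ip H (p - q) g))\<^sup>2 \<le> 0"
      by (intro LIMSEQ_le[of "\<lambda>n. s * (cmod (\<alpha> n))\<^sup>2" _ "\<lambda>n. 1 / real (Suc n)"]) auto
    then show ?thesis using s by (simp add: mult_le_0_iff)
  qed
  then show ?thesis using X(1) q by blast
qed

end

section \<open>Unbounded normal operators\<close>

text \<open>The graph of an operator in \<open>H\<close> is a subspace of this direct sum, so projecting onto a graph is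
a way to solve operator equations.\<close>

definition hprod :: "'a::ab_group_add hspace \<Rightarrow> ('a \<times> 'a) hspace" where
  "hprod H = \<lparr>carr = carr H \<times> carr H,
     scl = (\<lambda>c z. (scl H c (fst z), scl H c (snd z))),
     ip = (\<lambda>z w. ip H (fst z) (fst w) + ip H (snd z) (snd w))\<rparr>"

lemma hprod_simps [simp]:
  "carr (hprod H) = carr H \<times> carr H"
  "scl (hprod H) c z = (scl H c (fst z), scl H c (snd z))"
  "ip (hprod H) z w = ip H (fst z) (fst w) + ip H (snd z) (snd w)"
  by (simp_all add: hprod_def)

context complex_hilbert_space
begin

lemma hnorm_hprod:
  "z \<in> carr (hprod H) \<Longrightarrow> hnorm (hprod H) z = sqrt ((hnorm H (fst z))\<^sup>2 + (hnorm H (snd z))\<^sup>2)"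
  by (auto simp: hnorm_def[of "hprod H"] hnorm_sq)

lemma hnorm_fst_le: "z \<in> carr (hprod H) \<Longrightarrow> hnorm H (fst z) \<le> hnorm (hprod H) z"
  by (simp only: hnorm_hprod real_sqrt_sum_squares_ge1)

lemma hnorm_snd_le: "z \<in> carr (hprod H) \<Longrightarrow> hnorm H (snd z) \<le> hnorm (hprod H) z"
  by (simp only: hnorm_hprod real_sqrt_sum_squares_ge2)

lemma hprod_tendstoD:
  assumes "\<And>n. X n - (a, b) \<in> carr (hprod H)" "(\<lambda>n. hnorm (hprod H) (X n - (a, b))) \<longlonglongrightarrow> 0"
  shows "(\<lambda>n. hnorm H (fst (X n) - a)) \<longlonglongrightarrow> 0" "(\<lambda>n. hnorm H (snd (X n) - b)) \<longlonglongrightarrow> 0"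
proof -
  have "fst (X n) - a \<in> carr H" "snd (X n) - b \<in> carr H" for n
    using assms(1)[of n] by (auto simp: mem_Times_iff)
  then have "norm (hnorm H (fst (X n) - a)) \<le> hnorm (hprod H) (X n - (a, b))"
    "norm (hnorm H (snd (X n) - b)) \<le> hnorm (hprod H) (X n - (a, b))" for n
    using hnorm_fst_le[OF assms(1)] hnorm_snd_le[OF assms(1)] by simp_all
  then show "(\<lambda>n. hnorm H (fst (X n) - a)) \<longlonglongrightarrow> 0" "(\<lambda>n. hnorm H (snd (X n) - b)) \<longlonglongrightarrow> 0"
    by (auto intro: Lim_null_comparison[OF _ assms(2)])
qed

lemma complex_hilbert_space_hprod: "complex_hilbert_space (hprod H)"
proof -
  interpret P: vector_space "scl (hprod H)"
    by unfold_locales (simp_all add: scale_right_distrib scale_left_distrib)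
  show ?thesis
  proof (intro complex_hilbert_space.intro complex_hilbert_space_axioms.intro)
    show "vector_space (scl (hprod H))" by (rule P.vector_space_axioms)
    show "P.subspace (carr (hprod H))"
      by (rule P.subspaceI) (auto simp: zero_prod_def)
    fix x y z :: "'a \<times> 'a" and c
    assume x: "x \<in> carr (hprod H)"
    show "0 \<le> Re (ip (hprod H) x x)" using x ip_nonneg by auto
    show "x = 0" if "ip (hprod H) x x = 0"
    proof -
      have "of_real ((hnorm H (fst x))\<^sup>2 + (hnorm H (snd x))\<^sup>2) = (0::complex)"
        using x that ip_self by auto
      then have "(hnorm H (fst x))\<^sup>2 + (hnorm H (snd x))\<^sup>2 = 0"
        by (simp only: of_real_eq_0_iff)
      then have "hnorm H (fst x) = 0" "hnorm H (snd x) = 0"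
        by (simp_all add: sum_power2_eq_zero_iff)
      then show ?thesis using x hnorm_eq_0 by (auto simp: prod_eq_iff)
    qed
    assume y: "y \<in> carr (hprod H)"
    show "ip (hprod H) y x = cnj (ip (hprod H) x y)"
      using x y by (auto intro!: arg_cong2[of _ _ _ _ "(+)"] ip_cnj)
    show "ip (hprod H) (scl (hprod H) c x) y = c * ip (hprod H) x y"
      using x y by (auto simp: ip_scale distrib_left)
    assume z: "z \<in> carr (hprod H)"
    show "ip (hprod H) (x + y) z = ip (hprod H) x z + ip (hprod H) y z"
      using x y z by (auto simp: ip_add)
  next
    fix X :: "nat \<Rightarrow> 'a \<times> 'a"
    assume X: "\<And>n. X n \<in> carr (hprod H)"
      and C: "\<And>e. e > 0 \<Longrightarrow> \<exists>M. \<forall>m\<ge>M. \<forall>n\<ge>M. hnorm (hprod H) (X m - X n) < e"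
    have X1: "fst (X n) \<in> carr H" and X2: "snd (X n) \<in> carr H" for n
      using X[of n] by auto
    have D: "X m - X n \<in> carr (hprod H)" for m n
      using X1 X2 by (auto simp: mem_Times_iff)
    have "\<exists>M. \<forall>m\<ge>M. \<forall>n\<ge>M. hnorm H (fst (X m) - fst (X n)) < e" if e: "e > 0" for e
      using C[OF e] hnorm_fst_le[OF D] by (metis fst_diff order.strict_trans1)
    then obtain x where x: "x \<in> carr H" "(\<lambda>n. hnorm H (fst (X n) - x)) \<longlonglongrightarrow> 0"
      using complete[of "\<lambda>n. fst (X n)"] X1 by blast
    have "\<exists>M. \<forall>m\<ge>M. \<forall>n\<ge>M. hnorm H (snd (X m) - snd (X n)) < e" if e: "e > 0" for e
      using C[OF e] hnorm_snd_le[OF D] by (metis snd_diff order.strict_trans1)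
    then obtain y where y: "y \<in> carr H" "(\<lambda>n. hnorm H (snd (X n) - y)) \<longlonglongrightarrow> 0"
      using complete[of "\<lambda>n. snd (X n)"] X2 by blast
    have "X n - (x, y) \<in> carr (hprod H)" for n
      using X1 X2 x y by (auto simp: mem_Times_iff)
    then have "hnorm (hprod H) (X n - (x, y)) =
        sqrt ((hnorm H (fst (X n) - x))\<^sup>2 + (hnorm H (snd (X n) - y))\<^sup>2)" for n
      by (simp only: hnorm_hprod fst_diff snd_diff fst_conv snd_conv)
    moreover have "(\<lambda>n. sqrt ((hnorm H (fst (X n) - x))\<^sup>2 + (hnorm H (snd (X n) - y))\<^sup>2)) \<longlonglongrightarrow> sqrt (0\<^sup>2 + 0\<^sup>2)"
      using x y by (intro tendsto_intros)
    ultimately have "(\<lambda>n. hnorm (hprod H) (X n - (x, y))) \<longlonglongrightarrow> 0" by simp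
    then show "\<exists>x\<in>carr (hprod H). (\<lambda>n. hnorm (hprod H) (X n - x)) \<longlonglongrightarrow> 0"
      using x y by auto
  qed
qed

end

locale normal_in_hilbert_space = complex_hilbert_space H
  for H :: "'a::ab_group_add hspace" +
  fixes N :: "'a rel"
  assumes normal: "normal_operator H N"
begin

abbreviation "Nadj \<equiv> adjoint_op H N"

lemma N_carr: "(x, y) \<in> N \<Longrightarrow> x \<in> carr H" "(x, y) \<in> N \<Longrightarrow> y \<in> carr H"
  using normal unfolding normal_operator_def linear_operator_def by blast+

lemma N_unique: "(x, y) \<in> N \<Longrightarrow> (x, y') \<in> N \<Longrightarrow> y = y'"
  using normal unfolding normal_operator_def linear_operator_def by (meson single_valuedD)

lemma N_zero: "(0, 0) \<in> N"
  and N_add: "(x, y) \<in> N \<Longrightarrow> (x', y') \<in> N \<Longrightarrow> (x + x', y + y') \<in> N"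
  and N_scl: "(x, y) \<in> N \<Longrightarrow> (scl H c x, scl H c y) \<in> N"
  using normal unfolding normal_operator_def linear_operator_def by blast+

lemma N_diff: "(x, y) \<in> N \<Longrightarrow> (x', y') \<in> N \<Longrightarrow> (x - x', y - y') \<in> N"
  using N_add[of x y "scl H (-1) x'" "scl H (-1) y'"] N_scl[of x' y' "-1"] by simp

lemma N_closed:
  assumes "x \<in> carr H" "y \<in> carr H" "\<And>n. (X n, Y n) \<in> N"
    "(\<lambda>n. hnorm H (X n - x)) \<longlonglongrightarrow> 0" "(\<lambda>n. hnorm H (Y n - y)) \<longlonglongrightarrow> 0"
  shows "(x, y) \<in> N"
  using normal assms unfolding normal_operator_def closed_operator_def by blast

lemma adj_carr: "(x, y) \<in> Nadj \<Longrightarrow> x \<in> carr H" "(x, y) \<in> Nadj \<Longrightarrow> y \<in> carr H"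
  unfolding adjoint_op_def by auto

lemma adj_ip: "(x, w) \<in> N \<Longrightarrow> (y, z) \<in> Nadj \<Longrightarrow> ip H w y = ip H x z"
  unfolding adjoint_op_def by auto

lemma adjI:
  "y \<in> carr H \<Longrightarrow> z \<in> carr H \<Longrightarrow> (\<And>x w. (x, w) \<in> N \<Longrightarrow> ip H w y = ip H x z) \<Longrightarrow> (y, z) \<in> Nadj"
  unfolding adjoint_op_def by auto

lemma adj_diff:
  assumes "(x, y) \<in> Nadj" "(x', y') \<in> Nadj"
  shows "(x - x', y - y') \<in> Nadj"
proof (rule adjI)
  fix a w assume aw: "(a, w) \<in> N"
  show "ip H w (x - x') = ip H a (y - y')"
    using adj_ip[OF aw assms(1)] adj_ip[OF aw assms(2)] N_carr[OF aw] adj_carr[OF assms(1)] adj_carr[OF assms(2)]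
    by (simp add: ip_diff_right)
qed (use adj_carr[OF assms(1)] adj_carr[OF assms(2)] in simp_all)

lemma adj_add:
  assumes "(x, y) \<in> Nadj" "(x', y') \<in> Nadj"
  shows "(x + x', y + y') \<in> Nadj"
proof (rule adjI)
  fix a w assume aw: "(a, w) \<in> N"
  show "ip H w (x + x') = ip H a (y + y')"
    using adj_ip[OF aw assms(1)] adj_ip[OF aw assms(2)] N_carr[OF aw] adj_carr[OF assms(1)] adj_carr[OF assms(2)]
    by (simp add: ip_add_right)
qed (use adj_carr[OF assms(1)] adj_carr[OF assms(2)] in simp_all)

lemma adj_scl:
  assumes "(x, y) \<in> Nadj"
  shows "(scl H c x, scl H c y) \<in> Nadj"
proof (rule adjI)
  fix a w assume aw: "(a, w) \<in> N"
  show "ip H w (scl H c x) = ip H a (scl H c y)"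
    using adj_ip[OF aw assms(1)] N_carr[OF aw] adj_carr[OF assms(1)]
    by (simp add: ip_scale_right)
qed (use adj_carr[OF assms(1)] in simp_all)

lemma adj_zero: "(0, 0) \<in> Nadj"
  by (rule adjI) (simp_all add: N_carr(1)[THEN ip_zero_right] N_carr(2)[THEN ip_zero_right])

lemma adj_unique:
  assumes "(y, z) \<in> Nadj" "(y, z') \<in> Nadj"
  shows "z = z'"
proof (rule ccontr)
  define d where "d = z - z'"
  have d: "(0, d) \<in> Nadj" using adj_diff[OF assms] by (simp add: d_def)
  have dc: "d \<in> carr H" using adj_carr(2)[OF d] .
  assume "z \<noteq> z'"
  then have pos: "hnorm H d > 0"
    using hnorm_eq_0[OF dc] hnorm_nonneg[OF dc] by (simp add: d_def)
  have "densely_defined H N" using normal unfolding normal_operator_def by blast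
  then obtain x w where xw: "(x, w) \<in> N" "hnorm H (d - x) < hnorm H d"
    unfolding densely_defined_def using dc pos by blast
  have xc: "x \<in> carr H" "w \<in> carr H" using N_carr[OF xw(1)] by auto
  have "ip H x d = 0" using adj_ip[OF xw(1) d] xc by simp
  then have "ip H d d = ip H (d - x) d" using dc xc by (simp add: ip_diff)
  then have "(hnorm H d)\<^sup>2 \<le> cmod (ip H (d - x) d)"
    using hnorm_sq[OF dc] complex_Re_le_cmod[of "ip H (d - x) d"] by simp
  also have "\<dots> \<le> hnorm H (d - x) * hnorm H d" using Cauchy_Schwarz dc xc by simp
  also have "\<dots> < hnorm H d * hnorm H d" using xw(2) pos by simp
  finally show False by (simp add: power2_eq_square)
qed

lemma commute:
  assumes "(u, v) \<in> N" "(v, w) \<in> Nadj"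
  obtains v' where "(u, v') \<in> Nadj" "(v', w) \<in> N"
proof -
  have "(u, w) \<in> Nadj O N" using normal assms unfolding normal_operator_def by (metis relcompI)
  then show thesis using that by blast
qed

lemma hnorm_N_eq_adj:
  assumes "(u, v) \<in> N" "(v, w) \<in> Nadj" "(u, v') \<in> Nadj" "(v', w) \<in> N"
  shows "hnorm H v = hnorm H v'"
proof -
  have c: "u \<in> carr H" "v \<in> carr H" "w \<in> carr H" "v' \<in> carr H"
    using N_carr[OF assms(1)] N_carr[OF assms(4)] by auto
  have "ip H v v = ip H u w" by (rule adj_ip[OF assms(1,2)])
  moreover have "ip H w u = ip H v' v'" by (rule adj_ip[OF assms(4,3)])
  moreover have "ip H w u = cnj (ip H u w)" by (rule ip_cnj[OF c(1,3)])
  ultimately have "ip H v' v' = cnj (ip H v v)" by simp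
  then show ?thesis by (simp add: hnorm_def)
qed

text \<open>Project \<open>(y, 0)\<close> onto the graph of \<open>N\<close>. If \<open>(u, v)\<close> is the projection, then orthogonality of
\<open>(y - u, - v)\<close> to the graph says precisely that \<open>v\<close> is in the domain of the adjoint, with value
\<open>y - u\<close>.\<close>

lemma one_plus_adj_N_surj:
  assumes y: "y \<in> carr H"
  obtains u v w where "(u, v) \<in> N" "(v, w) \<in> Nadj" "y = u + w"
proof -
  interpret P: complex_hilbert_space "hprod H" by (rule complex_hilbert_space_hprod)
  have sub: "P.subspace N"
    by (rule P.subspaceI) (simp add: zero_prod_def N_zero, force intro: N_add, force intro: N_scl)
  have Nc: "N \<subseteq> carr (hprod H)" by (auto dest: N_carr)
  have p: "(y, 0) \<in> carr (hprod H)" using y by simp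
  obtain X q where XG: "\<forall>n. X n \<in> N" and Xq: "q \<in> carr (hprod H)"
    "(\<lambda>n::nat. hnorm (hprod H) (X n - q)) \<longlonglongrightarrow> 0"
    "\<forall>g\<in>N. ip (hprod H) ((y, 0) - q) g = 0"
    using P.orthogonal_projection[OF sub Nc p] by blast
  obtain u v where q: "q = (u, v)" by fastforce
  have uv: "u \<in> carr H" "v \<in> carr H" using Xq(1) q by auto
  have D: "X n - q \<in> carr (hprod H)" for n using XG[rule_format, of n] Xq(1) Nc P.carr_diff by blast
  have lim: "(\<lambda>n. hnorm H (fst (X n) - u)) \<longlonglongrightarrow> 0" "(\<lambda>n. hnorm H (snd (X n) - v)) \<longlonglongrightarrow> 0"
    by (rule hprod_tendstoD[OF D[unfolded q] Xq(2)[unfolded q]])+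
  have "(fst (X n), snd (X n)) \<in> N" for n using XG by simp
  then have uvN: "(u, v) \<in> N" by (rule N_closed[OF uv _ lim])
  have "(v, y - u) \<in> Nadj"
  proof (rule adjI)
    show "v \<in> carr H" "y - u \<in> carr H" using uv y by auto
    fix x w assume xw: "(x, w) \<in> N"
    have c: "x \<in> carr H" "w \<in> carr H" using N_carr[OF xw] by auto
    have "ip H (y - u) x = ip H v w"
      using bspec[OF Xq(3) xw] c uv y by (simp add: q ip_diff ip_minus)
    then show "ip H w v = ip H x (y - u)"
      using ip_cnj[of v w] ip_cnj[of "y - u" x] c uv y by simp
  qed
  then show thesis by (rule that[OF uvN]) simp
qed

text \<open>An element of the graph of \<open>N\<close> that is orthogonal to all \<open>(u, N u)\<close> with \<open>N u\<close> in the domain of \<open>N*\<close>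
has a first component orthogonal to the range of \<open>1 + N*N\<close>, which is everything.\<close>

lemma adj_N_domain_is_core:
  assumes xy: "(x, y) \<in> N"
  shows "\<exists>U V W. (\<forall>n::nat. (U n, V n) \<in> N \<and> (V n, W n) \<in> Nadj) \<and>
    (\<lambda>n. hnorm H (U n - x)) \<longlonglongrightarrow> 0 \<and> (\<lambda>n. hnorm H (V n - y)) \<longlonglongrightarrow> 0"
proof -
  interpret P: complex_hilbert_space "hprod H" by (rule complex_hilbert_space_hprod)
  define G where "G = {z \<in> N. snd z \<in> Domain Nadj}"
  have sub: "P.subspace G"
  proof (rule P.subspaceI)
    show "0 \<in> G" using N_zero adj_zero by (auto simp: G_def zero_prod_def)
    show "z + z' \<in> G" if "z \<in> G" "z' \<in> G" for z z'
      using that N_add adj_add unfolding G_def by (cases z; cases z') (force simp: Domain_iff)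
    show "scl (hprod H) c z \<in> G" if "z \<in> G" for c z
      using that N_scl adj_scl unfolding G_def by (cases z) (force simp: Domain_iff)
  qed
  have Gc: "G \<subseteq> carr (hprod H)" by (auto simp: G_def dest: N_carr)
  have xyc: "x \<in> carr H" "y \<in> carr H" using N_carr[OF xy] by auto
  then have p: "(x, y) \<in> carr (hprod H)" by simp
  obtain X q where XG: "\<forall>n. X n \<in> G" and Xq: "q \<in> carr (hprod H)"
    "(\<lambda>n::nat. hnorm (hprod H) (X n - q)) \<longlonglongrightarrow> 0"
    "\<forall>g\<in>G. ip (hprod H) ((x, y) - q) g = 0"
    using P.orthogonal_projection[OF sub Gc p] by blast
  obtain a b where q: "q = (a, b)" by fastforce
  have ab: "a \<in> carr H" "b \<in> carr H" using Xq(1) q by auto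
  have D: "X n - q \<in> carr (hprod H)" for n using XG[rule_format, of n] Xq(1) Gc P.carr_diff by blast
  have l1: "(\<lambda>n. hnorm H (fst (X n) - a)) \<longlonglongrightarrow> 0" and l2: "(\<lambda>n. hnorm H (snd (X n) - b)) \<longlonglongrightarrow> 0"
    by (rule hprod_tendstoD[OF D[unfolded q] Xq(2)[unfolded q]])+
  have "(fst (X n), snd (X n)) \<in> N" for n using XG by (simp add: G_def)
  then have abN: "(a, b) \<in> N" by (rule N_closed[OF ab _ l1 l2])
  have dN: "(x - a, y - b) \<in> N" by (rule N_diff[OF xy abN])
  obtain u v w where uvw: "(u, v) \<in> N" "(v, w) \<in> Nadj" "x - a = u + w"
    by (rule one_plus_adj_N_surj[OF carr_diff[OF xyc(1) ab(1)]])
  have c: "u \<in> carr H" "v \<in> carr H" "w \<in> carr H"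
    using N_carr[OF uvw(1)] adj_carr[OF uvw(2)] by auto
  have "(u, v) \<in> G" using uvw by (auto simp: G_def)
  from bspec[OF Xq(3) this] have "ip H (x - a) u + ip H (y - b) v = 0" by (simp add: q)
  moreover have "ip H (y - b) v = ip H (x - a) w" by (rule adj_ip[OF dN uvw(2)])
  ultimately have "ip H (x - a) (x - a) = 0"
    using c ip_add_right[of "x - a" u w] xyc ab by (simp only: uvw(3)) simp
  then have xa: "x = a" using ip_eq_0[of "x - a"] xyc ab by simp
  then have yb: "y = b" using N_unique[OF xy] abN by simp
  have "\<forall>n. \<exists>w. (snd (X n), w) \<in> Nadj" using XG by (auto simp: G_def)
  from choice[OF this] obtain W where "\<forall>n. (snd (X n), W n) \<in> Nadj" ..
  moreover have "\<forall>n. (fst (X n), snd (X n)) \<in> N" using XG by (simp add: G_def)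
  ultimately show ?thesis
    unfolding xa yb using l1 l2
    by (intro exI[of _ "\<lambda>n. fst (X n)"] exI[of _ "\<lambda>n. snd (X n)"] exI[of _ W]) blast
qed

text \<open>On the core provided by the preceding lemma, \<open>N\<close> and its adjoint have the same norms because they
commute. So graph convergence for \<open>N\<close> implies that the values of the adjoint form a Cauchy sequence.\<close>

lemma Domain_subset_adj:
  assumes xy: "(x, y) \<in> N"
  obtains z where "(x, z) \<in> Nadj"
proof -
  obtain U V W where UVW: "\<forall>n::nat. (U n, V n) \<in> N \<and> (V n, W n) \<in> Nadj"
    and lim: "(\<lambda>n. hnorm H (U n - x)) \<longlonglongrightarrow> 0" "(\<lambda>n. hnorm H (V n - y)) \<longlonglongrightarrow> 0"
    using adj_N_domain_is_core[OF xy] by blast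
  have U: "(U n, V n) \<in> N" "(V n, W n) \<in> Nadj" for n using UVW by auto
  have "\<exists>v'. (U n, v') \<in> Nadj \<and> (v', W n) \<in> N" for n
    using commute[OF U(1)[of n] U(2)[of n]] by blast
  then obtain Z where Z: "\<And>n. (U n, Z n) \<in> Nadj" "\<And>n. (Z n, W n) \<in> N" by metis
  have xyc: "x \<in> carr H" "y \<in> carr H" using N_carr[OF xy] by auto
  have c: "U n \<in> carr H" "V n \<in> carr H" "Z n \<in> carr H" for n
    using N_carr[OF U(1)[of n]] adj_carr[OF Z(1)[of n]] by auto
  have "hnorm H (V m - V n) = hnorm H (Z m - Z n)" for m n
    by (rule hnorm_N_eq_adj[OF N_diff[OF U(1) U(1)] adj_diff[OF U(2) U(2)]
          adj_diff[OF Z(1) Z(1)] N_diff[OF Z(2) Z(2)]])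
  then have "\<exists>M::nat. \<forall>m\<ge>M. \<forall>n\<ge>M. hnorm H (Z m - Z n) < e" if "e > 0" for e
    using Cauchy_of_convergent[OF c(2) xyc(2) lim(2) that] by simp
  then obtain z where z: "z \<in> carr H" "(\<lambda>n. hnorm H (Z n - z)) \<longlonglongrightarrow> 0"
    using complete[of Z] c by blast
  have "(x, z) \<in> Nadj"
  proof (rule adjI)
    fix a b assume ab: "(a, b) \<in> N"
    have abc: "a \<in> carr H" "b \<in> carr H" using N_carr[OF ab] by auto
    have "(\<lambda>n. ip H b (U n)) \<longlonglongrightarrow> ip H b x" by (rule ip_tendsto_right[OF c(1) xyc(1) abc(2) lim(1)])
    moreover have "(\<lambda>n. ip H a (Z n)) \<longlonglongrightarrow> ip H a z" by (rule ip_tendsto_right[OF c(3) z(1) abc(1) z(2)])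
    moreover have "ip H b (U n) = ip H a (Z n)" for n by (rule adj_ip[OF ab Z(1)])
    ultimately show "ip H b x = ip H a z" using LIMSEQ_unique by simp
  qed (use xyc z in auto)
  then show thesis by (rule that)
qed

end

section \<open>Positivity of the squared norms of iterates\<close>

text \<open>The classical solvability criterion of the Stieltjes moment problem: the Hankel forms of the sequence
and of its shift are nonnegative.\<close>

definition stieltjes_positive :: "(nat \<Rightarrow> real) \<Rightarrow> bool" where
  "stieltjes_positive t \<longleftrightarrow>
     (\<forall>(n::nat) c. 0 \<le> (\<Sum>i\<le>n. \<Sum>j\<le>n. c i * c j * t (i + j))) \<and>
     (\<forall>(n::nat) c. 0 \<le> (\<Sum>i\<le>n. \<Sum>j\<le>n. c i * c j * t (Suc (i + j))))"

context complex_hilbert_space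
begin

lemma gram_nonneg:
  fixes c :: "nat \<Rightarrow> real"
  assumes v: "\<And>i. v i \<in> carr H" and t: "\<And>i j. ip H (v i) (v j) = of_real (t i j)"
  shows "0 \<le> (\<Sum>i\<le>n. \<Sum>j\<le>n. c i * c j * t i j)"
proof -
  define w where "w = (\<Sum>i\<le>n. scl H (of_real (c i)) (v i))"
  have s: "scl H (of_real (c i)) (v i) \<in> carr H" for i using v by simp
  have wc: "w \<in> carr H" unfolding w_def by (intro carr_sum s)
  have "ip H w w = (\<Sum>i\<le>n. \<Sum>j\<le>n. ip H (scl H (of_real (c i)) (v i)) (scl H (of_real (c j)) (v j)))"
    unfolding w_def using s by (subst ip_sum_left) (auto intro: carr_sum simp: ip_sum_right)
  also have "\<dots> = (\<Sum>i\<le>n. \<Sum>j\<le>n. of_real (c i * c j * t i j))"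
    using v s by (simp add: ip_scale ip_scale_right t mult_ac)
  finally have "ip H w w = of_real (\<Sum>i\<le>n. \<Sum>j\<le>n. c i * c j * t i j)" by simp
  then show ?thesis using ip_nonneg[OF wc] by simp
qed

end

context normal_in_hilbert_space
begin

definition Dinf :: "'a set" where
  "Dinf = {x \<in> carr H. \<forall>n. x \<in> Domain (N ^^ n)}"

lemma Dinf_N:
  assumes x: "x \<in> Dinf"
  obtains y where "(x, y) \<in> N" "y \<in> Dinf"
proof -
  have "x \<in> Domain (N ^^ 1)" using x unfolding Dinf_def by blast
  then obtain y where y: "(x, y) \<in> N" by auto
  have "y \<in> Domain (N ^^ n)" for n
  proof -
    have "x \<in> Domain (N ^^ Suc n)" using x unfolding Dinf_def by blast
    then obtain z where "(x, z) \<in> N ^^ Suc n" by blast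
    then obtain y' where "(x, y') \<in> N" "(y', z) \<in> N ^^ n" by (blast dest: relpow_Suc_D2)
    then show ?thesis using N_unique[OF y] by blast
  qed
  then have "y \<in> Dinf" using N_carr(2)[OF y] by (simp add: Dinf_def)
  with y show thesis by (rule that)
qed

text \<open>If \<open>x\<close> is in the domain of all powers, then \<open>N x\<close> is in the domain of \<open>N\<close>, hence in that of the
adjoint, and normality moves the adjoint past \<open>N\<close>. Iterating this shows that the adjoint preserves
the domain of all powers.\<close>

lemma Dinf_adj:
  assumes x: "x \<in> Dinf" and xy: "(x, y) \<in> N"
  obtains v w where "(x, v) \<in> Nadj" "v \<in> Dinf" "(y, w) \<in> Nadj" "(v, w) \<in> N"
proof -
  have adj: "\<exists>y w v. (x, y) \<in> N \<and> y \<in> Dinf \<and> (y, w) \<in> Nadj \<and> (x, v) \<in> Nadj \<and> (v, w) \<in> N"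
    if x: "x \<in> Dinf" for x
  proof -
    obtain y where y: "(x, y) \<in> N" "y \<in> Dinf" by (rule Dinf_N[OF x])
    obtain y' where y': "(y, y') \<in> N" using Dinf_N[OF y(2)] by blast
    obtain w where w: "(y, w) \<in> Nadj" by (rule Domain_subset_adj[OF y'])
    obtain v where "(x, v) \<in> Nadj" "(v, w) \<in> N" by (rule commute[OF y(1) w])
    then show ?thesis using y w by blast
  qed
  have Dom: "v \<in> Domain (N ^^ n)" if "x \<in> Dinf" "(x, v) \<in> Nadj" for n x v
    using that
  proof (induction n arbitrary: x v)
    case (Suc n)
    obtain y w v' where *: "(x, y) \<in> N" "y \<in> Dinf" "(y, w) \<in> Nadj" "(x, v') \<in> Nadj" "(v', w) \<in> N"
      using adj[OF Suc.prems(1)] by blast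
    have "v' = v" using adj_unique[OF *(4)] Suc.prems(2) by blast
    moreover obtain z where "(w, z) \<in> N ^^ n" using Suc.IH[OF *(2,3)] by blast
    ultimately have "(v, z) \<in> N ^^ Suc n" using *(5) by (blast intro: relpow_Suc_I2)
    then show ?case by blast
  qed auto
  obtain y' w v where *: "(x, y') \<in> N" "(y', w) \<in> Nadj" "(x, v) \<in> Nadj" "(v, w) \<in> N"
    using adj[OF x] by blast
  have "y' = y" by (rule N_unique[OF *(1) xy])
  moreover have "v \<in> Dinf" using Dom[OF x *(3)] adj_carr(2)[OF *(3)] by (simp add: Dinf_def)
  ultimately show thesis using that[OF *(3)] * by blast
qed

text \<open>With \<open>T = N*N\<close> on the domain of all powers, \<open>T\<^sup>i f\<close> and \<open>T\<^sup>j f\<close> have inner product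
\<open>\<parallel>N\<^sup>i\<^sup>+\<^sup>j f\<parallel>\<^sup>2\<close>, and \<open>N T\<^sup>i f\<close> and \<open>N T\<^sup>j f\<close> have inner product \<open>\<parallel>N\<^sup>i\<^sup>+\<^sup>j\<^sup>+\<^sup>1 f\<parallel>\<^sup>2\<close>. Both
Hankel forms therefore are Gram forms.\<close>

lemma power_norms_stieltjes_positive:
  assumes f: "f \<in> carr H" and g: "\<And>n. (f, g n) \<in> N ^^ n"
  shows "stieltjes_positive (\<lambda>n. (hnorm H (g n))\<^sup>2)"
proof -
  define A where "A x = (THE y. (x, y) \<in> N)" for x
  define B where "B x = (THE y. (x, y) \<in> Nadj)" for x
  have fD: "f \<in> Dinf" using f g by (auto simp: Dinf_def)
  have A_eq: "A x = y" if "(x, y) \<in> N" for x y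
    unfolding A_def using that N_unique by (intro the_equality)
  have B_eq: "B x = y" if "(x, y) \<in> Nadj" for x y
    unfolding B_def using that adj_unique by (intro the_equality)
  have A: "(x, A x) \<in> N" "A x \<in> Dinf" if "x \<in> Dinf" for x
    using Dinf_N[OF that] A_eq by metis+
  have B: "(x, B x) \<in> Nadj" "B x \<in> Dinf" "A (B x) = B (A x)" if x: "x \<in> Dinf" for x
  proof -
    obtain v w where *: "(x, v) \<in> Nadj" "v \<in> Dinf" "(A x, w) \<in> Nadj" "(v, w) \<in> N"
      by (rule Dinf_adj[OF x A(1)[OF x]])
    have "B x = v" "B (A x) = w" "A v = w" using * A_eq B_eq by auto
    then show "(x, B x) \<in> Nadj" "B x \<in> Dinf" "A (B x) = B (A x)" using * by auto
  qed
  have Dc: "x \<in> carr H" if "x \<in> Dinf" for x using that by (simp add: Dinf_def)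
  have AB: "ip H (A x) y = ip H x (B y)" if "x \<in> Dinf" "y \<in> Dinf" for x y
    by (rule adj_ip[OF A(1)[OF that(1)] B(1)[OF that(2)]])
  have BA: "ip H (B x) y = ip H x (A y)" if "x \<in> Dinf" "y \<in> Dinf" for x y
    using AB[OF that(2,1)] ip_cnj[of y "B x"] ip_cnj[of "A y" x] Dc that A B
    by (simp add: Dc)
  have Apow: "(A ^^ n) x \<in> Dinf" if "x \<in> Dinf" for n x
    using that by (induction n) (auto intro: A)
  have ABpow: "(A ^^ n) (B x) = B ((A ^^ n) x)" if "x \<in> Dinf" for n x
    using that by (induction n) (auto simp: B Apow)
  define T where "T x = B (A x)" for x
  have TD: "T x \<in> Dinf" if "x \<in> Dinf" for x unfolding T_def using A B that by blast
  have Tpow: "(T ^^ n) x \<in> Dinf" if "x \<in> Dinf" for n x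
    using that by (induction n) (auto intro: TD)
  have c1: "ip H ((T ^^ n) x) y = ip H ((A ^^ n) x) ((A ^^ n) y)" if "x \<in> Dinf" "y \<in> Dinf" for n x y
    using that
  proof (induction n arbitrary: x y)
    case (Suc n)
    have "ip H ((T ^^ Suc n) x) y = ip H ((A ^^ n) (B (A x))) ((A ^^ n) y)"
      using Suc.IH[OF TD[OF Suc.prems(1)] Suc.prems(2)] 
      unfolding T_def[of x, symmetric] by (simp add: funpow_swap1)
    also have "\<dots> = ip H (B ((A ^^ n) (A x))) ((A ^^ n) y)"
      by (simp add: ABpow A Suc.prems)
    also have "\<dots> = ip H ((A ^^ n) (A x)) (A ((A ^^ n) y))"
      by (intro BA Apow A Suc.prems)
    finally show ?case by (simp add: funpow_swap1)
  qed simp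
  have Tsym: "ip H x (T y) = ip H (T x) y" if "x \<in> Dinf" "y \<in> Dinf" for x y
    unfolding T_def using that A AB BA by simp
  have c2: "ip H ((T ^^ i) f) ((T ^^ j) f) = ip H ((T ^^ (i + j)) f) f" for i j
  proof (induction j arbitrary: i)
    case (Suc j)
    have "ip H ((T ^^ i) f) ((T ^^ Suc j) f) = ip H ((T ^^ Suc i) f) ((T ^^ j) f)"
      using Tsym[OF Tpow[OF fD] Tpow[OF fD]] by simp
    then show ?case using Suc.IH[of "Suc i"] by simp
  qed simp
  have gA: "g n = (A ^^ n) f" for n
  proof -
    have *: "(f, y) \<in> N ^^ n \<Longrightarrow> y = (A ^^ n) f" for y
    proof (induction n arbitrary: y)
      case (Suc n)
      then obtain x where "(f, x) \<in> N ^^ n" "(x, y) \<in> N" by auto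
      then show ?case using Suc.IH A_eq by auto
    qed simp
    show ?thesis using *[OF g] .
  qed
  have T_norm: "ip H ((T ^^ i) f) ((T ^^ j) f) = of_real ((hnorm H (g (i + j)))\<^sup>2)" for i j
    using c2[of i j] c1[OF fD fD] ip_self[OF Dc[OF Apow[OF fD]]] by (simp add: gA)
  have AT_norm: "ip H (A ((T ^^ i) f)) (A ((T ^^ j) f)) = of_real ((hnorm H (g (Suc (i + j))))\<^sup>2)" for i j
  proof -
    have "ip H (A ((T ^^ i) f)) (A ((T ^^ j) f)) = ip H ((T ^^ Suc i) f) ((T ^^ j) f)"
      using BA[OF A(2)[OF Tpow[OF fD]] Tpow[OF fD]] by (simp add: T_def)
    then show ?thesis using T_norm[of "Suc i" j] by simp
  qed
  show ?thesis unfolding stieltjes_positive_def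
  proof (intro conjI allI)
    show "0 \<le> (\<Sum>i\<le>n. \<Sum>j\<le>n. c i * c j * (hnorm H (g (i + j)))\<^sup>2)" for n :: nat and c
      by (rule gram_nonneg[of "\<lambda>i. (T ^^ i) f"]) (intro Dc Tpow fD, rule T_norm)
    show "0 \<le> (\<Sum>i\<le>n. \<Sum>j\<le>n. c i * c j * (hnorm H (g (Suc (i + j))))\<^sup>2)" for n :: nat and c
      by (rule gram_nonneg[of "\<lambda>i. A ((T ^^ i) f)"]) (intro Dc A Tpow fD, rule AT_norm)
  qed
qed

end

lemma subnormal_stieltjes_positive:
  assumes sub: "subnormal TYPE('k::ab_group_add) H S"
    and f: "f \<in> carr H" and g: "\<And>n. (f, g n) \<in> S ^^ n"
  shows "stieltjes_positive (\<lambda>n. (hnorm H (g n))\<^sup>2)"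
proof -
  obtain K :: "'k hspace" and N J where K: "complex_hilbert_space K" "normal_operator K N"
    "isometric_embedding H K J" "\<forall>(f, g)\<in>S. (J f, J g) \<in> N"
    using sub unfolding subnormal_def by blast
  have lin: "linear_operator H S" using sub unfolding subnormal_def by blast
  interpret normal_in_hilbert_space K N
    using K by (simp add: normal_in_hilbert_space_def normal_in_hilbert_space_axioms_def)
  have rel: "(f, y) \<in> S ^^ n \<Longrightarrow> y \<in> carr H \<and> (J f, J y) \<in> N ^^ n" for n y
  proof (induction n arbitrary: y)
    case (Suc n)
    then obtain x where x: "(f, x) \<in> S ^^ n" "(x, y) \<in> S" by auto
    then have "y \<in> carr H" using lin unfolding linear_operator_def by blast
    moreover have "(J x, J y) \<in> N" using K(4) x(2) by blast
    ultimately show ?case using Suc.IH[OF x(1)] by auto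
  qed (use f in simp)
  have "J f \<in> carr K" using K(3) f unfolding isometric_embedding_def by blast
  from power_norms_stieltjes_positive[OF this, of "\<lambda>n. J (g n)"] rel[OF g]
  have "stieltjes_positive (\<lambda>n. (hnorm K (J (g n)))\<^sup>2)" by blast
  moreover have "hnorm K (J (g n)) = hnorm H (g n)" for n
    using K(3) rel[OF g] unfolding isometric_embedding_def hnorm_def by simp
  ultimately show ?thesis by simp
qed

section \<open>Gauss quadrature for positive functionals\<close>

text \<open>The value at \<open>p\<close> is what the integral of \<open>p\<close> would be for a measure with moments \<open>t\<close>.\<close>

definition moment_functional :: "(nat \<Rightarrow> real) \<Rightarrow> real poly \<Rightarrow> real" where
  "moment_functional t p = (\<Sum>i\<le>degree p. coeff p i * t i)"

lemma moment_functional_altdef: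
  assumes "degree p \<le> n"
  shows "moment_functional t p = (\<Sum>i\<le>n. coeff p i * t i)"
  unfolding moment_functional_def using assms
  by (intro sum.mono_neutral_left) (auto simp: coeff_eq_0)

lemma moment_functional_add: "moment_functional t (p + q) = moment_functional t p + moment_functional t q"
proof -
  define n where "n = max (degree p) (degree q)"
  have "degree p \<le> n" "degree q \<le> n" "degree (p + q) \<le> n"
    by (auto simp: n_def degree_add_le)
  then show ?thesis by (simp add: moment_functional_altdef sum.distrib distrib_right)
qed

lemma moment_functional_smult: "moment_functional t (smult c p) = c * moment_functional t p"
  by (subst moment_functional_altdef[of _ "degree p"])
    (simp_all add: moment_functional_def sum_distrib_left mult_ac)

lemma moment_functional_0 [simp]: "moment_functional t 0 = 0"
  by (simp add: moment_functional_def)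

lemma moment_functional_diff: "moment_functional t (p - q) = moment_functional t p - moment_functional t q"
  using moment_functional_add[of t "p - q" q] by simp

lemma moment_functional_sum: "moment_functional t (sum f A) = (\<Sum>a\<in>A. moment_functional t (f a))"
  by (induction A rule: infinite_finite_induct) (auto simp: moment_functional_add)

lemma moment_functional_monom: "moment_functional t (monom c n) = c * t n"
  by (subst moment_functional_altdef[of _ n])
    (simp_all add: degree_monom_le if_distrib[of "\<lambda>x. x * _"] cong: if_cong)

lemma moment_functional_pCons_0: "moment_functional t (pCons 0 p) = moment_functional (\<lambda>n. t (Suc n)) p"
  by (subst moment_functional_altdef[of _ "Suc (degree p)"])
    (auto simp: sum.atMost_Suc_shift moment_functional_def degree_pCons_le simp del: sum.atMost_Suc)

lemma moment_functional_mult: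
  assumes "degree p \<le> n" "degree q \<le> n"
  shows "moment_functional t (p * q) = (\<Sum>i\<le>n. \<Sum>j\<le>n. coeff p i * coeff q j * t (i + j))"
proof -
  have "p * q = (\<Sum>i\<le>n. monom (coeff p i) i) * (\<Sum>j\<le>n. monom (coeff q j) j)"
    using assms by (simp add: poly_as_sum_of_monoms')
  also have "\<dots> = (\<Sum>i\<le>n. \<Sum>j\<le>n. monom (coeff p i * coeff q j) (i + j))"
    by (simp add: sum_product mult_monom)
  finally show ?thesis by (simp add: moment_functional_sum moment_functional_monom)
qed

lemma moment_functional_scale_seq:
  "moment_functional (\<lambda>n. a * t n + b * s n) p = a * moment_functional t p + b * moment_functional s p"
  by (simp add: moment_functional_def sum.distrib sum_distrib_left distrib_left mult_ac)

lemma stieltjes_positive_functional: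
  assumes "stieltjes_positive t"
  shows "0 \<le> moment_functional t (p * p)" "0 \<le> moment_functional t (pCons 0 (p * p))"
  using assms unfolding stieltjes_positive_def
  by (auto simp: moment_functional_pCons_0 moment_functional_mult[OF order_refl order_refl])

lemma complex_eval_hom:
  fixes z :: complex
  defines "C \<equiv> \<lambda>p. poly (map_poly complex_of_real p) z"
  shows "C (pCons a p) = of_real a + z * C p" "C (p + q) = C p + C q" "C (p * q) = C p * C q"
proof -
  have pC: "C (pCons a p) = of_real a + z * C p" for a p
    unfolding C_def by (simp add: map_poly_pCons)
  have C0: "C 0 = 0" by (simp add: C_def)
  have add: "C (p + q) = C p + C q" for p q
    by (induction p q rule: poly_induct2) (simp_all add: C0 pC algebra_simps)
  have sm: "C (smult a q) = of_real a * C q" for a q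
    by (induction q) (simp_all add: C0 pC algebra_simps)
  have "C (p * q) = C p * C q" for p q
    by (induction p) (simp_all add: C0 pC add sm algebra_simps)
  with pC add show "C (pCons a p) = of_real a + z * C p" "C (p + q) = C p + C q" "C (p * q) = C p * C q"
    by blast+
qed

text \<open>Either a complex root is real, or the remainder of \<open>g\<close> modulo the quadratic polynomial with that root
and its conjugate is a real linear polynomial with a nonreal root, hence zero.\<close>

lemma real_poly_has_factor:
  fixes g :: "real poly"
  assumes "degree g \<noteq> 0"
  obtains r where "poly g r = 0" | a b where "b \<noteq> 0" "[:a\<^sup>2 + b\<^sup>2, - 2 * a, 1:] dvd g"
proof -
  define C where "C = map_poly complex_of_real"
  have "degree (C g) = degree g" unfolding C_def by (rule degree_map_poly) simp
  then have "\<not> constant (poly (C g))" using assms by (simp add: constant_degree)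
  then obtain z where z: "poly (C g) z = 0" using fundamental_theorem_of_algebra by blast
  define a b where "a = Re z" and "b = Im z"
  define q where "q = [:a\<^sup>2 + b\<^sup>2, - 2 * a, 1:]"
  note hom = complex_eval_hom[where z = z, folded C_def]
  have C0: "C 0 = 0" by (simp add: C_def)
  have qz: "poly (C q) z = 0"
    unfolding q_def by (simp add: hom C0 a_def b_def complex_eq_iff power2_eq_square algebra_simps)
  show thesis
  proof (cases "b = 0")
    case True
    then have "z = of_real a" by (simp add: a_def b_def complex_eq_iff)
    moreover have "poly (C p) (of_real a) = of_real (poly p a)" for p
      unfolding C_def by (induction p) (simp_all add: map_poly_pCons)
    ultimately have "complex_of_real (poly g a) = 0" using z by simp
    then show thesis using that(1) by simp
  next
    case False
    define r where "r = g mod q"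
    have "degree q = 2" by (simp add: q_def)
    then have "degree r < 2"
      using degree_mod_less[of q g] by (auto simp: r_def q_def)
    then obtain c d where r: "r = [:c, d:]"
      by (metis One_nat_def Suc_1 degree_pCons_eq_if less_2_cases_iff pCons_cases degree_eq_zeroE
          less_Suc_eq nat.inject not_less0 zero_less_Suc pCons_0_0)
    have "g = q * (g div q) + r" by (simp add: r_def)
    then have "poly (C r) z = 0" using z qz hom by (metis add_cancel_right_left mult_zero_left)
    then have "of_real c + z * of_real d = 0" unfolding r by (simp add: hom C0)
    then have "d = 0" "c = 0" using False by (auto simp: complex_eq_iff b_def)
    then have "q dvd g" using r by (simp add: r_def mod_eq_0_iff_dvd)
    then show thesis using that(2)[OF False] unfolding q_def by blast
  qed
qed

lemma prod_roots_dvd: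
  fixes p :: "real poly"
  assumes "finite A" "\<And>a. a \<in> A \<Longrightarrow> poly p a = 0"
  shows "(\<Prod>a\<in>A. [:- a, 1:]) dvd p"
  using assms
proof (induction A rule: finite_induct)
  case (insert a A)
  then obtain g where g: "p = (\<Prod>a\<in>A. [:- a, 1:]) * g" by (meson dvdE insertCI)
  have "poly (\<Prod>a\<in>A. [:- a, 1:]) a \<noteq> 0" using insert by (auto simp: poly_prod)
  moreover have "poly p a = 0" using insert by blast
  ultimately have "poly g a = 0" using g by simp
  then have "[:- a, 1:] dvd g" by (simp add: poly_eq_0_iff_dvd)
  moreover have "p = g * (\<Prod>a\<in>A. [:- a, 1:])" by (subst mult.commute) (rule g)
  ultimately show ?case
    unfolding prod.insert[OF insert(1,2)] by (simp only: mult_dvd_mono[OF _ dvd_refl])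
qed simp

text \<open>Strict positivity on squares makes orthogonal polynomials available; strict positivity on \<open>x\<close> times
squares makes their roots positive.\<close>

locale positive_functional =
  fixes t :: "nat \<Rightarrow> real"
  assumes pos: "p \<noteq> 0 \<Longrightarrow> 0 < moment_functional t (p * p)"
    and pos_x: "p \<noteq> 0 \<Longrightarrow> 0 < moment_functional t (pCons 0 (p * p))"
begin

abbreviation "L \<equiv> moment_functional t"

text \<open>The Gram-Schmidt process.\<close>

lemma orthogonal_polynomial_exists:
  "\<exists>p. degree p = n \<and> lead_coeff p = 1 \<and> (\<forall>q. degree q < n \<longrightarrow> L (p * q) = 0)"
proof (induction n rule: less_induct)
  case (less n)
  then obtain P where P: "\<And>k. k < n \<Longrightarrow> degree (P k) = k" "\<And>k. k < n \<Longrightarrow> lead_coeff (P k) = 1"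
    "\<And>k q. k < n \<Longrightarrow> degree q < k \<Longrightarrow> L (P k * q) = 0" by metis
  define s where "s = (\<Sum>k<n. smult (L (monom 1 n * P k) / L (P k * P k)) (P k))"
  define p where "p = monom 1 n - s"
  have coeff_s: "coeff s i = 0" if "i \<ge> n" for i
    unfolding s_def using that P(1) by (auto simp: coeff_sum coeff_eq_0 intro!: sum.neutral)
  have "coeff p n = 1" by (simp add: p_def coeff_s)
  moreover have "degree p \<le> n"
    by (rule degree_le) (auto simp: p_def coeff_s)
  ultimately have deg: "degree p = n" "lead_coeff p = 1"
    using le_degree[of p n] by (auto simp: antisym)
  have orth: "L (p * P j) = 0" if j: "j < n" for j
  proof -
    have PP: "L (P k * P j) = 0" if "k < n" "k \<noteq> j" for k
      using P(3)[of k "P j"] P(3)[of j "P k"] P(1) j that by (cases "j < k") (auto simp: mult.commute)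
    have "L (s * P j) = (\<Sum>k<n. L (monom 1 n * P k) / L (P k * P k) * L (P k * P j))"
      unfolding s_def by (simp add: sum_distrib_right moment_functional_sum moment_functional_smult)
    also have "\<dots> = (\<Sum>k<n. if k = j then L (monom 1 n * P j) else 0)"
    proof (rule sum.cong)
      fix k assume k: "k \<in> {..<n}"
      have "P j \<noteq> 0" using P(2)[OF j] by auto
      from pos[OF this] show "L (monom 1 n * P k) / L (P k * P k) * L (P k * P j) =
        (if k = j then L (monom 1 n * P j) else 0)" using PP[of k] k by auto
    qed simp
    also have "\<dots> = L (monom 1 n * P j)" using j by simp
    finally show ?thesis by (simp add: p_def left_diff_distrib moment_functional_diff)
  qed
  have "m \<le> n \<Longrightarrow> degree q < m \<Longrightarrow> L (p * q) = 0" for m q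
  proof (induction m arbitrary: q)
    case (Suc m)
    define r where "r = q - smult (coeff q m) (P m)"
    have Pm: "degree (P m) = m" "coeff (P m) m = 1" using P(1,2)[of m] Suc.prems by auto
    have coeff_r: "coeff r i = 0" if "i \<ge> m" for i
      using that Suc.prems Pm by (cases "i = m") (auto simp: r_def coeff_eq_0)
    have "L (p * r) = 0"
    proof (cases "r = 0")
      case False
      then have "coeff r (degree r) \<noteq> 0" by simp
      then have "degree r < m" using coeff_r not_less by blast
      then show ?thesis using Suc by simp
    qed simp
    moreover have "q = r + smult (coeff q m) (P m)" by (simp add: r_def)
    ultimately show ?case
      using orth[of m] Suc.prems(1)
      by (metis (no_types, lifting) Suc_le_eq add.right_neutral distrib_left moment_functional_add
          moment_functional_smult mult_smult_right mult_zero_right)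
  qed simp
  then show ?case using deg by blast
qed

text \<open>If \<open>p = ((x - a)\<^sup>2 + b\<^sup>2) g\<close>, then \<open>p g\<close> is a sum of squares, although orthogonality gives it the
value \<open>0\<close>; the case \<open>b = 0\<close> excludes double roots, the other cases exclude nonreal roots. If
\<open>p = (x - r) g\<close> with \<open>r \<le> 0\<close>, then \<open>p g\<close> is \<open>x g\<^sup>2\<close> plus a square, with the same contradiction.\<close>

lemma orthogonal_polynomial_roots:
  assumes deg: "degree p = n" and p0: "p \<noteq> 0" and orth: "\<And>q. degree q < n \<Longrightarrow> L (p * q) = 0"
  shows "card {x. poly p x = 0} = n" "\<And>x. poly p x = 0 \<Longrightarrow> x > 0"
proof -
  have no_quad: "\<not> [:a\<^sup>2 + b\<^sup>2, - 2 * a, 1:] dvd p" for a b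
  proof
    assume "[:a\<^sup>2 + b\<^sup>2, - 2 * a, 1:] dvd p"
    then obtain g where g: "p = [:a\<^sup>2 + b\<^sup>2, - 2 * a, 1:] * g" by (rule dvdE)
    \<comment> \<open>so that \<open>p g = h\<^sup>2 + b\<^sup>2 g\<^sup>2\<close>\<close>
    define h where "h = [:- a, 1:] * g"
    have g0: "g \<noteq> 0" using p0 g by auto
    then have h0: "h \<noteq> 0" unfolding h_def mult_eq_0_iff by simp
    have "degree p = 2 + degree g" unfolding g using g0 by (subst degree_mult_eq) auto
    then have "L (p * g) = 0" using orth deg by simp
    moreover have "p * g = h * h + smult (b\<^sup>2) (g * g)"
    proof -
      have "[:a\<^sup>2 + b\<^sup>2, - 2 * a, 1:] = [:- a, 1:] * [:- a, 1:] + [:b\<^sup>2:]"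
        by (simp add: power2_eq_square)
      then have "p * g = ([:- a, 1:] * [:- a, 1:] + [:b\<^sup>2:]) * g * g" unfolding g by simp
      also have "\<dots> = h * h + [:b\<^sup>2:] * (g * g)" unfolding h_def by (simp only: algebra_simps)
      finally show ?thesis by simp
    qed
    ultimately have "L (h * h) + b\<^sup>2 * L (g * g) = 0"
      by (simp add: moment_functional_add moment_functional_smult)
    moreover have "L (h * h) > 0" "b\<^sup>2 * L (g * g) \<ge> 0" using pos[OF h0] pos[OF g0] by auto
    ultimately show False by linarith
  qed
  show positive: "x > 0" if x: "poly p x = 0" for x
  proof (rule ccontr)
    assume "\<not> x > 0"
    obtain g where g: "p = [:- x, 1:] * g" using x by (auto simp: poly_eq_0_iff_dvd)
    have g0: "g \<noteq> 0" using p0 g by auto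
    have "degree p = 1 + degree g" unfolding g using g0 by (subst degree_mult_eq) auto
    then have "L (p * g) = 0" using orth deg by simp
    moreover have "p * g = pCons 0 (g * g) + smult (- x) (g * g)"
      unfolding g by (simp add: algebra_simps)
    ultimately have "L (pCons 0 (g * g)) + - x * L (g * g) = 0"
      by (simp add: moment_functional_add moment_functional_smult del: pCons_0_0 smult_minus_left)
    moreover have "- x * L (g * g) \<ge> 0" using \<open>\<not> x > 0\<close> pos[OF g0] by (intro mult_nonneg_nonneg) auto
    ultimately show False using pos_x[OF g0] by linarith
  qed
  define A where "A = {x. poly p x = 0}"
  have A: "finite A" unfolding A_def by (rule poly_roots_finite[OF p0])
  obtain g where g: "p = (\<Prod>a\<in>A. [:- a, 1:]) * g"
    using prod_roots_dvd[OF A, of p] by (auto simp: A_def dvd_def)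
  have "degree g = 0"
  proof (rule ccontr)
    assume "degree g \<noteq> 0"
    then consider r where "poly g r = 0" | a b where "[:a\<^sup>2 + b\<^sup>2, - 2 * a, 1:] dvd g"
      using real_poly_has_factor by metis
    then show False
    proof cases
      case (1 r)
      then have "[:- r, 1:] dvd g" by (simp add: poly_eq_0_iff_dvd)
      moreover have "poly p r = poly (\<Prod>a\<in>A. [:- a, 1:]) r * poly g r" by (subst g) (rule poly_mult)
      then have "r \<in> A" using 1 by (simp add: A_def)
      then have "[:- r, 1:] dvd (\<Prod>a\<in>A. [:- a, 1:])" by (rule dvd_prodI[OF A])
      ultimately have "[:- r, 1:] * [:- r, 1:] dvd p" unfolding g by (intro mult_dvd_mono)
      moreover have "[:- r, 1:] * [:- r, 1:] = [:r\<^sup>2 + 0\<^sup>2, - 2 * r, 1:]" by (simp add: power2_eq_square)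
      ultimately show False using no_quad[of r 0] by metis
    next
      case (2 a b)
      then have "[:a\<^sup>2 + b\<^sup>2, - 2 * a, 1:] dvd p" unfolding g by (rule dvd_mult)
      then show False using no_quad by blast
    qed
  qed
  moreover have "degree (\<Prod>a\<in>A. [:- a, 1:]) = card A" by (subst degree_prod_eq_sum_degree) auto
  moreover have "(\<Prod>a\<in>A. [:- a, 1:]) \<noteq> 0" "g \<noteq> 0" using g p0 by auto
  ultimately have "degree p = card A" using g degree_mult_eq by (metis add.right_neutral)
  then show "card {x. poly p x = 0} = n" using deg by (simp add: A_def)
qed

text \<open>Division by the orthogonal polynomial of degree \<open>n\<close> reduces degrees below \<open>2 n\<close> to degrees below \<open>n\<close>
without changing the functional or the values at the nodes; there Lagrange interpolation is exact.
The weights are nonnegative because each one is also the value of the functional at the square of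
a Lagrange polynomial.\<close>

lemma gauss_quadrature:
  assumes n: "n > 0"
  obtains A w where "finite A" "\<And>a. a \<in> A \<Longrightarrow> a > (0::real)" "\<And>a. a \<in> A \<Longrightarrow> w a \<ge> 0"
    "\<And>k. k < 2 * n \<Longrightarrow> t k = (\<Sum>a\<in>A. w a * a ^ k)"
proof -
  obtain p where p: "degree p = n" "lead_coeff p = 1" "\<And>q. degree q < n \<Longrightarrow> L (p * q) = 0"
    using orthogonal_polynomial_exists by blast
  have p0: "p \<noteq> 0" using p(2) by auto
  define A where "A = {x. poly p x = 0}"
  have A: "finite A" "card A = n" "\<And>a. a \<in> A \<Longrightarrow> a > 0"
    using orthogonal_polynomial_roots[OF p(1) p0 p(3)] poly_roots_finite[OF p0] by (auto simp: A_def)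
  define l where "l a = smult (inverse (\<Prod>b\<in>A-{a}. a - b)) (\<Prod>b\<in>A-{a}. [:- b, 1:])" for a
  have l_deg: "degree (l a) < n" if "a \<in> A" for a
  proof -
    have "degree (l a) \<le> card (A - {a})"
      unfolding l_def by (rule order_trans[OF degree_smult_le]) (subst degree_prod_eq_sum_degree, auto)
    then show ?thesis using A n that by simp
  qed
  have l_eval: "poly (l a) b = (if b = a then 1 else 0)" if "a \<in> A" "b \<in> A" for a b
    using A that by (auto simp: l_def poly_prod)
  define w where "w a = L (l a)" for a
  have quad: "L f = (\<Sum>a\<in>A. w a * poly f a)" if f: "degree f < 2 * n" for f
  proof -
    define r where "r = f mod p"
    have rdeg: "degree r < n" using degree_mod_less[OF p0, of f] p(1) n by (auto simp: r_def)
    have "degree (f div p) < n"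
    proof (cases "f div p = 0")
      case False
      have "degree (p * (f div p)) = n + degree (f div p)"
        using p0 False p(1) by (simp add: degree_mult_eq)
      moreover have "p * (f div p) = f - r" by (simp add: r_def minus_mod_eq_mult_div)
      moreover have "degree (f - r) < 2 * n" using f rdeg by (intro degree_diff_less) auto
      ultimately show ?thesis by simp
    qed (use n in simp)
    then have "L (p * (f div p)) = 0" by (rule p(3))
    moreover have fr: "f = p * (f div p) + r" by (simp add: r_def)
    ultimately have Lf: "L f = L r" by (metis add_0 moment_functional_add)
    have "degree (\<Sum>a\<in>A. smult (poly r a) (l a)) < n"
      using n l_deg by (intro degree_sum_less) (auto intro: le_less_trans[OF degree_smult_le])
    moreover have "poly r x = poly (\<Sum>a\<in>A. smult (poly r a) (l a)) x" if "x \<in> A" for x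
      using that A by (simp add: poly_sum l_eval if_distrib cong: if_cong)
    ultimately have "r = (\<Sum>a\<in>A. smult (poly r a) (l a))"
      using rdeg A by (intro poly_eqI_degree[of A]) auto
    then have "L r = (\<Sum>a\<in>A. poly r a * w a)"
      unfolding w_def by (metis (no_types, lifting) moment_functional_smult moment_functional_sum sum.cong)
    moreover have "poly f a = poly r a" if "a \<in> A" for a
      using that by (subst fr) (simp add: A_def)
    ultimately show ?thesis by (simp add: Lf mult.commute)
  qed
  \<comment> \<open>Apply the quadrature formula to the square of the Lagrange polynomial, which has degree below
    \<open>2 n\<close>.\<close>
  have "w a \<ge> 0" if a: "a \<in> A" for a
  proof -
    have "degree (l a * l a) < 2 * n"
      using degree_mult_le[of "l a" "l a"] l_deg[OF a] by simp
    then have "L (l a * l a) = (\<Sum>b\<in>A. w b * poly (l a * l a) b)" by (rule quad)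
    also have "\<dots> = w a" using a A by (simp add: l_eval if_distrib cong: if_cong)
    finally have "w a = L (l a * l a)" ..
    moreover have "l a \<noteq> 0" using l_eval[OF a a] by auto
    ultimately show ?thesis using pos[of "l a"] by simp
  qed
  moreover have "t k = (\<Sum>a\<in>A. w a * a ^ k)" if "k < 2 * n" for k
    using quad[of "monom 1 k"] that by (simp add: moment_functional_monom degree_monom_eq poly_monom)
  ultimately show thesis using that[OF A(1,3)] by blast
qed

end

section \<open>Existence of representing measures\<close>

lemma nonneg_tight:
  fixes \<mu> :: "nat \<Rightarrow> real measure"
  assumes dist: "\<And>n. real_distribution (\<mu> n)"
    and nonneg: "\<And>n. AE x in \<mu> n. 0 \<le> x"
    and mean: "\<And>n. integrable (\<mu> n) (\<lambda>x. x)" "\<And>n. (\<integral>x. x \<partial>\<mu> n) \<le> C"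
  shows "tight \<mu>"
  unfolding tight_def
proof (intro conjI allI impI dist)
  fix e :: real assume e: "e > 0"
  define b where "b = (\<bar>C\<bar> + 1) / e"
  have b: "b > 0" using e by (simp add: b_def)
  have "measure (\<mu> n) {-1<..b} > 1 - e" for n
  proof -
    interpret real_distribution "\<mu> n" by (rule dist)
    have "measure (\<mu> n) {x \<in> space (\<mu> n). x \<ge> b} \<le> (\<integral>x. x \<partial>\<mu> n) / b"
      by (rule integral_Markov_inequality_measure[where A = "{}"]) (use mean nonneg b in auto)
    also have "\<dots> \<le> C / b" using mean(2)[of n] b by (simp add: divide_right_mono)
    also have "\<dots> < e"
    proof -
      have "C < e * b" using e by (simp add: b_def)
      then show ?thesis using b by (simp add: field_simps)
    qed
    finally have small: "prob {x \<in> space (\<mu> n). x \<ge> b} < e" .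
    have "prob (space (\<mu> n) - {-1<..b}) \<le> prob {x \<in> space (\<mu> n). x \<ge> b}"
    proof (rule finite_measure_mono_AE)
      show "AE x in \<mu> n. x \<in> space (\<mu> n) - {-1<..b} \<longrightarrow> x \<in> {x \<in> space (\<mu> n). x \<ge> b}"
        using nonneg[of n] by eventually_elim auto
    qed simp
    moreover have "prob (space (\<mu> n) - {-1<..b}) = 1 - prob {-1<..b}"
      by (rule prob_compl) simp
    ultimately show ?thesis using small by linarith
  qed
  then show "\<exists>a b. a < b \<and> (\<forall>n. 1 - e < measure (\<mu> n) {a<..b})"
    using b by (intro exI[of _ "-1"] exI[of _ b]) auto
qed

text \<open>The first moments are bounded, so the measures are tight and a subsequence converges weakly. A moment
is the integral of an unbounded function, which weak convergence does not control. Replacing \<open>x\<close>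
by \<open>min m x\<close> in \<open>x\<^sup>k\<close> costs at most the moment of order \<open>k + 1\<close> divided by \<open>m\<close>, uniformly in the sequence.\<close>

lemma moment_limit:
  fixes \<mu> :: "nat \<Rightarrow> real measure" and t :: "nat \<Rightarrow> real"
  assumes dist: "\<And>n. real_distribution (\<mu> n)"
    and nonneg: "\<And>n. AE x in \<mu> n. 0 \<le> x"
    and mom: "\<And>n k. k < 2 * Suc n \<Longrightarrow> has_bochner_integral (\<mu> n) (\<lambda>x. x ^ k) (s n k)"
    and lim: "\<And>k. (\<lambda>n. s n k) \<longlonglongrightarrow> t k"
  shows "\<exists>M. prob_space M \<and> represents M t"
proof -
  obtain C where C: "\<And>n. \<bar>s n 1\<bar> \<le> C"
    using convergent_imp_bounded[OF lim[of 1]] by (auto simp: bounded_iff)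
  have mean: "has_bochner_integral (\<mu> n) (\<lambda>x. x) (s n 1)" for n using mom[of 1 n] by simp
  have "tight \<mu>"
  proof (rule nonneg_tight[OF dist nonneg])
    show "integrable (\<mu> n) (\<lambda>x. x)" "(\<integral>x. x \<partial>\<mu> n) \<le> C" for n
      using mean[of n] C[of n] by (auto simp: has_bochner_integral_iff)
  qed
  then obtain r M where r: "strict_mono (r :: nat \<Rightarrow> nat)" and M: "real_distribution M"
    and weak: "weak_conv_m (\<mu> \<circ> id \<circ> r) M"
    using tight_imp_convergent_subsubsequence[OF _ strict_mono_id] by blast
  interpret M: real_distribution M by (rule M)
  have conv: "(\<lambda>n. \<integral>x. f x \<partial>\<mu> (r n)) \<longlonglongrightarrow> (\<integral>x. f x \<partial>M)"
    if "\<And>x. isCont f x" "\<And>x. norm (f x) \<le> B" for f :: "real \<Rightarrow> real" and B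
    using weak_conv_imp_integral_bdd_continuous_conv[OF _ M weak that] dist by simp
  have M_nonneg: "AE x in M. 0 \<le> x"
  proof -
    \<comment> \<open>a bounded continuous function that is positive exactly on the negative half-line\<close>
    define g :: "real \<Rightarrow> real" where "g x = min 1 (max 0 (- x))" for x
    have g: "\<And>x. isCont g x" "\<And>x. norm (g x) \<le> 1" "\<And>x. 0 \<le> g x"
      unfolding g_def by (auto intro!: continuous_intros)
    have [measurable]: "g \<in> borel_measurable borel" unfolding g_def by simp
    have "(\<integral>x. g x \<partial>\<mu> n) = 0" for n
    proof -
      interpret real_distribution "\<mu> n" by (rule dist)
      have "AE x in \<mu> n. g x = 0" using nonneg[of n] by eventually_elim (simp add: g_def)
      then show ?thesis by (rule integral_eq_zero_AE)
    qed
    then have "(\<integral>x. g x \<partial>M) = 0" using conv[OF g(1,2)] by (simp add: LIMSEQ_const_iff)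
    moreover have "integrable M g"
      by (rule M.integrable_const_bound[of _ 1]) (use g in auto)
    ultimately have "AE x in M. g x = 0"
      using integral_nonneg_eq_0_iff_AE[of M g] g by simp
    then show ?thesis by eventually_elim (auto simp: g_def min_def max_def split: if_splits)
  qed
  have M_mom: "has_bochner_integral M (\<lambda>x. x ^ k) (t k)" for k
  proof -
    define f :: "nat \<Rightarrow> real \<Rightarrow> real" where "f m x = (min (real (Suc m)) (max 0 x)) ^ k" for m x
    have cont: "isCont (f m) x" for m x unfolding f_def by (auto intro!: continuous_intros)
    have [measurable]: "f m \<in> borel_measurable borel" for m unfolding f_def by simp
    have bound: "norm (f m x) \<le> real (Suc m) ^ k" for m x
      unfolding f_def norm_power by (rule power_mono) auto
    have int: "integrable (\<mu> n) (f m)" for n m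
    proof -
      interpret real_distribution "\<mu> n" by (rule dist)
      show ?thesis by (rule integrable_const_bound[of _ "real (Suc m) ^ k"]) (use bound in auto)
    qed
    have intM: "integrable M (f m)" for m
      by (rule M.integrable_const_bound[of _ "real (Suc m) ^ k"]) (use bound in auto)
    have f_le: "f m x \<le> x ^ k" if "0 \<le> x" for m x
      unfolding f_def using that by (intro power_mono) auto
    have f_ge: "x ^ k - x ^ Suc k / real (Suc m) \<le> f m x" if x: "0 \<le> x" for m x
    proof (cases "x \<le> real (Suc m)")
      case True
      then have "f m x = x ^ k" using x by (simp add: f_def)
      then show ?thesis using x by simp
    next
      case False
      then have "x ^ k * real (Suc m) \<le> x ^ k * x" using x by (intro mult_left_mono) auto
      then have "x ^ k \<le> x ^ Suc k / real (Suc m)" by (simp add: field_simps)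
      moreover have "0 \<le> f m x" by (simp add: f_def)
      ultimately show ?thesis by linarith
    qed
    have ev: "eventually (\<lambda>n. s (r n) k - s (r n) (Suc k) / real (Suc m) \<le> (\<integral>x. f m x \<partial>\<mu> (r n)) \<and>
        (\<integral>x. f m x \<partial>\<mu> (r n)) \<le> s (r n) k) sequentially" for m
    proof (rule eventually_sequentiallyI[of k], intro conjI)
      fix n assume "n \<ge> k"
      then have "Suc k < 2 * Suc (r n)" using seq_suble[OF r, of n] by simp
      then have h: "has_bochner_integral (\<mu> (r n)) (\<lambda>x. x ^ k) (s (r n) k)"
        "has_bochner_integral (\<mu> (r n)) (\<lambda>x. x ^ Suc k) (s (r n) (Suc k))"
        by (intro mom; simp)+
      have h': "has_bochner_integral (\<mu> (r n)) (\<lambda>x. x ^ k - x ^ Suc k / real (Suc m))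
          (s (r n) k - s (r n) (Suc k) / real (Suc m))"
        by (intro has_bochner_integral_diff has_bochner_integral_divide_zero h)
      have "(\<integral>x. (x ^ k - x ^ Suc k / real (Suc m)) \<partial>\<mu> (r n)) \<le> (\<integral>x. f m x \<partial>\<mu> (r n))"
        using nonneg[of "r n"] h' int f_ge
        by (intro integral_mono_AE) (auto simp: has_bochner_integral_iff elim!: eventually_mono)
      then show "s (r n) k - s (r n) (Suc k) / real (Suc m) \<le> (\<integral>x. f m x \<partial>\<mu> (r n))"
        using h' by (simp add: has_bochner_integral_iff)
      have "(\<integral>x. f m x \<partial>\<mu> (r n)) \<le> (\<integral>x. x ^ k \<partial>\<mu> (r n))"
        using nonneg[of "r n"] h int f_le
        by (intro integral_mono_AE) (auto simp: has_bochner_integral_iff elim!: eventually_mono)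
      then show "(\<integral>x. f m x \<partial>\<mu> (r n)) \<le> s (r n) k"
        using h by (simp add: has_bochner_integral_iff)
    qed
    have slim: "(\<lambda>n. s (r n) k) \<longlonglongrightarrow> t k" for k
      using LIMSEQ_subseq_LIMSEQ[OF lim r] by (simp add: o_def)
    have lower: "t k - t (Suc k) / real (Suc m) \<le> (\<integral>x. f m x \<partial>M)" for m
    proof (rule tendsto_le[OF _ conv[OF cont bound]])
      show "(\<lambda>n. s (r n) k - s (r n) (Suc k) / real (Suc m)) \<longlonglongrightarrow> t k - t (Suc k) / real (Suc m)"
        by (intro tendsto_intros slim) simp
    qed (use ev[of m] in \<open>auto elim: eventually_mono\<close>)
    have upper: "(\<integral>x. f m x \<partial>M) \<le> t k" for m
      by (rule tendsto_le[OF _ slim conv[OF cont bound]]) (use ev[of m] in \<open>auto elim: eventually_mono\<close>)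
    have "(\<lambda>m. t k - t (Suc k) * inverse (real (Suc m))) \<longlonglongrightarrow> t k - t (Suc k) * 0"
      by (intro tendsto_diff tendsto_mult tendsto_const LIMSEQ_inverse_real_of_nat)
    then have "(\<lambda>m. t k - t (Suc k) / real (Suc m)) \<longlonglongrightarrow> t k" by (simp only: divide_inverse mult_zero_right diff_zero)
    from real_tendsto_sandwich[OF always_eventually always_eventually this tendsto_const]
    have flim: "(\<lambda>m. \<integral>x. f m x \<partial>M) \<longlonglongrightarrow> t k" by this (intro allI lower upper)+
    have mono: "f m x \<le> f m' x" if "m \<le> m'" for m m' x
      unfolding f_def using that by (intro power_mono) (auto simp: min_def)
    have ptw: "(\<lambda>m. f m x) \<longlonglongrightarrow> (max 0 x) ^ k" for x
    proof (rule tendsto_eventually)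
      obtain m0 where "x \<le> real m0" using real_arch_simple by blast
      then show "eventually (\<lambda>m. f m x = (max 0 x) ^ k) sequentially"
        by (intro eventually_sequentiallyI[of m0]) (auto simp: f_def min_def)
    qed
    have "has_bochner_integral M (\<lambda>x. (max 0 x) ^ k) (t k)"
    proof (rule has_bochner_integral_monotone_convergence[OF intM _ _ flim])
      show "AE x in M. mono (\<lambda>m. f m x)" using mono by (auto simp: mono_def)
      show "AE x in M. (\<lambda>m. f m x) \<longlonglongrightarrow> (max 0 x) ^ k" using ptw by simp
    qed simp
    then show ?thesis
      by (rule has_bochner_integral_cong_AE[THEN iffD1, rotated 3])
        (use M_nonneg in \<open>auto elim!: eventually_mono\<close>)
  qed
  define M' where "M' = restrict_space M {0..}"
  have "sets M' = sets Rplus_borel"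
    unfolding M'_def Rplus_borel_def by (rule sets_restrict_space_cong) simp
  moreover have "has_bochner_integral M' (\<lambda>x. x ^ k) (t k)" for k
  proof -
    have "has_bochner_integral M (\<lambda>x. indicator {0..} x *\<^sub>R x ^ k) (t k)"
      by (rule has_bochner_integral_cong_AE[THEN iffD1, OF _ _ _ M_mom[of k]])
        (use M_nonneg in \<open>auto elim!: eventually_mono\<close>)
    then show ?thesis unfolding M'_def by (subst has_bochner_integral_restrict_space) auto
  qed
  moreover have "prob_space M'"
  proof (rule prob_spaceI)
    have "emeasure M {0..} = 1" by (rule M.emeasure_eq_1_AE) (use M_nonneg in simp_all)
    then show "emeasure M' (space M') = 1"
      unfolding M'_def by (simp add: space_restrict_space emeasure_restrict_space)
  qed
  ultimately show ?thesis by (auto simp: represents_def)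
qed

lemma moment_functional_unit_interval:
  "moment_functional (\<lambda>n. 1 / real (Suc n)) p = integral {0..1} (poly p)"
proof -
  have mono: "((\<lambda>x. x ^ i) has_integral 1 / real (Suc i)) {0..1::real}" for i
  proof -
    have "((\<lambda>x. x ^ Suc i / real (Suc i)) has_real_derivative x ^ i) (at x within {0..1})" for x :: real
      by (auto intro!: derivative_eq_intros simp del: power_Suc of_nat_Suc)
    then have "((\<lambda>x. x ^ i) has_integral 1 ^ Suc i / real (Suc i) - 0 ^ Suc i / real (Suc i)) {0..1::real}"
      by (intro fundamental_theorem_of_calculus) (auto simp: has_real_derivative_iff_has_vector_derivative)
    then show ?thesis by simp
  qed
  have "((\<lambda>x. \<Sum>i\<le>degree p. coeff p i * x ^ i) has_integral
      (\<Sum>i\<le>degree p. coeff p i * (1 / real (Suc i)))) {0..1}"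
    by (intro has_integral_sum has_integral_mult_right mono) simp
  moreover have "(\<lambda>x. \<Sum>i\<le>degree p. coeff p i * x ^ i) = poly p"
    by (rule ext) (simp add: poly_altdef)
  ultimately show ?thesis unfolding moment_functional_def by (metis integral_unique)
qed

text \<open>The moments of Lebesgue measure on the unit interval, a strictly positive perturbation to be added to
a sequence that is merely nonnegative.\<close>

lemma positive_functional_unit_interval: "positive_functional (\<lambda>n. 1 / real (Suc n))"
proof -
  have *: "0 < integral {0..1} (poly q)"
    if "q \<noteq> 0" "\<And>x. x \<in> {0..1} \<Longrightarrow> 0 \<le> poly q x" for q :: "real poly"
  proof -
    have cont: "continuous_on {0..1} (poly q)" by (intro continuous_intros)
    have "infinite {0..1::real}" by (simp add: infinite_Icc)
    then have "\<not> {0..1} \<subseteq> {x. poly q x = 0}"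
      using poly_roots_finite[OF that(1)] finite_subset by blast
    then have "integral {0..1} (poly q) \<noteq> 0"
      using integral_eq_0_iff[OF cont _ that(2)] by auto
    moreover have "0 \<le> integral {0..1} (poly q)"
      by (rule integral_nonneg) (use cont integrable_continuous_real that in auto)
    ultimately show ?thesis by simp
  qed
  show ?thesis
    by unfold_locales (unfold moment_functional_unit_interval, (rule *; simp)+)
qed

lemma stieltjes_moment_existence:
  assumes t: "stieltjes_positive t" and t0: "t 0 = 1"
  shows "\<exists>M. prob_space M \<and> represents M t"
proof -
  define e where "e n = 1 / real (Suc n)" for n
  define a where "a n = 1 / (1 + e n)" for n
  \<comment> \<open>The perturbation tends to zero; the factor \<open>a n\<close> keeps the total mass equal to one.\<close>
  define s where "s n k = a n * t k + a n * e n * (1 / real (Suc k))" for n k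
  have e: "e n > 0" for n by (simp add: e_def)
  have a: "a n > 0" for n using e[of n] by (simp add: a_def)
  have "e \<longlonglongrightarrow> 0"
    unfolding e_def using LIMSEQ_inverse_real_of_nat by (simp add: inverse_eq_divide)
  then have "a \<longlonglongrightarrow> 1 / (1 + 0)" unfolding a_def by (intro tendsto_intros) auto
  then have lim: "(\<lambda>n. s n k) \<longlonglongrightarrow> 1 / (1 + 0) * t k + 1 / (1 + 0) * 0 * (1 / real (Suc k))" for k
    unfolding s_def using \<open>e \<longlonglongrightarrow> 0\<close> by (intro tendsto_intros)
  have s0: "s n 0 = 1" for n
    using e[of n] unfolding s_def a_def by (simp add: t0 field_simps)
  have pos: "positive_functional (s n)" for n
  proof
    interpret u: positive_functional "\<lambda>n. 1 / real (Suc n)" by (rule positive_functional_unit_interval)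
    have eq: "moment_functional (s n) q = a n * moment_functional t q +
        a n * e n * moment_functional (\<lambda>n. 1 / real (Suc n)) q" for q
      unfolding s_def by (rule moment_functional_scale_seq)
    fix p :: "real poly" assume "p \<noteq> 0"
    then show "0 < moment_functional (s n) (p * p)" "0 < moment_functional (s n) (pCons 0 (p * p))"
      unfolding eq
      by (intro add_nonneg_pos mult_nonneg_nonneg mult_pos_pos e a less_imp_le[OF a]
          u.pos u.pos_x stieltjes_positive_functional[OF t]; assumption)+
  qed
  have "\<exists>\<mu>. real_distribution \<mu> \<and> (AE x in \<mu>. 0 \<le> x) \<and>
      (\<forall>k<2 * Suc n. has_bochner_integral \<mu> (\<lambda>x. x ^ k) (s n k))" for n
  proof -
    interpret positive_functional "s n" by (rule pos)
    obtain A w where A: "finite A" "\<And>a. a \<in> A \<Longrightarrow> a > (0::real)" "\<And>a. a \<in> A \<Longrightarrow> w a \<ge> 0"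
      "\<And>k. k < 2 * Suc n \<Longrightarrow> s n k = (\<Sum>a\<in>A. w a * a ^ k)"
      using gauss_quadrature[of "Suc n"] by blast
    define P where "P = point_measure A (\<lambda>a. ennreal (w a))"
    define \<mu> where "\<mu> = distr P borel (\<lambda>x. x)"
    have [measurable]: "(\<lambda>x. x) \<in> P \<rightarrow>\<^sub>M borel" by (simp add: P_def)
    have "emeasure P (space P) = (\<Sum>a\<in>A. ennreal (w a))"
      unfolding P_def using A by (simp add: space_point_measure emeasure_point_measure_finite)
    also have "\<dots> = ennreal (s n 0)" using A by (simp add: sum_ennreal)
    finally have "prob_space P" by (intro prob_spaceI) (simp add: s0)
    then have "real_distribution \<mu>"
      unfolding \<mu>_def by (intro real_distribution.intro prob_space.prob_space_distr)
        (auto simp: real_distribution_axioms_def)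
    moreover have "AE x in \<mu>. 0 \<le> x"
    proof -
      have "AE x in P. 0 \<le> x" unfolding P_def AE_point_measure using A(2) by (auto intro: less_imp_le)
      then show ?thesis unfolding \<mu>_def by (subst AE_distr_iff) simp_all
    qed
    moreover have "has_bochner_integral \<mu> (\<lambda>x. x ^ k) (s n k)" if "k < 2 * Suc n" for k
    proof -
      have "has_bochner_integral P (\<lambda>x. x ^ k) (s n k)"
        unfolding has_bochner_integral_iff P_def using A(1,3) A(4)[OF that]
        by (simp add: integrable_point_measure_finite lebesgue_integral_point_measure_finite)
      then show ?thesis unfolding \<mu>_def
        by (simp add: has_bochner_integral_iff integrable_distr_eq integral_distr)
    qed
    ultimately show ?thesis by blast
  qed
  then obtain \<mu> where \<mu>: "\<And>n. real_distribution (\<mu> n)" "\<And>n. AE x in \<mu> n. 0 \<le> x"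
    "\<And>n k. k < 2 * Suc n \<Longrightarrow> has_bochner_integral (\<mu> n) (\<lambda>x. x ^ k) (s n k)"
    by metis
  show ?thesis
    by (rule moment_limit[OF \<mu>]) (use lim in simp_all)
qed

section \<open>Quasi-analytic families of functions\<close>

text \<open>The inequality of Carleman for decreasing sequences. With \<open>G\<^sub>n\<close> the mean of the first \<open>n\<close> terms,
monotonicity gives \<open>G\<^sub>2\<^sub>n \<le> \<surd>(G\<^sub>n a\<^sub>n) \<le> G\<^sub>n / 4 + a\<^sub>n\<close> and \<open>G\<^sub>2\<^sub>n\<^sub>+\<^sub>1 \<le> G\<^sub>2\<^sub>n\<close>, so up to a constant a
partial sum is bounded by half of itself plus twice the sum of the \<open>a\<^sub>n\<close>.\<close>

lemma summable_geometric_means: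
  fixes a :: "nat \<Rightarrow> real"
  assumes pos: "\<And>n. 0 < a n" and dec: "decseq a" and sum: "summable a"
  shows "summable (\<lambda>n. root (Suc n) (\<Prod>i<Suc n. a i))"
proof -
  define G where "G n = root n (\<Prod>i<n. a i)" for n
  have P_pos: "0 < (\<Prod>i<n. a i)" for n using pos by (intro prod_pos) simp
  have G_pos: "0 < G n" if "n > 0" for n
    unfolding G_def using that P_pos by (intro real_root_gt_zero)
  have G_pow: "G n ^ n = (\<Prod>i<n. a i)" if "n > 0" for n
    unfolding G_def using that P_pos[of n] by (intro real_root_pow_pos2) auto
  have a_le_G: "a n \<le> G n" if "n > 0" for n
  proof (rule power_le_imp_le_base[where n = "n - 1"])
    have "a n ^ n \<le> (\<Prod>i<n. a i)"
      using prod_mono[of "{..<n}" "\<lambda>_. a n" a] pos dec by (auto simp: decseq_def less_imp_le)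
    then show "a n ^ Suc (n - 1) \<le> G n ^ Suc (n - 1)" using G_pow[OF that] that by simp
  qed (use G_pos[OF that] in simp)
  have G_dec: "G (Suc n) \<le> G n" if "n > 0" for n
  proof (rule power_le_imp_le_base[where n = n])
    have "G (Suc n) ^ Suc n = G n ^ n * a n" using G_pow[of "Suc n"] G_pow[OF that] by simp
    also have "\<dots> \<le> G n ^ n * G n"
      using a_le_G[OF that] G_pos[OF that] by (intro mult_left_mono) auto
    finally show "G (Suc n) ^ Suc n \<le> G n ^ Suc n" by (simp add: mult.commute)
  qed (use G_pos[OF that] in simp)
  \<comment> \<open>The second half of the product is at most \<open>a n ^ n\<close>; then use the inequality of the two
    means.\<close>
  have G_double: "G (2 * n) \<le> G n / 4 + a n" if n: "n > 0" for n
  proof (rule power_le_imp_le_base[where n = "2 * n - 1"])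
    have "G (2 * n) ^ (2 * n) = (\<Prod>i<n. a i) * (\<Prod>i\<in>{n..<2 * n}. a i)"
      using G_pow[of "2 * n"] n
        prod.union_disjoint[of "{..<n}" "{n..<2 * n}" a] by (simp add: ivl_disj_un ivl_disj_int)
    also have "(\<Prod>i\<in>{n..<2 * n}. a i) \<le> (\<Prod>i\<in>{n..<2 * n}. a n)"
      using pos dec by (intro prod_mono) (auto simp: decseq_def less_imp_le)
    then have "(\<Prod>i<n. a i) * (\<Prod>i\<in>{n..<2 * n}. a i) \<le> (\<Prod>i<n. a i) * a n ^ n"
      using P_pos[of n] by (intro mult_left_mono) auto
    also have "\<dots> = (G n * a n) ^ n" by (simp add: G_pow[OF n] power_mult_distrib)
    also have "\<dots> \<le> ((G n / 4 + a n)\<^sup>2) ^ n"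
    proof (rule power_mono)
      have "0 \<le> (G n / 4 - a n)\<^sup>2" by simp
      then show "G n * a n \<le> (G n / 4 + a n)\<^sup>2" by (simp add: power2_eq_square algebra_simps)
    qed (use G_pos[OF n] pos[of n] in simp)
    finally show "G (2 * n) ^ Suc (2 * n - 1) \<le> (G n / 4 + a n) ^ Suc (2 * n - 1)"
      using n by (simp add: power_mult[symmetric])
  qed (use G_pos[OF n] pos[of n] in simp)
  define A where "A = suminf a"
  have A: "(\<Sum>n<N. a (Suc n)) \<le> A" for N
  proof -
    have "(\<Sum>n<N. a (Suc n)) \<le> (\<Sum>n<Suc N. a n)" unfolding sum.lessThan_Suc_shift using pos[of 0] by simp
    also have "\<dots> \<le> A" unfolding A_def using sum pos by (intro sum_le_suminf) (auto simp: less_imp_le)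
    finally show ?thesis .
  qed
  define S where "S N = (\<Sum>n<N. G (Suc n))" for N
  have S_mono: "S m \<le> S n" if "m \<le> n" for m n
    unfolding S_def using that G_pos by (intro sum_mono2) (auto simp: less_imp_le)
  have S_rec: "S (Suc (2 * N)) \<le> G 1 + (\<Sum>n<N. G (Suc n) / 2 + 2 * a (Suc n))" for N
  proof (induction N)
    case (Suc N)
    have "S (Suc (2 * Suc N)) = S (Suc (2 * N)) + G (2 * Suc N) + G (Suc (2 * Suc N))"
      by (simp add: S_def)
    also have "G (Suc (2 * Suc N)) \<le> G (2 * Suc N)" by (rule G_dec) simp
    also have "G (2 * Suc N) \<le> G (Suc N) / 4 + a (Suc N)" by (rule G_double) simp
    finally show ?case using Suc.IH by simp
  qed (simp add: S_def)
  have "S N \<le> 2 * G 1 + 4 * A" for N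
  proof -
    have "S (Suc (2 * N)) \<le> G 1 + S N / 2 + 2 * (\<Sum>n<N. a (Suc n))"
      using S_rec[of N] by (simp add: S_def sum.distrib sum_divide_distrib sum_distrib_left)
    then show ?thesis using A[of N] S_mono[of N "Suc (2 * N)"] by simp
  qed
  then have "summable (\<lambda>n. G (Suc n))"
    using G_pos by (intro summableI_nonneg_bounded[of _ "2 * G 1 + 4 * A"]) (auto simp: S_def less_imp_le)
  then show ?thesis by (simp only: G_def)
qed

lemma exp_partial_sum_le:
  fixes x :: real
  assumes "0 \<le> x"
  shows "(\<Sum>j<m. x ^ j / fact j) \<le> exp x"
proof -
  have "(\<lambda>j. x ^ j / fact j) sums exp x"
    using exp_converges[of x] by (simp add: divide_inverse mult.commute)
  then show ?thesis
    using assms by (metis (mono_tags, lifting) divide_nonneg_pos fact_gt_zero finite_lessThan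
        sum_le_suminf sums_iff zero_le_power)
qed

text \<open>This is the theorem of Denjoy and Carleman in the form of Bang. Here \<open>d k\<close> plays the role of the
\<open>k\<close>-th derivative of \<open>d 0\<close>, by virtue of the Taylor estimates. Measure the size of all derivatives
at \<open>t\<close> by the largest \<open>N\<close> with \<open>|d k t| \<le> exp (k - N) M k\<close> for all \<open>k\<close>. The Taylor estimate up to the
derivative of order \<open>N + 1\<close> shows that a step of length \<open>1 / (e r N)\<close> lowers \<open>N + 1\<close> to \<open>N\<close> at worst. At the
origin \<open>N\<close> may be taken arbitrarily large, and as these lengths have a divergent sum, at a given \<open>t\<close>
it is still arbitrarily large.\<close>

lemma quasi_analytic_family_vanishes:
  fixes d :: "nat \<Rightarrow> real \<Rightarrow> real" and M r :: "nat \<Rightarrow> real"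
  assumes M_pos: "\<And>k. 0 < M k" and M_Suc: "\<And>k. M (Suc k) = r k * M k"
    and r_pos: "\<And>k. 0 < r k" and r_inc: "incseq r"
    and diverge: "\<not> summable (\<lambda>k. 1 / r k)"
    and bound: "\<And>k t. \<bar>d k t\<bar> \<le> M k"
    and taylor: "\<And>k m t h. 0 \<le> h \<Longrightarrow>
      \<bar>d k (t + h) - (\<Sum>j<m. h ^ j / fact j * d (k + j) t)\<bar> \<le> h ^ m / fact m * M (k + m)"
    and zero: "\<And>k. d k 0 = 0"
    and t: "0 \<le> t"
  shows "d 0 t = 0"
proof -
  \<comment> \<open>the size of all derivatives at \<open>t\<close>, on a logarithmic scale\<close>
  define P where "P N t \<longleftrightarrow> (\<forall>k. \<bar>d k t\<bar> \<le> exp (real k - real N) * M k)" for N t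
  have M_growth: "M (k + j) \<le> M k * r N ^ j" if "k + j \<le> Suc N" for k j N
    using that
  proof (induction j)
    case (Suc j)
    have "M (k + Suc j) = r (k + j) * M (k + j)" using M_Suc by simp
    also have "\<dots> \<le> r N * (M k * r N ^ j)"
      using Suc r_inc r_pos M_pos by (intro mult_mono) (auto simp: incseq_def less_imp_le)
    finally show ?case by (simp add: mult_ac)
  qed simp
  have step: "P N (t + h)" if PS: "P (Suc N) t" and h: "0 \<le> h" "h \<le> 1 / (exp 1 * r N)" for N t h
    unfolding P_def
  proof
    fix k
    show "\<bar>d k (t + h)\<bar> \<le> exp (real k - real N) * M k"
    proof (cases "N \<le> k")
      case True
      have "\<bar>d k (t + h)\<bar> \<le> 1 * M k" using bound by simp
      also have "\<dots> \<le> exp (real k - real N) * M k"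
        using True M_pos[of k] by (intro mult_right_mono) auto
      finally show ?thesis .
    next
      case False
      define m where "m = Suc N - k"
      have km: "k + m = Suc N" using False by (simp add: m_def)
      define x where "x = exp 1 * h * r N"
      have x: "0 \<le> x" "x \<le> 1"
        using h r_pos[of N] by (auto simp: x_def field_simps less_imp_le)
      define c where "c = exp (real k - real (Suc N)) * M k"
      have c: "c > 0" using M_pos by (simp add: c_def)
      have summand: "h ^ j / fact j * \<bar>d (k + j) t\<bar> \<le> c * (x ^ j / fact j)" if "j < m" for j
      proof -
        have "\<bar>d (k + j) t\<bar> \<le> exp (real (k + j) - real (Suc N)) * M (k + j)"
          using PS unfolding P_def by blast
        also have "\<dots> \<le> exp (real (k + j) - real (Suc N)) * (M k * r N ^ j)"
          using km that by (intro mult_left_mono M_growth) auto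
        also have "exp (real (k + j) - real (Suc N)) = exp (real k - real (Suc N)) * exp 1 ^ j"
          by (simp add: exp_of_nat_mult[symmetric] exp_add[symmetric])
        finally have "h ^ j / fact j * \<bar>d (k + j) t\<bar> \<le>
            h ^ j / fact j * (exp (real k - real (Suc N)) * exp 1 ^ j * (M k * r N ^ j))"
          using h by (intro mult_left_mono) auto
        also have "\<dots> = c * (x ^ j / fact j)"
          by (simp add: c_def x_def power_mult_distrib)
        finally show ?thesis .
      qed
      have last: "h ^ m / fact m * M (k + m) \<le> c * (x ^ m / fact m)"
      proof -
        have "h ^ m / fact m * M (k + m) \<le> h ^ m / fact m * (M k * r N ^ m)"
          using km h by (intro mult_left_mono M_growth) auto
        also have "\<dots> = c * (x ^ m / fact m)"
        proof -
          have "exp (real k - real (Suc N)) * exp 1 ^ m = (1::real)"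
            using km by (simp add: exp_of_nat_mult[symmetric] exp_add[symmetric] flip: of_nat_add)
          then show ?thesis by (simp add: c_def x_def power_mult_distrib)
        qed
        finally show ?thesis .
      qed
      have "\<bar>d k (t + h)\<bar> \<le> \<bar>\<Sum>j<m. h ^ j / fact j * d (k + j) t\<bar> + h ^ m / fact m * M (k + m)"
        using taylor[OF h(1), of k t m] by linarith
      also have "\<bar>\<Sum>j<m. h ^ j / fact j * d (k + j) t\<bar> \<le> (\<Sum>j<m. h ^ j / fact j * \<bar>d (k + j) t\<bar>)"
        using h by (intro order_trans[OF sum_abs]) (simp add: abs_mult)
      also have "\<dots> \<le> (\<Sum>j<m. c * (x ^ j / fact j))" using summand by (intro sum_mono) auto
      finally have "\<bar>d k (t + h)\<bar> \<le> c * (\<Sum>j<Suc m. x ^ j / fact j)"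
        using last by (simp add: sum_distrib_left distrib_left)
      also have "\<dots> \<le> c * exp 1"
        using exp_partial_sum_le[OF x(1), of "Suc m"] x(2) c
        by (intro mult_left_mono) (auto intro: order_trans)
      also have "\<dots> = exp (real k - real N) * M k"
        by (simp add: c_def exp_add[symmetric] mult.assoc mult.commute[of "M k"])
      finally show ?thesis .
    qed
  qed
  have steps: "P N (t + h)"
    if "P (N + n) t" "0 \<le> h" "h \<le> (\<Sum>i<n. 1 / (exp 1 * r (N + i)))" for N n t h
    using that
  proof (induction n arbitrary: t h)
    case (Suc n)
    \<comment> \<open>Walk as far as the current level permits, then continue with the next level.\<close>
    define h1 where "h1 = min h (1 / (exp 1 * r (N + n)))"
    have "0 \<le> h1" using Suc.prems(2) r_pos[of "N + n"] by (simp add: h1_def less_imp_le)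
    then have "P (N + n) (t + h1)" using Suc.prems(1) by (intro step) (auto simp: h1_def)
    then have "P N ((t + h1) + (h - h1))"
    proof (rule Suc.IH)
      show "0 \<le> h - h1" by (simp add: h1_def)
      have "0 \<le> (\<Sum>i<n. 1 / (exp 1 * r (N + i)))" using r_pos by (intro sum_nonneg) (auto simp: less_imp_le)
      then show "h - h1 \<le> (\<Sum>i<n. 1 / (exp 1 * r (N + i)))"
        using Suc.prems(3) by (auto simp: h1_def min_def)
    qed
    then show ?case by simp
  qed simp
  have P_t: "P N t" for N
  proof -
    \<comment> \<open>Starting at a high level, the divergent sum of step lengths reaches \<open>t\<close> above level
      \<open>N\<close>.\<close>
    have "\<exists>n. t \<le> (\<Sum>i<n. 1 / (exp 1 * r (N + i)))"
    proof (rule ccontr)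
      assume "\<not> ?thesis"
      then have "summable (\<lambda>i. 1 / (exp 1 * r (N + i)))"
        using r_pos by (intro summableI_nonneg_bounded[of _ t]) (auto simp: less_imp_le not_le)
      then have "summable (\<lambda>i. exp 1 * (1 / (exp 1 * r (N + i))))" by (rule summable_mult)
      then have "summable (\<lambda>i. 1 / r (i + N))" by (simp add: add.commute)
      then show False using diverge summable_iff_shift[of "\<lambda>i. 1 / r i" N] by blast
    qed
    then obtain n where n: "t \<le> (\<Sum>i<n. 1 / (exp 1 * r (N + i)))" ..
    have "P (N + n) 0" unfolding P_def using zero M_pos by (auto simp: less_imp_le)
    from steps[OF this t n] show ?thesis by simp
  qed
  have "\<bar>d 0 t\<bar> \<le> 0"
  proof (rule LIMSEQ_le_const)
    have "(\<lambda>N. exp (- 1) ^ N * M 0) \<longlonglongrightarrow> 0 * M 0"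
      by (intro tendsto_mult tendsto_const LIMSEQ_realpow_zero) auto
    then show "(\<lambda>N. exp (- real N) * M 0) \<longlonglongrightarrow> 0" by (simp add: exp_of_nat_mult[symmetric])
    show "\<exists>K. \<forall>N\<ge>K. \<bar>d 0 t\<bar> \<le> exp (- real N) * M 0"
      using P_t unfolding P_def by (metis diff_0 of_nat_0)
  qed
  then show ?thesis by simp
qed

section \<open>The Carleman condition for Stieltjes moments\<close>

lemma cos_taylor_bound:
  fixes a u :: real
  shows "\<bar>cos (a + u) - (\<Sum>j<m. u ^ j / fact j * cos (a + real j * (pi / 2)))\<bar> \<le> \<bar>u\<bar> ^ m / fact m"
proof -
  define diff where "diff j u = cos (a + u + real j * (pi / 2))" for j :: nat and u
  have "DERIV (diff j) u :> diff (Suc j) u" for j u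
  proof -
    have "a + u + real (Suc j) * (pi / 2) = (a + u + real j * (pi / 2)) + pi / 2"
      by (simp add: distrib_right)
    then have "diff (Suc j) u = - sin (a + u + real j * (pi / 2))"
      unfolding diff_def by (simp only: cos_add[of _ "pi / 2"]) simp
    moreover have "DERIV (\<lambda>u. cos (a + u + c)) u :> - sin (a + u + c)" for c
      by (auto intro!: derivative_eq_intros)
    ultimately show ?thesis unfolding diff_def by metis
  qed
  then obtain \<xi> where "diff 0 u = (\<Sum>j<m. (diff j 0 / fact j) * u ^ j) + (diff m \<xi> / fact m) * u ^ m"
    using Maclaurin_all_le[of diff "diff 0" u m] by auto
  then have "cos (a + u) - (\<Sum>j<m. u ^ j / fact j * cos (a + real j * (pi / 2))) = diff m \<xi> / fact m * u ^ m"
    by (simp add: diff_def mult.commute)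
  also have "\<bar>\<dots>\<bar> = \<bar>diff m \<xi>\<bar> * (\<bar>u\<bar> ^ m / fact m)" by (simp add: abs_mult power_abs)
  also have "\<dots> \<le> 1 * (\<bar>u\<bar> ^ m / fact m)"
  proof (rule mult_right_mono)
    show "\<bar>diff m \<xi>\<bar> \<le> 1" unfolding diff_def by (rule abs_cos_le_one)
  qed simp
  finally show ?thesis by simp
qed

lemma space_Rplus: "sets \<mu> = sets Rplus_borel \<Longrightarrow> space \<mu> = {0..}"
  by (drule sets_eq_imp_space_eq) (simp add: Rplus_borel_def space_restrict_space)

lemma borel_measurable_Rplus:
  assumes "sets \<mu> = sets Rplus_borel" "f \<in> borel \<rightarrow>\<^sub>M N"
  shows "f \<in> \<mu> \<rightarrow>\<^sub>M N"
  using assms(2) measurable_cong_sets[OF assms(1) refl, of N]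
  by (simp add: Rplus_borel_def measurable_restrict_space1)

text \<open>The geometric mean of the two neighbouring moments for odd \<open>k\<close>, and a moment for even \<open>k\<close>. It depends
on the sequence only, hence is a common bound for all representing measures.\<close>

definition half_moment :: "(nat \<Rightarrow> real) \<Rightarrow> nat \<Rightarrow> real" where
  "half_moment t k = sqrt (t (k div 2) * t (Suc k div 2))"

text \<open>For odd \<open>k\<close>, integrate the pointwise bound
\<open>\<surd>s \<le> (c + s / c) / 2\<close> with the optimal \<open>c\<close>.\<close>

lemma half_moment_bound:
  assumes rep: "represents \<mu> t" and pos: "\<And>n. 0 < t n"
  shows "integrable \<mu> (\<lambda>s. sqrt s ^ k)" "(\<integral>s. sqrt s ^ k \<partial>\<mu>) \<le> half_moment t k"
proof -
  have sets: "sets \<mu> = sets Rplus_borel" and mom: "\<And>n. has_bochner_integral \<mu> (\<lambda>s. s ^ n) (t n)"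
    using rep by (auto simp: represents_def)
  define n where "n = k div 2"
  have "\<exists>g. has_bochner_integral \<mu> g (half_moment t k) \<and> (\<forall>s\<in>space \<mu>. 0 \<le> sqrt s ^ k \<and> sqrt s ^ k \<le> g s)"
  proof (cases "even k")
    case True
    then have k: "k = 2 * n" by (simp add: n_def)
    have "sqrt s ^ k = s ^ n" if "s \<in> space \<mu>" for s
      using that unfolding k by (simp add: space_Rplus[OF sets] power_mult)
    moreover have "half_moment t k = t n" using pos[of n] by (simp add: half_moment_def k)
    ultimately show ?thesis using mom[of n] by (intro exI[of _ "\<lambda>s. s ^ n"]) (auto simp: space_Rplus[OF sets])
  next
    case False
    then have k: "k = Suc (2 * n)" by (simp add: n_def)
    \<comment> \<open>This choice makes both terms of the bound equal after integration.\<close>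
    define c where "c = sqrt (t (Suc n) / t n)"
    have c: "c > 0" using pos[of n] pos[of "Suc n"] by (simp add: c_def)
    have cc: "c * c = t (Suc n) / t n" using pos[of n] pos[of "Suc n"] by (simp add: c_def)
    have hm: "half_moment t k = c * t n"
    proof -
      have "half_moment t k = sqrt (t (Suc n) * t n)" by (simp add: half_moment_def k mult.commute)
      also have "t (Suc n) * t n = (c * t n)\<^sup>2"
        using cc pos[of n] by (simp add: power2_eq_square field_simps)
      finally show ?thesis using c pos[of n] by simp
    qed
    have "c * t n = (c * t n + t (Suc n) / c) / 2"
      using cc c pos[of n] by (simp add: field_simps)
    moreover have "has_bochner_integral \<mu> (\<lambda>s. (c * s ^ n + s ^ Suc n / c) / 2) ((c * t n + t (Suc n) / c) / 2)"
      by (intro has_bochner_integral_divide_zero has_bochner_integral_add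
          has_bochner_integral_mult_right mom)
    ultimately have "has_bochner_integral \<mu> (\<lambda>s. (c * s ^ n + s ^ Suc n / c) / 2) (half_moment t k)"
      unfolding hm by metis
    moreover have "sqrt s ^ k \<le> (c * s ^ n + s ^ Suc n / c) / 2" if "s \<in> space \<mu>" for s
    proof -
      have s: "0 \<le> s" using that by (simp add: space_Rplus[OF sets])
      have "0 \<le> (c - sqrt s)\<^sup>2" by simp
      then have "2 * c * sqrt s \<le> c * c + s"
        using s by (simp add: power2_eq_square algebra_simps)
      then have "sqrt s \<le> (c + s / c) / 2" using c by (simp add: field_simps)
      then have "s ^ n * sqrt s \<le> s ^ n * ((c + s / c) / 2)" using s by (intro mult_left_mono) auto
      moreover have "sqrt s ^ k = s ^ n * sqrt s" using s by (simp add: k power_mult)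
      ultimately show ?thesis by (simp add: algebra_simps)
    qed
    ultimately show ?thesis by (force simp: space_Rplus[OF sets])
  qed
  then obtain g where g: "has_bochner_integral \<mu> g (half_moment t k)"
    "\<And>s. s \<in> space \<mu> \<Longrightarrow> 0 \<le> sqrt s ^ k" "\<And>s. s \<in> space \<mu> \<Longrightarrow> sqrt s ^ k \<le> g s" by blast
  have [measurable]: "(\<lambda>s. sqrt s ^ k) \<in> borel_measurable \<mu>"
    by (rule borel_measurable_Rplus[OF sets]) simp
  show int: "integrable \<mu> (\<lambda>s. sqrt s ^ k)"
    by (rule Bochner_Integration.integrable_bound[of _ g])
      (use g in \<open>auto simp: has_bochner_integral_iff intro!: AE_I2 order_trans[OF _ abs_ge_self]\<close>)
  have "(\<integral>s. sqrt s ^ k \<partial>\<mu>) \<le> (\<integral>s. g s \<partial>\<mu>)"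
    using int g by (intro integral_mono) (auto simp: has_bochner_integral_iff)
  then show "(\<integral>s. sqrt s ^ k \<partial>\<mu>) \<le> half_moment t k" using g(1) by (simp add: has_bochner_integral_iff)
qed

text \<open>The \<open>k\<close>-th derivative in \<open>\<tau>\<close> of the integral of \<open>cos (\<tau> \<surd>s)\<close>, written out so that no derivative
has to be taken under an integral.\<close>

definition cos_derivative_integral :: "real measure \<Rightarrow> nat \<Rightarrow> real \<Rightarrow> real" where
  "cos_derivative_integral \<mu> k \<tau> = (\<integral>s. sqrt s ^ k * cos (\<tau> * sqrt s + real k * (pi / 2)) \<partial>\<mu>)"

lemma cos_derivative_integral_estimates:
  assumes rep: "represents \<mu> t" and pos: "\<And>n. 0 < t n"
  shows "\<bar>cos_derivative_integral \<mu> k \<tau>\<bar> \<le> half_moment t k"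
    and "0 \<le> h \<Longrightarrow> \<bar>cos_derivative_integral \<mu> k (\<tau> + h) -
      (\<Sum>j<m. h ^ j / fact j * cos_derivative_integral \<mu> (k + j) \<tau>)\<bar> \<le> h ^ m / fact m * half_moment t (k + m)"
    and "cos_derivative_integral \<mu> k 0 = (if even k then t (k div 2) * cos (real k * (pi / 2)) else 0)"
proof -
  have sets: "sets \<mu> = sets Rplus_borel" and mom: "\<And>n. has_bochner_integral \<mu> (\<lambda>s. s ^ n) (t n)"
    using rep by (auto simp: represents_def)
  note int = half_moment_bound(1)[OF rep pos] and le = half_moment_bound(2)[OF rep pos]
  define F where "F k \<tau> s = sqrt s ^ k * cos (\<tau> * sqrt s + real k * (pi / 2))" for k \<tau> s
  have C: "cos_derivative_integral \<mu> k \<tau> = (\<integral>s. F k \<tau> s \<partial>\<mu>)" for k \<tau>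
    by (simp add: cos_derivative_integral_def F_def)
  have F_le: "\<bar>F k \<tau> s\<bar> \<le> sqrt s ^ k" if "s \<in> space \<mu>" for k \<tau> s
    unfolding F_def abs_mult using that
    by (intro order_trans[OF mult_left_mono[OF abs_cos_le_one]]) (auto simp: space_Rplus[OF sets])
  have [measurable]: "F k \<tau> \<in> borel_measurable \<mu>" for k \<tau>
    unfolding F_def by (rule borel_measurable_Rplus[OF sets]) simp
  have intF: "integrable \<mu> (F k \<tau>)" for k \<tau>
    by (rule Bochner_Integration.integrable_bound[OF int[of k]])
      (auto intro!: AE_I2 order_trans[OF F_le abs_ge_self])
  show "\<bar>cos_derivative_integral \<mu> k \<tau>\<bar> \<le> half_moment t k"
  proof -
    have "\<bar>\<integral>s. F k \<tau> s \<partial>\<mu>\<bar> \<le> (\<integral>s. \<bar>F k \<tau> s\<bar> \<partial>\<mu>)" by (rule integral_abs_bound)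
    also have "\<dots> \<le> (\<integral>s. sqrt s ^ k \<partial>\<mu>)"
      by (intro integral_mono int F_le integrable_abs intF)
    finally show ?thesis using le[of k] by (simp add: C)
  qed
  show "\<bar>cos_derivative_integral \<mu> k (\<tau> + h) -
      (\<Sum>j<m. h ^ j / fact j * cos_derivative_integral \<mu> (k + j) \<tau>)\<bar> \<le> h ^ m / fact m * half_moment t (k + m)"
    if h: "0 \<le> h"
  proof -
    define R where "R s = F k (\<tau> + h) s - (\<Sum>j<m. h ^ j / fact j * F (k + j) \<tau> s)" for s
    have R_le: "\<bar>R s\<bar> \<le> h ^ m / fact m * sqrt s ^ (k + m)" if "s \<in> space \<mu>" for s
    proof -
      define x where "x = sqrt s"
      have x: "0 \<le> x" using that by (simp add: x_def space_Rplus[OF sets])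
      define a where "a = \<tau> * x + real k * (pi / 2)"
      have ang: "(\<tau> + h) * x + real k * (pi / 2) = a + h * x"
        "\<tau> * x + real (k + j) * (pi / 2) = a + real j * (pi / 2)" for j
        by (simp_all add: a_def algebra_simps)
      define Z where "Z = cos (a + h * x) - (\<Sum>j<m. (h * x) ^ j / fact j * cos (a + real j * (pi / 2)))"
      have "R s = x ^ k * Z"
        unfolding Z_def R_def F_def x_def[symmetric]
        by (simp only: ang) (simp add: right_diff_distrib sum_distrib_left power_mult_distrib power_add mult_ac)
      also have "\<bar>\<dots>\<bar> = x ^ k * \<bar>Z\<bar>" using x by (simp add: abs_mult)
      also have "\<dots> \<le> x ^ k * (\<bar>h * x\<bar> ^ m / fact m)"
        unfolding Z_def using x by (intro mult_left_mono cos_taylor_bound) simp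
      also have "\<dots> = h ^ m / fact m * x ^ (k + m)"
        using h x by (simp add: power_mult_distrib power_add abs_mult)
      finally show ?thesis by (simp add: x_def)
    qed
    have intR: "integrable \<mu> R"
      unfolding R_def by (intro Bochner_Integration.integrable_diff Bochner_Integration.integrable_sum
          integrable_mult_right intF)
    have "cos_derivative_integral \<mu> k (\<tau> + h) -
        (\<Sum>j<m. h ^ j / fact j * cos_derivative_integral \<mu> (k + j) \<tau>) = (\<integral>s. R s \<partial>\<mu>)"
      unfolding R_def C by (simp add: intF)
    also have "\<bar>\<dots>\<bar> \<le> (\<integral>s. \<bar>R s\<bar> \<partial>\<mu>)" by (rule integral_abs_bound)
    also have "\<dots> \<le> (\<integral>s. h ^ m / fact m * sqrt s ^ (k + m) \<partial>\<mu>)"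
      by (intro integral_mono R_le integrable_abs intR integrable_mult_right int)
    also have "\<dots> \<le> h ^ m / fact m * half_moment t (k + m)"
      using le[of "k + m"] h by (simp add: int mult_left_mono divide_right_mono)
    finally show ?thesis .
  qed
  show "cos_derivative_integral \<mu> k 0 = (if even k then t (k div 2) * cos (real k * (pi / 2)) else 0)"
  proof (cases "even k")
    case True
    then have k: "k = 2 * (k div 2)" by simp
    have "(\<integral>s. F k 0 s \<partial>\<mu>) = (\<integral>s. s ^ (k div 2) * cos (real k * (pi / 2)) \<partial>\<mu>)"
    proof (rule Bochner_Integration.integral_cong)
      fix s assume "s \<in> space \<mu>"
      then have "sqrt s ^ k = s ^ (k div 2)"
        by (subst k) (simp add: power_mult space_Rplus[OF sets] del: dvd_mult_div_cancel)
      then show "F k 0 s = s ^ (k div 2) * cos (real k * (pi / 2))" by (simp add: F_def)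
    qed simp
    then show ?thesis using True mom[of "k div 2"] by (simp add: C has_bochner_integral_iff)
  next
    case False
    then obtain n where "k = Suc (2 * n)" by (metis oddE Suc_eq_plus1)
    then have "real k * (pi / 2) = real n * pi + pi / 2" by (simp add: field_simps)
    then have "cos (real k * (pi / 2)) = 0" by (simp only: cos_add) simp
    then show ?thesis using False by (simp add: C F_def)
  qed
qed

text \<open>Integrate \<open>s\<^sup>n (s - c)\<^sup>2 \<ge> 0\<close> with \<open>c\<close> the ratio of the moments of orders \<open>n + 1\<close> and \<open>n\<close>.\<close>

lemma moments_log_convex:
  assumes rep: "represents \<mu> t" and pos: "\<And>n. 0 < t n"
  shows "t (Suc n) / t n \<le> t (Suc (Suc n)) / t (Suc n)"
proof -
  have sets: "sets \<mu> = sets Rplus_borel" and mom: "\<And>n. has_bochner_integral \<mu> (\<lambda>s. s ^ n) (t n)"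
    using rep by (auto simp: represents_def)
  define c where "c = t (Suc n) / t n"
  have hb: "has_bochner_integral \<mu> (\<lambda>s. s ^ Suc (Suc n) - 2 * c * s ^ Suc n + c\<^sup>2 * s ^ n)
      (t (Suc (Suc n)) - 2 * c * t (Suc n) + c\<^sup>2 * t n)"
    by (intro has_bochner_integral_add has_bochner_integral_diff has_bochner_integral_mult_right mom)
  have "0 \<le> (\<integral>s. s ^ Suc (Suc n) - 2 * c * s ^ Suc n + c\<^sup>2 * s ^ n \<partial>\<mu>)"
  proof (rule Bochner_Integration.integral_nonneg)
    show "0 \<le> s ^ Suc (Suc n) - 2 * c * s ^ Suc n + c\<^sup>2 * s ^ n" if "s \<in> space \<mu>" for s
  proof -
    have "0 \<le> s ^ n * (s - c)\<^sup>2" using that by (simp add: space_Rplus[OF sets])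
    then show ?thesis by (simp add: power2_eq_square algebra_simps)
    qed
  qed
  then have "0 \<le> t (Suc (Suc n)) - 2 * c * t (Suc n) + c\<^sup>2 * t n"
    by (simp only: has_bochner_integral_integral_eq[OF hb])
  then have "t (Suc n) * t (Suc n) \<le> t n * t (Suc (Suc n))"
    using pos[of n] by (simp add: c_def power2_eq_square field_simps)
  then show ?thesis using pos[of n] pos[of "Suc n"] by (simp add: field_simps)
qed

text \<open>At \<open>\<tau> = 0\<close> the derivatives of even order are moments, up to sign, and those of odd order vanish.
So the difference of the two sides has only zero derivatives there.\<close>

lemma cos_integrals_eq:
  assumes rep: "represents \<mu> t" "represents \<nu> t" and pos: "\<And>n. 0 < t n"
    and div: "\<not> summable (\<lambda>n. sqrt (t n / t (Suc n)))"
  shows "(\<integral>s. cos (\<tau> * sqrt s) \<partial>\<mu>) = (\<integral>s. cos (\<tau> * sqrt s) \<partial>\<nu>)"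
proof -
  define d where "d k \<tau> = cos_derivative_integral \<mu> k \<tau> - cos_derivative_integral \<nu> k \<tau>" for k \<tau>
  define M where "M k = 2 * half_moment t k" for k
  define r where "r k = sqrt (t (Suc (k div 2)) / t (k div 2))" for k
  have hpos: "0 < half_moment t k" for k using pos by (simp add: half_moment_def)
  have "d 0 \<tau> = 0" if "0 \<le> \<tau>" for \<tau>
  proof (rule quasi_analytic_family_vanishes[OF _ _ _ _ _ _ _ _ that])
    show "0 < M k" for k using hpos by (simp add: M_def)
    show "0 < r k" for k using pos by (simp add: r_def)
    show "M (Suc k) = r k * M k" for k
    proof -
      have p: "0 < t (k div 2)" using pos by auto
      have "r k * half_moment t k =
          sqrt (t (Suc (k div 2)) / t (k div 2) * (t (k div 2) * t (Suc k div 2)))"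
        unfolding r_def half_moment_def by (rule real_sqrt_mult[symmetric])
      also have "\<dots> = sqrt (t (Suc k div 2) * t (Suc (Suc k) div 2))"
        using p by (simp add: mult.commute)
      finally show ?thesis by (simp add: M_def half_moment_def)
    qed
    show "incseq r"
    proof (rule incseq_SucI)
      fix k
      show "r k \<le> r (Suc k)"
        using moments_log_convex[OF rep(1) pos, of "k div 2"] by (cases "even k") (auto simp: r_def)
    qed
    show "\<not> summable (\<lambda>k. 1 / r k)"
    proof
      assume "summable (\<lambda>k. 1 / r k)"
      then have "summable ((\<lambda>k. 1 / r k) \<circ> (\<lambda>n. 2 * n))"
        by (rule summable_reindex) (use pos in \<open>auto simp: inj_on_def r_def less_imp_le\<close>)
      moreover have "((\<lambda>k. 1 / r k) \<circ> (\<lambda>n. 2 * n)) = (\<lambda>n. sqrt (t n / t (Suc n)))"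
        by (auto simp: r_def real_sqrt_divide)
      ultimately show False using div by simp
    qed
    show "\<bar>d k \<tau>\<bar> \<le> M k" for k \<tau>
      using cos_derivative_integral_estimates(1)[OF rep(1) pos, of k \<tau>] cos_derivative_integral_estimates(1)[OF rep(2) pos, of k \<tau>]
      unfolding d_def M_def by linarith
    show "\<bar>d k (\<tau> + h) - (\<Sum>j<m. h ^ j / fact j * d (k + j) \<tau>)\<bar> \<le> h ^ m / fact m * M (k + m)"
      if "0 \<le> h" for k m \<tau> h
      using cos_derivative_integral_estimates(2)[OF rep(1) pos that, of k \<tau> m]
        cos_derivative_integral_estimates(2)[OF rep(2) pos that, of k \<tau> m]
      unfolding d_def M_def right_diff_distrib sum_subtractf by (simp only: mult.left_commute)
    show "d k 0 = 0" for k
      unfolding d_def cos_derivative_integral_estimates(3)[OF rep(1) pos] cos_derivative_integral_estimates(3)[OF rep(2) pos] by simp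
  qed
  from this[of "\<bar>\<tau>\<bar>"] have "(\<integral>s. cos (\<bar>\<tau>\<bar> * sqrt s) \<partial>\<mu>) = (\<integral>s. cos (\<bar>\<tau>\<bar> * sqrt s) \<partial>\<nu>)"
    by (simp add: d_def cos_derivative_integral_def)
  then show ?thesis by (cases "0 \<le> \<tau>") auto
qed

text \<open>The law of \<open>\<surd>s\<close> with a random sign. Its characteristic function is the cosine integral, and \<open>\<mu>\<close> is
recovered as its image under squaring.\<close>

definition symmetrized_sqrt :: "real measure \<Rightarrow> real measure" where
  "symmetrized_sqrt \<mu> =
     distr (\<mu> \<Otimes>\<^sub>M measure_pmf (bernoulli_pmf (1/2))) borel (\<lambda>z. if snd z then sqrt (fst z) else - sqrt (fst z))"

context
  fixes \<mu> :: "real measure"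
  assumes prob: "prob_space \<mu>" and sets: "sets \<mu> = sets Rplus_borel"
begin

interpretation mu: prob_space \<mu> by (rule prob)

interpretation pair_prob_space \<mu> "measure_pmf (bernoulli_pmf (1/2))" ..

lemma symmetrized_sqrt_measurable [measurable]:
  "(\<lambda>z. if snd z then sqrt (fst z) else - sqrt (fst z)) \<in>
     \<mu> \<Otimes>\<^sub>M measure_pmf (bernoulli_pmf (1/2)) \<rightarrow>\<^sub>M borel"
proof -
  have [measurable]: "sqrt \<in> \<mu> \<rightarrow>\<^sub>M borel" by (rule borel_measurable_Rplus[OF sets]) simp
  have [measurable]: "(\<lambda>b. b) \<in> measure_pmf (bernoulli_pmf (1/2)) \<rightarrow>\<^sub>M count_space UNIV" by simp
  show ?thesis by measurable
qed

lemma real_distribution_symmetrized_sqrt: "real_distribution (symmetrized_sqrt \<mu>)"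
  unfolding symmetrized_sqrt_def
  by (intro real_distribution.intro P.prob_space_distr symmetrized_sqrt_measurable)
    (simp add: real_distribution_axioms_def)

lemma char_symmetrized_sqrt:
  "char (symmetrized_sqrt \<mu>) \<tau> = complex_of_real (\<integral>s. cos (\<tau> * sqrt s) \<partial>\<mu>)"
proof -
  let ?f = "\<lambda>z. if snd z then sqrt (fst z) else - sqrt (fst z)"
  have [measurable]: "sqrt \<in> \<mu> \<rightarrow>\<^sub>M borel" by (rule borel_measurable_Rplus[OF sets]) simp
  have int: "integrable (\<mu> \<Otimes>\<^sub>M measure_pmf (bernoulli_pmf (1/2))) (\<lambda>z. iexp (\<tau> * ?f z))"
    by (rule P.integrable_const_bound[of _ 1]) simp_all
  have "char (symmetrized_sqrt \<mu>) \<tau> =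
      (\<integral>z. iexp (\<tau> * ?f z) \<partial>(\<mu> \<Otimes>\<^sub>M measure_pmf (bernoulli_pmf (1/2))))"
    unfolding char_def symmetrized_sqrt_def by (rule integral_distr) measurable
  also have "\<dots> = (\<integral>s. \<integral>b. iexp (\<tau> * ?f (s, b)) \<partial>measure_pmf (bernoulli_pmf (1/2)) \<partial>\<mu>)"
    by (rule integral_fst'[OF int, symmetric])
  also have "\<dots> = (\<integral>s. complex_of_real (cos (\<tau> * sqrt s)) \<partial>\<mu>)"
  proof (rule Bochner_Integration.integral_cong)
    fix s
    have "(\<integral>b. iexp (\<tau> * ?f (s, b)) \<partial>measure_pmf (bernoulli_pmf (1/2))) =
        (iexp (\<tau> * sqrt s) + iexp (- (\<tau> * sqrt s))) / 2"
      by (subst integral_measure_pmf[of UNIV]) (auto simp: UNIV_bool scaleR_conv_of_real)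
    also have "\<dots> = complex_of_real (cos (\<tau> * sqrt s))"
      by (simp add: cos_of_real[symmetric] cos_exp_eq)
    finally show "(\<integral>b. iexp (\<tau> * ?f (s, b)) \<partial>measure_pmf (bernoulli_pmf (1/2))) =
        complex_of_real (cos (\<tau> * sqrt s))" .
  qed simp
  also have "\<dots> = complex_of_real (\<integral>s. cos (\<tau> * sqrt s) \<partial>\<mu>)" by (rule integral_complex_of_real)
  finally show ?thesis .
qed

lemma emeasure_symmetrized_sqrt:
  assumes A: "A \<in> sets \<mu>"
  shows "emeasure (symmetrized_sqrt \<mu>) ((\<lambda>x. x\<^sup>2) -` A) = emeasure \<mu> A"
proof -
  have Ab: "A \<in> sets borel" "A \<subseteq> {0..}"
    using A sets.sets_into_space[OF A] unfolding sets Rplus_borel_def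
    by (auto simp: sets_restrict_space_iff space_restrict_space)
  have [measurable]: "(\<lambda>x. x\<^sup>2) -` A \<in> sets borel"
    using measurable_sets[of "\<lambda>x::real. x\<^sup>2" borel borel A] Ab by simp
  let ?P = "\<mu> \<Otimes>\<^sub>M measure_pmf (bernoulli_pmf (1/2))"
  have "emeasure (symmetrized_sqrt \<mu>) ((\<lambda>x. x\<^sup>2) -` A) =
      emeasure ?P ((\<lambda>z. if snd z then sqrt (fst z) else - sqrt (fst z)) -` ((\<lambda>x. x\<^sup>2) -` A) \<inter> space ?P)"
    unfolding symmetrized_sqrt_def by (rule emeasure_distr) simp_all
  also have "(\<lambda>z. if snd z then sqrt (fst z) else - sqrt (fst z)) -` ((\<lambda>x. x\<^sup>2) -` A) \<inter> space ?P =
      fst -` A \<inter> space ?P"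
    by (auto simp: space_pair_measure space_Rplus[OF sets] split: if_splits)
  also have "emeasure ?P (fst -` A \<inter> space ?P) = emeasure (distr ?P \<mu> fst) A"
    by (rule emeasure_distr[symmetric]) (simp_all add: A)
  also have "distr ?P \<mu> fst = \<mu>" by (rule measure_pmf.distr_pair_fst)
  finally show ?thesis .
qed

end

text \<open>The symmetrized square roots have the same characteristic function, so the theorem of Levy applies.\<close>

lemma represents_eqI_prob:
  assumes rep: "represents \<mu> t" "represents \<nu> t" and pos: "\<And>n. 0 < t n" and t0: "t 0 = 1"
    and div: "\<not> summable (\<lambda>n. sqrt (t n / t (Suc n)))"
  shows "\<mu> = \<nu>"
proof -
  have prob: "prob_space M" if "represents M t" for M
  proof (rule prob_spaceI)
    have "has_bochner_integral M (\<lambda>s. s ^ 0) (t 0)" using that unfolding represents_def by blast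
    then have "measure M (space M) = 1"
      by (simp add: has_bochner_integral_iff t0)
    then show "emeasure M (space M) = 1"
      by (cases "emeasure M (space M)") (auto simp: measure_def)
  qed
  have sets: "sets \<mu> = sets Rplus_borel" "sets \<nu> = sets Rplus_borel"
    using rep by (auto simp: represents_def)
  note m = prob[OF rep(1)] sets(1) and n = prob[OF rep(2)] sets(2)
  have "char (symmetrized_sqrt \<mu>) = char (symmetrized_sqrt \<nu>)"
    by (rule ext) (simp add: char_symmetrized_sqrt[OF m] char_symmetrized_sqrt[OF n]
        cos_integrals_eq[OF rep pos div])
  then have eq: "symmetrized_sqrt \<mu> = symmetrized_sqrt \<nu>"
    by (intro Levy_uniqueness real_distribution_symmetrized_sqrt m n)
  show ?thesis
  proof (rule measure_eqI)
    show "emeasure \<mu> A = emeasure \<nu> A" if "A \<in> sets \<mu>" for A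
      using emeasure_symmetrized_sqrt[OF m that] emeasure_symmetrized_sqrt[OF n, of A] that sets eq by simp
  qed (simp add: sets)
qed

lemma represents_eqI:
  assumes rep: "represents \<mu> t" "represents \<nu> t" and pos: "\<And>n. 0 < t n"
    and div: "\<not> summable (\<lambda>n. sqrt (t n / t (Suc n)))"
  shows "\<mu> = \<nu>"
proof -
  define c where "c = 1 / t 0"
  have c: "0 < c" using pos by (simp add: c_def)
  have scale: "represents (density M (\<lambda>_. c)) (\<lambda>n. c * t n)" if "represents M t" for M
  proof -
    have "has_bochner_integral (density M (\<lambda>_. ennreal c)) (\<lambda>s. s ^ n) (c * t n)" for n
      using that c unfolding represents_def
      by (intro has_bochner_integral_density) (auto intro: borel_measurable_Rplus has_bochner_integral_mult_right)
    then show ?thesis using that by (simp add: represents_def)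
  qed
  have dens: "density \<mu> (\<lambda>_. c) = density \<nu> (\<lambda>_. c)"
  proof (rule represents_eqI_prob[OF scale[OF rep(1)] scale[OF rep(2)]])
    show "0 < c * t n" for n using c pos by simp
    show "c * t 0 = 1" using pos[of 0] by (simp add: c_def)
    show "\<not> summable (\<lambda>n. sqrt (c * t n / (c * t (Suc n))))" using div c by simp
  qed
  have sets: "sets \<mu> = sets \<nu>" using rep by (simp add: represents_def)
  show ?thesis
  proof (rule measure_eqI[OF sets])
    fix A assume A: "A \<in> sets \<mu>"
    have "emeasure (density \<mu> (\<lambda>_. c)) A = emeasure (density \<nu> (\<lambda>_. c)) A" by (simp only: dens)
    then have "ennreal c * emeasure \<mu> A = ennreal c * emeasure \<nu> A"
      using A sets by (simp add: emeasure_density_const)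
    then show "emeasure \<mu> A = emeasure \<nu> A"
      using c by (simp add: ennreal_mult_cancel_left)
  qed
qed

text \<open>The square roots of the ratios decrease by log-convexity, and as \<open>t 0 = 1\<close> their geometric means
telescope to the terms of the Carleman series.\<close>

lemma carleman_ratio_divergence:
  assumes rep: "represents \<mu> t" and pos: "\<And>n. 0 < t n" and t0: "t 0 = 1"
    and div: "(\<Sum>n. inverse (ennreal (root (2 * Suc n) (t (Suc n))))) = \<infinity>"
  shows "\<not> summable (\<lambda>n. sqrt (t n / t (Suc n)))"
proof
  define a where "a n = sqrt (t n / t (Suc n))" for n
  assume "summable (\<lambda>n. sqrt (t n / t (Suc n)))"
  moreover have "a = (\<lambda>n. sqrt (t n / t (Suc n)))" by (rule ext) (rule a_def)
  ultimately have sum: "summable a" by simp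
  have a_pos: "0 < a n" for n using pos by (simp add: a_def)
  have "decseq a"
  proof (rule decseq_SucI)
    fix n
    have "t (Suc n) / t (Suc (Suc n)) \<le> t n / t (Suc n)"
      using moments_log_convex[OF rep pos, of n] pos[of n] pos[of "Suc n"] pos[of "Suc (Suc n)"]
      by (simp add: field_simps)
    then show "a (Suc n) \<le> a n" by (simp add: a_def)
  qed
  from summable_geometric_means[OF a_pos this sum]
  have s: "summable (\<lambda>n. root (Suc n) (\<Prod>i<Suc n. a i))" .
  have prod: "(\<Prod>i<n. a i) = inverse (sqrt (t n))" for n
  proof (induction n)
    case (Suc n)
    have "inverse (sqrt (t n)) * a n = inverse (sqrt (t (Suc n)))"
      using pos[of n] by (simp add: a_def real_sqrt_divide field_simps)
    then show ?case using Suc by simp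
  qed (simp add: t0)
  have term_eq: "root (Suc n) (\<Prod>i<Suc n. a i) = inverse (root (2 * Suc n) (t (Suc n)))" for n
  proof -
    have "root (2 * Suc n) (t (Suc n)) = root (Suc n) (sqrt (t (Suc n)))"
      unfolding sqrt_def by (metis mult.commute real_root_mult_exp)
    then show ?thesis unfolding prod by (simp add: real_root_inverse)
  qed
  have p: "0 < root (2 * Suc n) (t (Suc n))" for n using pos by simp
  have "(\<Sum>n. inverse (ennreal (root (2 * Suc n) (t (Suc n))))) =
      (\<Sum>n. ennreal (inverse (root (2 * Suc n) (t (Suc n)))))"
    by (simp only: inverse_ennreal[OF p])
  also have "\<dots> = ennreal (\<Sum>n. inverse (root (2 * Suc n) (t (Suc n))))"
    using s p unfolding term_eq by (intro suminf_ennreal2) (auto simp: less_imp_le)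
  finally show False using div by simp
qed

text \<open>Divergence of the sum of the square roots of the ratios is unaffected by dropping the first term.\<close>

lemma carleman_determinate_shift:
  assumes rep: "represents \<mu> t" and pos: "\<And>n. 0 < t n" and t0: "t 0 = 1"
    and div: "(\<Sum>n. inverse (ennreal (root (2 * Suc n) (t (Suc n))))) = \<infinity>"
  shows "determinate_stieltjes (\<lambda>n. t (Suc n))"
proof -
  have sets: "sets \<mu> = sets Rplus_borel" and mom: "\<And>n. has_bochner_integral \<mu> (\<lambda>s. s ^ n) (t n)"
    using rep by (auto simp: represents_def)
  have "has_bochner_integral (density \<mu> (\<lambda>s. ennreal s)) (\<lambda>s. s ^ n) (t (Suc n))" for n
  proof (rule has_bochner_integral_density)
    show "has_bochner_integral \<mu> (\<lambda>s. s *\<^sub>R s ^ n) (t (Suc n))" using mom[of "Suc n"] by simp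
    show "AE s in \<mu>. 0 \<le> s" by (rule AE_I2) (simp add: space_Rplus[OF sets])
  qed (auto intro: borel_measurable_Rplus[OF sets])
  then have "represents (density \<mu> (\<lambda>s. ennreal s)) (\<lambda>n. t (Suc n))"
    by (simp add: represents_def sets)
  moreover have "\<not> summable (\<lambda>n. sqrt (t (Suc n) / t (Suc (Suc n))))"
    using carleman_ratio_divergence[OF rep pos t0 div]
      summable_Suc_iff[of "\<lambda>n. sqrt (t n / t (Suc n))"] by simp
  then have "\<mu>' = \<nu>'" if "represents \<mu>' (\<lambda>n. t (Suc n))" "represents \<nu>' (\<lambda>n. t (Suc n))" for \<mu>' \<nu>'
    using represents_eqI[OF that] pos by blast
  ultimately show ?thesis
    unfolding determinate_stieltjes_def stieltjes_moment_sequence_def by blast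
qed

section \<open>Iterates of the weighted shift\<close>

lemma tree_par_Trunk: "enat (Suc k) \<le> \<kappa> \<Longrightarrow> tree_par \<eta> \<kappa> (Trunk k) = Trunk (Suc k)"
  unfolding tree_par_def tree_E_def J_set_def
  by (rule the_equality) (auto intro!: exI[of _ "Suc k"])

lemma tree_par_Branch_1: "i \<in> J_set \<eta> \<Longrightarrow> tree_par \<eta> \<kappa> (Branch i (Suc 0)) = Trunk 0"
  unfolding tree_par_def tree_E_def by (rule the_equality) auto

lemma tree_par_Branch_Suc: "i \<in> J_set \<eta> \<Longrightarrow> tree_par \<eta> \<kappa> (Branch i (Suc (Suc j))) = Branch i (Suc j)"
  unfolding tree_par_def tree_E_def by (rule the_equality) auto

lemma Trunk_in_tree_V: "Trunk k \<in> tree_V \<eta> \<kappa> \<longleftrightarrow> enat k \<le> \<kappa>"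
  by (cases k) (auto simp: tree_V_def J_set_def zero_enat_def[symmetric])

lemma Branch_in_tree_V: "Branch i j \<in> tree_V \<eta> \<kappa> \<longleftrightarrow> i \<in> J_set \<eta> \<and> 1 \<le> j"
  by (auto simp: tree_V_def)

lemma Trunk_in_nonroot: "Trunk k \<in> tree_V_nonroot \<eta> \<kappa> \<longleftrightarrow> enat (Suc k) \<le> \<kappa>"
  by (cases \<kappa>) (auto simp: tree_V_nonroot_def Trunk_in_tree_V)

lemma Branch_in_nonroot: "Branch i j \<in> tree_V_nonroot \<eta> \<kappa> \<longleftrightarrow> i \<in> J_set \<eta> \<and> 1 \<le> j"
  by (auto simp: tree_V_nonroot_def Branch_in_tree_V)

lemma Lambda_map_Trunk:
  "Lambda_map \<eta> \<kappa> lam f (Trunk k) =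
     (if enat (Suc k) \<le> \<kappa> then lam (Trunk k) * f (Trunk (Suc k)) else 0)"
  by (simp add: Lambda_map_def Trunk_in_nonroot tree_par_Trunk)

lemma Lambda_map_Branch:
  "Lambda_map \<eta> \<kappa> lam f (Branch i j) =
     (if i \<in> J_set \<eta> \<and> 1 \<le> j
      then lam (Branch i j) * f (if j = 1 then Trunk 0 else Branch i (j - 1)) else 0)"
proof -
  consider "j = 0" | "j = Suc 0" | k where "j = Suc (Suc k)" by (metis not0_implies_Suc)
  then show ?thesis
    by cases (auto simp: Lambda_map_def Branch_in_nonroot tree_par_Branch_1 tree_par_Branch_Suc)
qed

lemmas Lambda_map_simps = Lambda_map_Trunk Lambda_map_Branch

lemma fun_vertex_eqI:
  "(\<And>k. f (Trunk k) = g (Trunk k)) \<Longrightarrow> (\<And>i j. f (Branch i j) = g (Branch i j)) \<Longrightarrow> f = g"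
  by (rule ext) (metis vertex.exhaust)

lemma Lambda_map_scale: "Lambda_map \<eta> \<kappa> lam (\<lambda>v. c * f v) = (\<lambda>v. c * Lambda_map \<eta> \<kappa> lam f v)"
  by (rule ext) (simp add: Lambda_map_def)

lemma Lambda_map_power_scale:
  "(Lambda_map \<eta> \<kappa> lam ^^ n) (\<lambda>v. c * f v) = (\<lambda>v. c * (Lambda_map \<eta> \<kappa> lam ^^ n) f v)"
  by (induction n) (simp_all add: Lambda_map_scale)

lemma Lambda_map_Branch_unit:
  assumes "i \<in> J_set \<eta>" "1 \<le> j"
  shows "Lambda_map \<eta> \<kappa> lam (unit_vec (Branch i j)) =
    (\<lambda>v. lam (Branch i (Suc j)) * unit_vec (Branch i (Suc j)) v)"
  using assms by (intro fun_vertex_eqI) (auto simp: Lambda_map_simps unit_vec_def)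

lemma Lambda_map_Trunk_unit:
  assumes "enat (Suc k) \<le> \<kappa>"
  shows "Lambda_map \<eta> \<kappa> lam (unit_vec (Trunk (Suc k))) = (\<lambda>v. lam (Trunk k) * unit_vec (Trunk k) v)"
  using assms by (intro fun_vertex_eqI) (auto simp: Lambda_map_simps unit_vec_def)

lemma Lambda_power_branch_root:
  assumes i: "i \<in> J_set \<eta>"
  shows "(Lambda_map \<eta> \<kappa> lam ^^ n) (unit_vec (Branch i 1)) =
    (\<lambda>v. (\<Prod>j=2..n+1. lam (Branch i j)) * unit_vec (Branch i (Suc n)) v)"
proof (induction n)
  case (Suc n)
  have "(\<Prod>j=2..Suc n+1. lam (Branch i j)) = (\<Prod>j=2..n+1. lam (Branch i j)) * lam (Branch i (Suc (Suc n)))"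
    by simp
  moreover have "1 \<le> Suc n" by simp
  ultimately show ?case
    by (simp only: funpow.simps o_apply Suc.IH Lambda_map_scale Lambda_map_Branch_unit[OF i] mult.assoc)
qed simp

lemma Lambda_power_Trunk_le:
  assumes k: "enat k \<le> \<kappa>" and n: "n \<le> k"
  shows "(Lambda_map \<eta> \<kappa> lam ^^ n) (unit_vec (Trunk k)) =
    (\<lambda>v. (\<Prod>j\<in>{k-n..<k}. lam (Trunk j)) * unit_vec (Trunk (k - n)) v)"
  using n
proof (induction n)
  case (Suc n)
  define m where "m = k - Suc n"
  have m: "k - n = Suc m" "{k - Suc n..<k} = insert m {k - n..<k}" "m \<notin> {k - n..<k}"
    using Suc.prems by (auto simp: m_def)
  have "enat (Suc m) \<le> \<kappa>" using k m(1) Suc.prems by (metis diff_le_self enat_ord_simps(1) order_trans)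
  then have "Lambda_map \<eta> \<kappa> lam (unit_vec (Trunk (k - n))) = (\<lambda>v. lam (Trunk m) * unit_vec (Trunk m) v)"
    unfolding m(1) by (rule Lambda_map_Trunk_unit)
  moreover have "(\<Prod>j\<in>{k - Suc n..<k}. lam (Trunk j)) = (\<Prod>j\<in>{k - n..<k}. lam (Trunk j)) * lam (Trunk m)"
    unfolding m(2) using m(3) by (simp add: mult.commute)
  moreover have "(Lambda_map \<eta> \<kappa> lam ^^ n) (unit_vec (Trunk k)) =
      (\<lambda>v. (\<Prod>j\<in>{k - n..<k}. lam (Trunk j)) * unit_vec (Trunk (k - n)) v)"
    using Suc by simp
  ultimately show ?case
    by (simp only: funpow.simps o_apply Lambda_map_scale m_def[symmetric] mult.assoc)
qed simp

lemma Lambda_power_Trunk_ge: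
  assumes k: "enat k \<le> \<kappa>"
  shows "(Lambda_map \<eta> \<kappa> lam ^^ (n + k)) (unit_vec (Trunk k)) =
    (\<lambda>v. (\<Prod>j<k. lam (Trunk j)) * (Lambda_map \<eta> \<kappa> lam ^^ n) (unit_vec (Trunk 0)) v)"
  using Lambda_power_Trunk_le[OF k order_refl, of \<eta> lam]
  by (simp add: funpow_add Lambda_map_power_scale atLeast0LessThan)

lemma Lambda_power_branching_vertex:
  "(Lambda_map \<eta> \<kappa> lam ^^ Suc n) (unit_vec (Trunk 0)) =
    (\<lambda>v. case v of Trunk k \<Rightarrow> 0 | Branch i j \<Rightarrow>
       if i \<in> J_set \<eta> \<and> j = Suc n then \<Prod>j=1..Suc n. lam (Branch i j) else 0)"
proof (induction n)
  case 0
  show ?case by (rule fun_vertex_eqI) (auto simp: Lambda_map_simps unit_vec_def)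
next
  case (Suc n)
  have "(Lambda_map \<eta> \<kappa> lam ^^ Suc (Suc n)) (unit_vec (Trunk 0)) =
      Lambda_map \<eta> \<kappa> lam ((Lambda_map \<eta> \<kappa> lam ^^ Suc n) (unit_vec (Trunk 0)))" by simp
  then show ?case unfolding Suc.IH
    by (intro fun_vertex_eqI) (auto simp: Lambda_map_simps mult_ac)
qed

lemma carr_ell2: "f \<in> carr (ell2 V) \<longleftrightarrow> (\<forall>v. v \<notin> V \<longrightarrow> f v = 0) \<and> (\<lambda>v. (cmod (f v))\<^sup>2) summable_on V"
  by (simp add: ell2_def)

lemma carr_ell2_scale: "f \<in> carr (ell2 V) \<Longrightarrow> (\<lambda>v. c * f v) \<in> carr (ell2 V)"
  by (auto simp: carr_ell2 norm_mult power_mult_distrib intro: summable_on_cmult_right)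

lemma unit_vec_carr:
  assumes "u \<in> V"
  shows "unit_vec u \<in> carr (ell2 V)"
proof -
  have "finite {v \<in> V. (cmod (unit_vec u v))\<^sup>2 \<noteq> 0}"
    by (rule finite_subset[of _ "{u}"]) (auto simp: unit_vec_def)
  then have "(\<lambda>v. (cmod (unit_vec u v))\<^sup>2) summable_on V"
    by (rule finite_nonzero_values_imp_summable_on)
  with assms show ?thesis by (auto simp: carr_ell2 unit_vec_def)
qed

lemma hnorm_ell2: "hnorm (ell2 V) f = sqrt (\<Sum>\<^sub>\<infinity>v\<in>V. (cmod (f v))\<^sup>2)"
proof -
  have "(\<Sum>\<^sub>\<infinity>v\<in>V. f v * cnj (f v)) = (\<Sum>\<^sub>\<infinity>v\<in>V. complex_of_real ((cmod (f v))\<^sup>2))"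
    by (simp only: complex_norm_square)
  also have "\<dots> = complex_of_real (\<Sum>\<^sub>\<infinity>v\<in>V. (cmod (f v))\<^sup>2)"
  proof (rule infsum_bounded_linear_strong[OF _ bounded_linear_of_real], rule iffI)
    assume "(\<lambda>v. complex_of_real ((cmod (f v))\<^sup>2)) summable_on V"
    from summable_on_Re[OF this] show "(\<lambda>v. (cmod (f v))\<^sup>2) summable_on V" by simp
  qed (rule summable_on_of_real)
  finally show ?thesis by (simp add: hnorm_def ell2_def)
qed

lemma hnorm_ell2_sq: "(hnorm (ell2 V) f)\<^sup>2 = (\<Sum>\<^sub>\<infinity>v\<in>V. (cmod (f v))\<^sup>2)"
  by (simp add: hnorm_ell2 infsum_nonneg)

lemma hnorm_ell2_scale_sq: "(hnorm (ell2 V) (\<lambda>v. c * f v))\<^sup>2 = (cmod c)\<^sup>2 * (hnorm (ell2 V) f)\<^sup>2"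
  by (simp add: hnorm_ell2_sq norm_mult power_mult_distrib infsum_cmult_right')

lemma hnorm_unit_vec:
  assumes "u \<in> V"
  shows "(hnorm (ell2 V) (unit_vec u))\<^sup>2 = 1"
proof -
  have "(\<Sum>\<^sub>\<infinity>v\<in>V. (cmod (unit_vec u v))\<^sup>2) = (\<Sum>\<^sub>\<infinity>v\<in>{u}. 1)"
    using assms by (intro infsum_cong_neutral) (auto simp: unit_vec_def)
  then show ?thesis by (simp add: hnorm_ell2_sq)
qed

lemma sq_norm_Lambda_power_branching_vertex:
  "(hnorm (ell2 (tree_V \<eta> \<kappa>)) ((Lambda_map \<eta> \<kappa> lam ^^ Suc n) (unit_vec (Trunk 0))))\<^sup>2 =
     (\<Sum>\<^sub>\<infinity>i\<in>J_set \<eta>. (cmod (\<Prod>j=1..Suc n. lam (Branch i j)))\<^sup>2)"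
proof -
  let ?f = "(Lambda_map \<eta> \<kappa> lam ^^ Suc n) (unit_vec (Trunk 0))"
  have "(\<Sum>\<^sub>\<infinity>v\<in>tree_V \<eta> \<kappa>. (cmod (?f v))\<^sup>2) =
      (\<Sum>\<^sub>\<infinity>v\<in>(\<lambda>i. Branch i (Suc n)) ` J_set \<eta>. (cmod (?f v))\<^sup>2)"
    unfolding Lambda_power_branching_vertex
    by (rule infsum_cong_neutral) (auto simp: Branch_in_tree_V split: vertex.splits)
  also have "\<dots> = (\<Sum>\<^sub>\<infinity>i\<in>J_set \<eta>. (cmod (?f (Branch i (Suc n))))\<^sup>2)"
    by (subst infsum_reindex) (auto simp: inj_on_def o_def)
  also have "\<dots> = (\<Sum>\<^sub>\<infinity>i\<in>J_set \<eta>. (cmod (\<Prod>j=1..Suc n. lam (Branch i j)))\<^sup>2)"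
    unfolding Lambda_power_branching_vertex by (rule infsum_cong) simp
  finally show ?thesis by (simp only: hnorm_ell2_sq)
qed

lemma summable_branch_weights:
  assumes "(Lambda_map \<eta> \<kappa> lam ^^ Suc n) (unit_vec (Trunk 0)) \<in> carr (ell2 (tree_V \<eta> \<kappa>))"
  shows "(\<lambda>i. (cmod (\<Prod>j=1..Suc n. lam (Branch i j)))\<^sup>2) summable_on J_set \<eta>"
proof -
  let ?f = "(Lambda_map \<eta> \<kappa> lam ^^ Suc n) (unit_vec (Trunk 0))"
  have "(\<lambda>v. (cmod (?f v))\<^sup>2) summable_on (\<lambda>i. Branch i (Suc n)) ` J_set \<eta>"
    using assms by (auto simp: carr_ell2 Branch_in_tree_V elim!: summable_on_subset_banach)
  then have "(\<lambda>i. (cmod (?f (Branch i (Suc n))))\<^sup>2) summable_on J_set \<eta>"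
    by (subst (asm) summable_on_reindex) (auto simp: inj_on_def o_def)
  moreover have "(\<lambda>i. (cmod (?f (Branch i (Suc n))))\<^sup>2) summable_on J_set \<eta> \<longleftrightarrow> ?thesis"
    unfolding Lambda_power_branching_vertex by (rule summable_on_cong) simp
  ultimately show ?thesis by blast
qed

lemma weighted_shift_power_eq:
  "(f, g) \<in> weighted_shift \<eta> \<kappa> lam ^^ n \<Longrightarrow> g = (Lambda_map \<eta> \<kappa> lam ^^ n) f"
  by (induction n arbitrary: g) (auto simp: weighted_shift_def)

lemma weighted_shift_powerI:
  assumes "\<And>m. (Lambda_map \<eta> \<kappa> lam ^^ m) f \<in> carr (ell2 (tree_V \<eta> \<kappa>))"
  shows "(f, (Lambda_map \<eta> \<kappa> lam ^^ n) f) \<in> weighted_shift \<eta> \<kappa> lam ^^ n"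
proof (induction n)
  case (Suc n)
  have "((Lambda_map \<eta> \<kappa> lam ^^ n) f, (Lambda_map \<eta> \<kappa> lam ^^ Suc n) f) \<in> weighted_shift \<eta> \<kappa> lam"
    using assms[of n] assms[of "Suc n"] by (simp add: weighted_shift_def)
  then show ?case using Suc.IH by auto
qed simp

lemma D_infinity_carr:
  assumes "f \<in> D_infinity (ell2 (tree_V \<eta> \<kappa>)) (weighted_shift \<eta> \<kappa> lam)"
  shows "(Lambda_map \<eta> \<kappa> lam ^^ n) f \<in> carr (ell2 (tree_V \<eta> \<kappa>))"
proof (cases n)
  case (Suc m)
  obtain g where g: "(f, g) \<in> weighted_shift \<eta> \<kappa> lam ^^ n" using assms unfolding D_infinity_def by blast
  then have "g \<in> carr (ell2 (tree_V \<eta> \<kappa>))" unfolding Suc by (auto simp: weighted_shift_def)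
  then show ?thesis using weighted_shift_power_eq[OF g] by simp
qed (use assms in \<open>simp add: D_infinity_def\<close>)

text \<open>The moment sequence of a basis vector; it is normalized because the vector is a unit vector.\<close>

lemma subnormal_weighted_shift_moments:
  assumes sub: "subnormal TYPE('k::ab_group_add) (ell2 (tree_V \<eta> \<kappa>)) (weighted_shift \<eta> \<kappa> lam)"
    and carr: "\<And>m. (Lambda_map \<eta> \<kappa> lam ^^ m) (unit_vec u) \<in> carr (ell2 (tree_V \<eta> \<kappa>))"
    and u: "u \<in> tree_V \<eta> \<kappa>"
  shows "\<exists>M. prob_space M \<and> represents M
    (\<lambda>n. (hnorm (ell2 (tree_V \<eta> \<kappa>)) ((Lambda_map \<eta> \<kappa> lam ^^ n) (unit_vec u)))\<^sup>2)"
proof (rule stieltjes_moment_existence)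
  have "unit_vec u \<in> carr (ell2 (tree_V \<eta> \<kappa>))" by (rule unit_vec_carr[OF u])
  then show "stieltjes_positive
      (\<lambda>n. (hnorm (ell2 (tree_V \<eta> \<kappa>)) ((Lambda_map \<eta> \<kappa> lam ^^ n) (unit_vec u)))\<^sup>2)"
    by (rule subnormal_stieltjes_positive[OF sub]) (rule weighted_shift_powerI[OF carr])
qed (simp add: hnorm_unit_vec[OF u])

section \<open>Mixtures and densities of representing measures\<close>

lemma nn_integral_count_space_infsum:
  fixes f :: "nat \<Rightarrow> ennreal"
  shows "(\<integral>\<^sup>+i. f i \<partial>count_space J) = (\<Sum>\<^sub>\<infinity>i\<in>J. f i)"
proof -
  define g where "g i = f i * indicator J i" for i
  have "(\<integral>\<^sup>+i. f i \<partial>count_space J) = (\<integral>\<^sup>+i. g i \<partial>count_space UNIV)"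
    unfolding g_def by (rule nn_integral_count_space_indicator) simp
  also have "\<dots> = (\<Sum>i. g i)" by (rule nn_integral_count_space_nat)
  also have "\<dots> = infsum g UNIV"
    by (rule sums_unique[symmetric], rule has_sum_imp_sums, rule has_sum_infsum,
        rule nonneg_summable_on_complete) simp
  also have "\<dots> = infsum f J"
    by (rule infsum_cong_neutral) (auto simp: g_def)
  finally show ?thesis .
qed

lemma ennreal_infsum:
  fixes f :: "'a \<Rightarrow> real"
  assumes "f summable_on A" "\<And>x. x \<in> A \<Longrightarrow> 0 \<le> f x"
  shows "(\<Sum>\<^sub>\<infinity>x\<in>A. ennreal (f x)) = ennreal (infsum f A)"
proof -
  have "sum (ennreal \<circ> f) F = ennreal (sum f F)" if "finite F" "F \<subseteq> A" for F
    using that assms(2) by (auto simp: sum_ennreal subset_iff)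
  then have "ennreal (infsum f A) = infsum (ennreal \<circ> f) A"
    by (simp add: infsum_comm_additive_general assms(1))
  then show ?thesis by (simp add: o_def)
qed

text \<open>The measure \<open>\<Sum>\<^sub>i\<^sub>\<in>\<^sub>J c\<^sub>i \<mu>\<^sub>i\<close> as a monadic composition, so that a possibly infinite sum of measures needs
no separate construction.\<close>

definition weighted_mixture :: "nat set \<Rightarrow> (nat \<Rightarrow> real) \<Rightarrow> (nat \<Rightarrow> real measure) \<Rightarrow> real measure" where
  "weighted_mixture J c \<mu> = density (count_space J) (\<lambda>i. ennreal (c i)) \<bind> \<mu>"

context
  fixes J :: "nat set" and c :: "nat \<Rightarrow> real" and \<mu> :: "nat \<Rightarrow> real measure"
  assumes J: "J \<noteq> {}" and \<mu>: "\<And>i. i \<in> J \<Longrightarrow> borel_prob_Rplus (\<mu> i)"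
begin

lemma mixture_kernel: "\<mu> \<in> density (count_space J) (\<lambda>i. ennreal (c i)) \<rightarrow>\<^sub>M subprob_algebra Rplus_borel"
  using \<mu> by (auto simp: space_subprob_algebra borel_prob_Rplus_def intro: prob_space_imp_subprob_space)

lemma sets_weighted_mixture: "sets (weighted_mixture J c \<mu>) = sets Rplus_borel"
  unfolding weighted_mixture_def
  by (rule sets_bind) (use J \<mu> in \<open>auto simp: borel_prob_Rplus_def\<close>)

lemma nn_integral_weighted_mixture:
  assumes f: "f \<in> borel_measurable Rplus_borel"
  shows "(\<integral>\<^sup>+s. f s \<partial>weighted_mixture J c \<mu>) = (\<Sum>\<^sub>\<infinity>i\<in>J. ennreal (c i) * (\<integral>\<^sup>+s. f s \<partial>\<mu> i))"
  unfolding weighted_mixture_def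
  by (simp add: nn_integral_bind[OF f mixture_kernel] nn_integral_density nn_integral_count_space_infsum)

lemma represents_weighted_mixture:
  assumes c: "\<And>i. i \<in> J \<Longrightarrow> 0 \<le> c i"
    and mom: "\<And>i n. i \<in> J \<Longrightarrow> has_bochner_integral (\<mu> i) (\<lambda>s. s ^ n) (p i n)"
    and sum: "\<And>n. (\<lambda>i. c i * p i n) summable_on J"
  shows "represents (weighted_mixture J c \<mu>) (\<lambda>n. \<Sum>\<^sub>\<infinity>i\<in>J. c i * p i n)"
  unfolding represents_def
proof (intro conjI allI sets_weighted_mixture)
  fix n
  have sets: "sets (\<mu> i) = sets Rplus_borel" if "i \<in> J" for i
    using \<mu>[OF that] by (simp add: borel_prob_Rplus_def)
  have p: "0 \<le> p i n" if "i \<in> J" for i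
  proof -
    have "0 \<le> (\<integral>s. s ^ n \<partial>\<mu> i)"
      by (rule Bochner_Integration.integral_nonneg) (simp add: space_Rplus[OF sets[OF that]])
    then show ?thesis using mom[OF that, of n] by (simp add: has_bochner_integral_iff)
  qed
  show "has_bochner_integral (weighted_mixture J c \<mu>) (\<lambda>s. s ^ n) (\<Sum>\<^sub>\<infinity>i\<in>J. c i * p i n)"
  proof (rule has_bochner_integral_nn_integral)
    show "(\<lambda>s. s ^ n) \<in> borel_measurable (weighted_mixture J c \<mu>)"
      by (rule borel_measurable_Rplus[OF sets_weighted_mixture]) simp
    show "AE s in weighted_mixture J c \<mu>. 0 \<le> s ^ n"
      by (rule AE_I2) (simp add: space_Rplus[OF sets_weighted_mixture])
    show "0 \<le> (\<Sum>\<^sub>\<infinity>i\<in>J. c i * p i n)" using c p by (intro infsum_nonneg mult_nonneg_nonneg)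
    have "(\<integral>\<^sup>+s. ennreal (s ^ n) \<partial>weighted_mixture J c \<mu>) =
        (\<Sum>\<^sub>\<infinity>i\<in>J. ennreal (c i) * (\<integral>\<^sup>+s. ennreal (s ^ n) \<partial>\<mu> i))"
      by (rule nn_integral_weighted_mixture) (rule borel_measurable_Rplus; simp)
    also have "\<dots> = (\<Sum>\<^sub>\<infinity>i\<in>J. ennreal (c i * p i n))"
    proof (rule infsum_cong)
      fix i assume i: "i \<in> J"
      have "(\<integral>\<^sup>+s. ennreal (s ^ n) \<partial>\<mu> i) = ennreal (\<integral>s. s ^ n \<partial>\<mu> i)"
        using mom[OF i, of n]
        by (intro nn_integral_eq_integral AE_I2)
          (auto simp: space_Rplus[OF sets[OF i]] has_bochner_integral_iff)
      also have "(\<integral>s. s ^ n \<partial>\<mu> i) = p i n" using mom[OF i, of n] by (simp add: has_bochner_integral_iff)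
      finally show "ennreal (c i) * (\<integral>\<^sup>+s. ennreal (s ^ n) \<partial>\<mu> i) = ennreal (c i * p i n)"
        using c[OF i] p[OF i] by (simp add: ennreal_mult)
    qed
    also have "\<dots> = ennreal (\<Sum>\<^sub>\<infinity>i\<in>J. c i * p i n)"
      using c p by (intro ennreal_infsum sum) auto
    finally show "(\<integral>\<^sup>+s. ennreal (s ^ n) \<partial>weighted_mixture J c \<mu>) = ennreal (\<Sum>\<^sub>\<infinity>i\<in>J. c i * p i n)" .
  qed
qed

end

text \<open>Multiplication by \<open>x\<^sup>k\<close> shifts moments by \<open>k\<close>.\<close>

lemma represents_power_density:
  assumes rep: "represents \<nu> r" and C: "0 < C" and r: "\<And>n. r (n + k) = C * s n"
  shows "represents (density \<nu> (\<lambda>x. ennreal (x ^ k / C))) s"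
proof -
  have sets: "sets \<nu> = sets Rplus_borel" and mom: "\<And>n. has_bochner_integral \<nu> (\<lambda>x. x ^ n) (r n)"
    using rep by (auto simp: represents_def)
  have "has_bochner_integral (density \<nu> (\<lambda>x. ennreal (x ^ k / C))) (\<lambda>x. x ^ n) (s n)" for n
  proof (rule has_bochner_integral_density)
    have "has_bochner_integral \<nu> (\<lambda>x. x ^ (n + k) / C) (r (n + k) / C)"
      by (intro has_bochner_integral_divide_zero mom)
    then show "has_bochner_integral \<nu> (\<lambda>x. (x ^ k / C) *\<^sub>R x ^ n) (s n)"
      using C by (simp add: r power_add mult.commute)
    show "AE x in \<nu>. 0 \<le> x ^ k / C" using C by (intro AE_I2) (simp add: space_Rplus[OF sets])
  qed (rule borel_measurable_Rplus[OF sets]; simp)+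
  then show ?thesis by (simp add: represents_def sets)
qed

text \<open>The case \<open>x = 0\<close> is where the convention \<open>0 * \<infinity> = 0\<close> enters: both sides vanish, since \<open>Suc k - m\<close> is
positive.\<close>

lemma ennreal_power_divide:
  assumes "0 \<le> x" "m \<le> k"
  shows "ennreal (x ^ Suc k) * (1 / ennreal (x ^ m)) = ennreal (x ^ (Suc k - m))"
proof (cases "x = 0")
  case False
  then have x: "0 < x ^ m" using assms by simp
  have "x ^ Suc k = x ^ (Suc k - m) * x ^ m" using assms(2) by (simp flip: power_add)
  moreover have "1 / ennreal (x ^ m) = ennreal (1 / x ^ m)"
    using x by (simp add: divide_ennreal[symmetric])
  ultimately show ?thesis using assms x
    by (simp add: ennreal_mult[symmetric])
qed (use assms in \<open>simp add: Suc_diff_le\<close>)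

lemma ennreal_power_divide_le: "ennreal (x ^ k) * (1 / ennreal (x ^ k)) \<le> 1"
  by (cases "ennreal (x ^ k) = 0") (auto simp: ennreal_times_divide ennreal_divide_self less_top[symmetric])

text \<open>The mixture \<open>A\<close> of the branch measures and the density \<open>x\<^sup>k / C\<close> with respect
to \<open>\<nu>\<close> both represent \<open>s\<close>, so they are equal; then integrate \<open>x\<^sup>-\<^sup>m\<close> over \<open>\<sigma>\<close>.\<close>

lemma negative_moment_identity:
  assumes mixture: "\<And>f. f \<in> borel_measurable Rplus_borel \<Longrightarrow>
      (\<integral>\<^sup>+x. f x \<partial>A) = (\<Sum>\<^sub>\<infinity>i\<in>J_set \<eta>. ennreal ((cmod (lam (Branch i 1)))\<^sup>2) * (\<integral>\<^sup>+x. f x \<partial>\<mu> i))"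
    and A: "represents A s" and det: "determinate_stieltjes s"
    and rep: "represents \<nu> r" and C: "0 < C" and r: "\<And>n. r (n + k) = C * s n"
    and \<sigma>: "\<sigma> \<in> sets Rplus_borel"
  shows "ennreal C * neg_moment_sum \<eta> lam \<mu> m \<sigma> =
    (\<integral>\<^sup>+x\<in>\<sigma>. (ennreal (x ^ k) * (1 / ennreal (x ^ m))) \<partial>\<nu>)"
proof -
  have sets: "sets \<nu> = sets Rplus_borel" using rep by (simp add: represents_def)
  have A_eq: "A = density \<nu> (\<lambda>x. ennreal (x ^ k / C))"
    using det A represents_power_density[OF rep C r] unfolding determinate_stieltjes_def by blast
  define h where "h = (\<lambda>x. 1 / ennreal (x ^ m) * indicator \<sigma> x)"
  have ind [measurable]: "indicator \<sigma> \<in> borel_measurable Rplus_borel" "indicator \<sigma> \<in> borel_measurable \<nu>"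
    using \<sigma> sets by auto
  have inv [measurable]: "(\<lambda>x. 1 / ennreal (x ^ m)) \<in> borel_measurable Rplus_borel"
    "(\<lambda>x. 1 / ennreal (x ^ m)) \<in> borel_measurable \<nu>"
    by (rule borel_measurable_Rplus; simp add: sets)+
  have pow [measurable]: "(\<lambda>x. ennreal (x ^ k / C)) \<in> borel_measurable \<nu>"
    by (rule borel_measurable_Rplus; simp add: sets)
  have h [measurable]: "h \<in> borel_measurable Rplus_borel" "h \<in> borel_measurable \<nu>"
    unfolding h_def by measurable
  have "neg_moment_sum \<eta> lam \<mu> m \<sigma> = (\<integral>\<^sup>+x. h x \<partial>A)"
    unfolding neg_moment_sum_def mixture[OF h(1)] unfolding h_def ..
  also have "\<dots> = (\<integral>\<^sup>+x. ennreal (x ^ k / C) * h x \<partial>\<nu>)"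
    unfolding A_eq by (rule nn_integral_density) measurable
  finally have "ennreal C * neg_moment_sum \<eta> lam \<mu> m \<sigma> = (\<integral>\<^sup>+x. ennreal C * (ennreal (x ^ k / C) * h x) \<partial>\<nu>)"
    by (simp add: nn_integral_cmult)
  also have "\<dots> = (\<integral>\<^sup>+x\<in>\<sigma>. (ennreal (x ^ k) * (1 / ennreal (x ^ m))) \<partial>\<nu>)"
  proof (rule nn_integral_cong)
    fix x assume "x \<in> space \<nu>"
    then have x: "0 \<le> x" by (simp add: space_Rplus[OF sets])
    have "ennreal C * ennreal (x ^ k / C) = ennreal (x ^ k)"
      using C x by (simp add: ennreal_mult[symmetric])
    then show "ennreal C * (ennreal (x ^ k / C) * h x) =
        ennreal (x ^ k) * (1 / ennreal (x ^ m)) * indicator \<sigma> x"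
      unfolding h_def by (simp add: mult.assoc[symmetric])
  qed
  finally show ?thesis .
qed

section \<open>Measures attached to a subnormal weighted shift\<close>

theorem theorem6p2p3:
  fixes \<eta> \<kappa> :: enat and lam :: "vertex \<Rightarrow> complex"
  assumes "\<eta> \<ge> 2"
    and "\<forall>v\<in>tree_V_nonroot \<eta> \<kappa>. lam v \<noteq> 0"
    and "subnormal TYPE('k::ab_group_add) (ell2 (tree_V \<eta> \<kappa>)) (weighted_shift \<eta> \<kappa> lam)"
    and "unit_vec (Trunk 0) \<in> D_infinity (ell2 (tree_V \<eta> \<kappa>)) (weighted_shift \<eta> \<kappa> lam)"
  shows
    "(cond_D \<eta> lam \<longrightarrow>
       (\<kappa> = 0 \<longrightarrow>
          (\<exists>\<mu>. (\<forall>i\<in>J_set \<eta>. borel_prob_Rplus (\<mu> i)) \<and> cond_1 \<eta> lam \<mu> \<and>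
               neg_moment_sum \<eta> lam \<mu> 1 {0..} \<le> 1)) \<and>
       (\<forall>k::nat. \<kappa> = enat k \<and> 0 < k \<longrightarrow>
          (\<exists>\<mu>. (\<forall>i\<in>J_set \<eta>. borel_prob_Rplus (\<mu> i)) \<and>
               cond_1 \<eta> lam \<mu> \<and> cond_2 \<eta> lam \<mu> \<and> cond_3 \<eta> \<kappa> lam \<mu> \<and>
               ennreal ((cmod (\<Prod>j<k. lam (Trunk j)))\<^sup>2) * neg_moment_sum \<eta> lam \<mu> (k + 1) {0..} \<le> 1)) \<and>
       (\<forall>k::nat. \<kappa> = enat k \<and> 0 < k \<longrightarrow>
          (\<exists>\<mu> \<nu>. (\<forall>i\<in>J_set \<eta>. borel_prob_Rplus (\<mu> i)) \<and> borel_prob_Rplus \<nu> \<and>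
               cond_1 \<eta> lam \<mu> \<and>
               (\<forall>n\<in>J_set \<kappa>. has_bochner_integral \<nu> (\<lambda>s. s ^ n)
                               ((cmod (\<Prod>j=k-n..k-1. lam (Trunk j)))\<^sup>2)) \<and>
               (\<forall>\<sigma>\<in>sets Rplus_borel.
                  (\<integral>\<^sup>+s\<in>\<sigma>. ennreal (s ^ k) \<partial>\<nu>) =
                  ennreal ((cmod (\<Prod>j<k. lam (Trunk j)))\<^sup>2) * neg_moment_sum \<eta> lam \<mu> 1 \<sigma>))) \<and>
       (\<kappa> = \<infinity> \<longrightarrow>
          (\<exists>\<mu>. (\<forall>i\<in>J_set \<eta>. borel_prob_Rplus (\<mu> i)) \<and>
               cond_1 \<eta> lam \<mu> \<and> cond_2 \<eta> lam \<mu> \<and> cond_3 \<eta> \<kappa> lam \<mu>))) \<and>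
     (unit_vec (Trunk 0) \<in> quasi_analytic (ell2 (tree_V \<eta> \<kappa>)) (weighted_shift \<eta> \<kappa> lam) \<longleftrightarrow>
       (\<Sum>n. inverse (ennreal (root (2 * Suc n)
          (\<Sum>\<^sub>\<infinity>i\<in>J_set \<eta>. (cmod (\<Prod>j=1..Suc n. lam (Branch i j)))\<^sup>2)))) = \<infinity>) \<and>
     (unit_vec (Trunk 0) \<in> quasi_analytic (ell2 (tree_V \<eta> \<kappa>)) (weighted_shift \<eta> \<kappa> lam) \<longrightarrow>
       cond_D \<eta> lam)"
proof -
  define V where "V = tree_V \<eta> \<kappa>"
  define Lm where "Lm = Lambda_map \<eta> \<kappa> lam"
  define s where "s n = (\<Sum>\<^sub>\<infinity>i\<in>J_set \<eta>. (cmod (\<Prod>j=1..Suc n. lam (Branch i j)))\<^sup>2)" for n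
  define C where "C k = (cmod (\<Prod>j<k. lam (Trunk j)))\<^sup>2" for k
  define \<tau> where "\<tau> u n = (hnorm (ell2 V) ((Lm ^^ n) (unit_vec u)))\<^sup>2" for u n
  have J1: "1 \<in> J_set \<eta>"
    using assms(1) by (cases \<eta>) (auto simp: J_set_def numeral_eq_enat one_enat_def)
  have e0: "(Lm ^^ n) (unit_vec (Trunk 0)) \<in> carr (ell2 V)" for n
    unfolding Lm_def V_def by (rule D_infinity_carr[OF assms(4)])
  have lam_Branch: "lam (Branch i j) \<noteq> 0" if "i \<in> J_set \<eta>" "1 \<le> j" for i j
    using assms(2) that by (simp add: Branch_in_nonroot)
  have lam_Trunk: "lam (Trunk j) \<noteq> 0" if "enat (Suc j) \<le> \<kappa>" for j
    using assms(2) that by (simp add: Trunk_in_nonroot)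
  have tau_0: "\<tau> (Trunk 0) (Suc n) = s n" for n
    unfolding \<tau>_def s_def Lm_def V_def by (rule sq_norm_Lambda_power_branching_vertex)
  have summ: "(\<lambda>i. (cmod (\<Prod>j=1..Suc n. lam (Branch i j)))\<^sup>2) summable_on J_set \<eta>" for n
    by (rule summable_branch_weights[where \<eta> = \<eta> and \<kappa> = \<kappa>]) (rule e0[unfolded Lm_def V_def])
  have s_pos: "0 < s n" for n
  proof -
    define f where "f i = (cmod (\<Prod>j=1..Suc n. lam (Branch i j)))\<^sup>2" for i
    have "sum f {1} \<le> infsum f (J_set \<eta>)"
      unfolding f_def using J1 by (intro finite_sum_le_infsum summ) auto
    moreover have "infsum f (J_set \<eta>) = s n" unfolding f_def s_def ..
    moreover have "(\<Prod>j=1..Suc n. lam (Branch 1 j)) \<noteq> 0"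
      using lam_Branch[OF J1] by (simp only: prod_zero_iff finite_atLeastAtMost) auto
    then have "0 < f 1" unfolding f_def by (intro zero_less_power) (simp only: zero_less_norm_iff not_False_eq_True)
    ultimately show ?thesis by simp
  qed
  have trunk_in: "Trunk k \<in> V" if "enat k \<le> \<kappa>" for k using that by (simp add: V_def Trunk_in_tree_V)
  have tau_Trunk_le: "\<tau> (Trunk k) n = (cmod (\<Prod>j\<in>{k-n..<k}. lam (Trunk j)))\<^sup>2"
    if "enat k \<le> \<kappa>" "n \<le> k" for k n
  proof -
    have "enat (k - n) \<le> \<kappa>" by (rule order_trans[OF _ that(1)]) simp
    then show ?thesis
      unfolding \<tau>_def Lm_def Lambda_power_Trunk_le[OF that] hnorm_ell2_scale_sq
      by (simp add: hnorm_unit_vec trunk_in)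
  qed
  \<comment> \<open>From step \<open>k + 1\<close> on, the iterates of the vector at \<open>-k\<close> live on the
    branches.\<close>
  have tau_Trunk_ge: "\<tau> (Trunk k) (n + Suc k) = C k * s n" if "enat k \<le> \<kappa>" for k n
  proof -
    have "\<tau> (Trunk k) (Suc n + k) = C k * \<tau> (Trunk 0) (Suc n)"
      unfolding \<tau>_def Lm_def Lambda_power_Trunk_ge[OF that] hnorm_ell2_scale_sq C_def ..
    then show ?thesis by (simp add: tau_0)
  qed
  have Trunk_carr: "(Lm ^^ n) (unit_vec (Trunk k)) \<in> carr (ell2 V)" if k: "enat k \<le> \<kappa>" for k n
  proof (cases "n \<le> k")
    case True
    have "enat (k - n) \<le> \<kappa>" by (rule order_trans[OF _ k]) simp
    then show ?thesis unfolding Lm_def Lambda_power_Trunk_le[OF k True]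
      by (intro carr_ell2_scale unit_vec_carr trunk_in)
  next
    case False
    then have n: "n = (n - k) + k" by simp
    show ?thesis unfolding Lm_def by (subst n, subst Lambda_power_Trunk_ge[OF k])
        (intro carr_ell2_scale e0[unfolded Lm_def])
  qed
  have nu_ex: "\<exists>M. prob_space M \<and> represents M (\<tau> (Trunk k))" if "enat k \<le> \<kappa>" for k
    using subnormal_weighted_shift_moments[OF assms(3), of "Trunk k"] Trunk_carr[OF that] trunk_in[OF that]
    unfolding \<tau>_def Lm_def V_def by blast
  have C_pos: "0 < C k" if "enat k \<le> \<kappa>" for k
  proof -
    have "lam (Trunk j) \<noteq> 0" if "j < k" for j
      using that by (intro lam_Trunk order_trans[OF _ \<open>enat k \<le> \<kappa>\<close>]) simp
    then show ?thesis by (simp add: C_def)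
  qed

  have quasi: "unit_vec (Trunk 0) \<in> quasi_analytic (ell2 V) (weighted_shift \<eta> \<kappa> lam) \<longleftrightarrow>
      (\<Sum>n. inverse (ennreal (root (2 * Suc n) (s n)))) = \<infinity>"
  proof -
    have "root (Suc n) (hnorm (ell2 V) (op_apply (weighted_shift \<eta> \<kappa> lam ^^ Suc n) (unit_vec (Trunk 0)))) =
        root (2 * Suc n) (s n)" for n
    proof -
      have "op_apply (weighted_shift \<eta> \<kappa> lam ^^ Suc n) (unit_vec (Trunk 0)) =
          (Lm ^^ Suc n) (unit_vec (Trunk 0))"
        unfolding op_apply_def Lm_def
      proof (rule the_equality)
        show "(unit_vec (Trunk 0), (Lambda_map \<eta> \<kappa> lam ^^ Suc n) (unit_vec (Trunk 0)))
            \<in> weighted_shift \<eta> \<kappa> lam ^^ Suc n"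
          by (rule weighted_shift_powerI) (rule e0[unfolded Lm_def V_def])
      qed (rule weighted_shift_power_eq)
      moreover have "hnorm (ell2 V) ((Lm ^^ Suc n) (unit_vec (Trunk 0))) = sqrt (s n)"
        using tau_0[of n] unfolding \<tau>_def
        by (intro real_sqrt_unique[symmetric]) (auto simp: hnorm_ell2 infsum_nonneg less_imp_le[OF s_pos])
      moreover have "root (Suc n) (sqrt (s n)) = root (2 * Suc n) (s n)"
        unfolding sqrt_def real_root_mult_exp[symmetric] by (simp only: mult.commute)
      ultimately show ?thesis by simp
    qed
    then show ?thesis using assms(4) unfolding quasi_analytic_def V_def by simp
  qed

  have carleman: "cond_D \<eta> lam"
    if "unit_vec (Trunk 0) \<in> quasi_analytic (ell2 V) (weighted_shift \<eta> \<kappa> lam)"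
  proof -
    obtain M where M: "represents M (\<tau> (Trunk 0))" using nu_ex[of 0] by (auto simp: zero_enat_def[symmetric])
    have t0: "\<tau> (Trunk 0) 0 = 1"
      unfolding \<tau>_def using trunk_in[of 0] by (simp add: hnorm_unit_vec zero_enat_def[symmetric])
    have pos: "0 < \<tau> (Trunk 0) n" for n by (cases n) (simp_all add: t0 tau_0 s_pos)
    have "(\<Sum>n. inverse (ennreal (root (2 * Suc n) (\<tau> (Trunk 0) (Suc n))))) = \<infinity>"
      using that unfolding quasi tau_0 .
    from carleman_determinate_shift[OF M pos t0 this]
    have "determinate_stieltjes s" by (simp add: tau_0)
    then show ?thesis unfolding cond_D_def using summ by (simp add: s_def[abs_def])
  qed

  have branch_ex: "\<exists>M. prob_space M \<and> represents M (\<lambda>n. (cmod (\<Prod>j=2..n+1. lam (Branch i j)))\<^sup>2)"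
    if i: "i \<in> J_set \<eta>" for i
  proof -
    have in_V: "Branch i (Suc n) \<in> V" for n using i by (simp add: V_def Branch_in_tree_V)
    have carr: "(Lm ^^ n) (unit_vec (Branch i 1)) \<in> carr (ell2 V)" for n
      unfolding Lm_def Lambda_power_branch_root[OF i] by (intro carr_ell2_scale unit_vec_carr in_V)
    have "\<tau> (Branch i 1) n = (cmod (\<Prod>j=2..n+1. lam (Branch i j)))\<^sup>2" for n
      unfolding \<tau>_def Lm_def Lambda_power_branch_root[OF i] hnorm_ell2_scale_sq
      by (simp add: hnorm_unit_vec in_V)
    then have "\<tau> (Branch i 1) = (\<lambda>n. (cmod (\<Prod>j=2..n+1. lam (Branch i j)))\<^sup>2)" by blast
    then show ?thesis
      using subnormal_weighted_shift_moments[OF assms(3), of "Branch i 1"] carr in_V[of 0]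
      unfolding \<tau>_def Lm_def V_def by simp
  qed
  then obtain \<mu> where \<mu>: "\<And>i. i \<in> J_set \<eta> \<Longrightarrow> prob_space (\<mu> i)"
    "\<And>i. i \<in> J_set \<eta> \<Longrightarrow> represents (\<mu> i) (\<lambda>n. (cmod (\<Prod>j=2..n+1. lam (Branch i j)))\<^sup>2)"
    by metis
  have prob: "borel_prob_Rplus (\<mu> i)" if "i \<in> J_set \<eta>" for i
    using \<mu>[OF that] by (simp add: borel_prob_Rplus_def represents_def)
  have mom: "has_bochner_integral (\<mu> i) (\<lambda>s. s ^ n) ((cmod (\<Prod>j=2..n+1. lam (Branch i j)))\<^sup>2)"
    if "i \<in> J_set \<eta>" for i n
    using \<mu>(2)[OF that] by (simp add: represents_def)
  have cond1: "cond_1 \<eta> lam \<mu>" unfolding cond_1_def using mom by blast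

  define c where "c i = (cmod (lam (Branch i 1)))\<^sup>2" for i
  \<comment> \<open>This mixture represents the sequence in \<open>cond_D\<close>: the \<open>n\<close>-th moment of
    \<open>c i \<mu>\<^sub>i\<close> is the squared modulus of the product of the first \<open>n + 1\<close> weights on branch
    \<open>i\<close>.\<close>
  define A where "A = weighted_mixture (J_set \<eta>) c \<mu>"
  have J0: "J_set \<eta> \<noteq> {}" using J1 by blast
  have split: "c i * (cmod (\<Prod>j=2..n+1. lam (Branch i j)))\<^sup>2 = (cmod (\<Prod>j=1..Suc n. lam (Branch i j)))\<^sup>2"
    for i n
  proof -
    have "(\<Prod>j=1..Suc n. lam (Branch i j)) = lam (Branch i 1) * (\<Prod>j=2..n+1. lam (Branch i j))"
      by (simp add: prod.atLeast_Suc_atMost numeral_2_eq_2 del: prod.cl_ivl_Suc)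
    then show ?thesis by (simp only: c_def norm_mult power_mult_distrib)
  qed
  have A_rep: "represents A s"
  proof -
    have "represents A (\<lambda>n. \<Sum>\<^sub>\<infinity>i\<in>J_set \<eta>. c i * (cmod (\<Prod>j=2..n+1. lam (Branch i j)))\<^sup>2)"
      unfolding A_def
    proof (rule represents_weighted_mixture[OF J0 prob _ mom])
      show "(\<lambda>i. c i * (cmod (\<Prod>j=2..n+1. lam (Branch i j)))\<^sup>2) summable_on J_set \<eta>" for n
        unfolding split by (rule summ)
    qed (simp_all add: c_def)
    then show ?thesis unfolding split s_def[symmetric] by simp
  qed
  have mixture: "(\<integral>\<^sup>+x. f x \<partial>A) =
      (\<Sum>\<^sub>\<infinity>i\<in>J_set \<eta>. ennreal ((cmod (lam (Branch i 1)))\<^sup>2) * (\<integral>\<^sup>+x. f x \<partial>\<mu> i))"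
    if "f \<in> borel_measurable Rplus_borel" for f
    unfolding A_def using nn_integral_weighted_mixture[OF J0 prob that, where c = c] by (simp add: c_def)

  have main: "(\<kappa> = 0 \<longrightarrow> neg_moment_sum \<eta> lam \<mu> 1 {0..} \<le> 1) \<and>
      (\<forall>k. \<kappa> = enat k \<and> 0 < k \<longrightarrow> ennreal (C k) * neg_moment_sum \<eta> lam \<mu> (k + 1) {0..} \<le> 1) \<and>
      (\<forall>l. enat (Suc l) \<le> \<kappa> \<longrightarrow> ennreal (C l) * neg_moment_sum \<eta> lam \<mu> (l + 1) {0..} = 1) \<and>
      (\<forall>k. \<kappa> = enat k \<and> 0 < k \<longrightarrow> (\<exists>\<nu>. borel_prob_Rplus \<nu> \<and>
         (\<forall>n\<in>J_set \<kappa>. has_bochner_integral \<nu> (\<lambda>s. s ^ n) ((cmod (\<Prod>j=k-n..k-1. lam (Trunk j)))\<^sup>2)) \<and>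
         (\<forall>\<sigma>\<in>sets Rplus_borel. (\<integral>\<^sup>+s\<in>\<sigma>. ennreal (s ^ k) \<partial>\<nu>) =
            ennreal (C k) * neg_moment_sum \<eta> lam \<mu> 1 \<sigma>)))"
    if D: "cond_D \<eta> lam"
  proof -
    have det: "determinate_stieltjes s" using D by (simp add: cond_D_def s_def[abs_def])
    have all: "{0..} \<in> sets Rplus_borel" unfolding Rplus_borel_def by (simp add: sets_restrict_space_iff)
    have neg: "ennreal (C k) * neg_moment_sum \<eta> lam \<mu> m \<sigma> =
        (\<integral>\<^sup>+x\<in>\<sigma>. (ennreal (x ^ Suc k) * (1 / ennreal (x ^ m))) \<partial>\<nu>)"
      if "enat k \<le> \<kappa>" "represents \<nu> (\<tau> (Trunk k))" "\<sigma> \<in> sets Rplus_borel" for k m \<sigma> \<nu>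
      by (rule negative_moment_identity[OF mixture A_rep det that(2) C_pos[OF that(1)]
            tau_Trunk_ge[OF that(1)] that(3)])
    have neg': "ennreal (C k) * neg_moment_sum \<eta> lam \<mu> m \<sigma> = (\<integral>\<^sup>+x\<in>\<sigma>. ennreal (x ^ (Suc k - m)) \<partial>\<nu>)"
      if "enat k \<le> \<kappa>" "represents \<nu> (\<tau> (Trunk k))" "\<sigma> \<in> sets Rplus_borel" "m \<le> k" for k m \<sigma> \<nu>
    proof -
      have sets: "sets \<nu> = sets Rplus_borel" using that(2) by (simp add: represents_def)
      show ?thesis unfolding neg[OF that(1-3)]
        by (rule nn_integral_cong) (simp add: space_Rplus[OF sets] ennreal_power_divide that(4) del: power_Suc)
    qed
    \<comment> \<open>The left side is the mass off the origin of the measure at \<open>-k\<close>.\<close>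
    have le1: "ennreal (C k) * neg_moment_sum \<eta> lam \<mu> (k + 1) {0..} \<le> 1" if k: "enat k \<le> \<kappa>" for k
    proof -
      obtain \<nu> where \<nu>: "prob_space \<nu>" "represents \<nu> (\<tau> (Trunk k))" using nu_ex[OF k] by blast
      have "ennreal (C k) * neg_moment_sum \<eta> lam \<mu> (k + 1) {0..} \<le> (\<integral>\<^sup>+x. 1 \<partial>\<nu>)"
        unfolding neg[OF k \<nu>(2) all]
      proof (rule nn_integral_mono)
        fix x
        show "ennreal (x ^ Suc k) * (1 / ennreal (x ^ (k + 1))) * indicator {0..} x \<le> 1"
          using ennreal_power_divide_le[of x "Suc k"] by (simp add: indicator_def del: power_Suc)
      qed
      then show ?thesis using prob_space.emeasure_space_1[OF \<nu>(1)] by simp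
    qed
    \<comment> \<open>Up to the factor \<open>a\<close>, the left side is the first moment of the measure at
      \<open>-(l + 1)\<close>, and this moment is \<open>a\<close>.\<close>
    have eq1: "ennreal (C l) * neg_moment_sum \<eta> lam \<mu> (l + 1) {0..} = 1" if l: "enat (Suc l) \<le> \<kappa>" for l
    proof -
      obtain \<nu> where \<nu>: "prob_space \<nu>" "represents \<nu> (\<tau> (Trunk (Suc l)))" using nu_ex[OF l] by blast
      have sets: "sets \<nu> = sets Rplus_borel" using \<nu>(2) by (simp add: represents_def)
      define a where "a = (cmod (lam (Trunk l)))\<^sup>2"
      have a: "0 < a" using lam_Trunk[OF l] by (simp add: a_def)
      have "has_bochner_integral \<nu> (\<lambda>x. x ^ 1) (\<tau> (Trunk (Suc l)) 1)"
        using \<nu>(2) unfolding represents_def by blast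
      moreover have "\<tau> (Trunk (Suc l)) 1 = a" using tau_Trunk_le[OF l, of 1] by (simp add: a_def)
      ultimately have "has_bochner_integral \<nu> (\<lambda>x. x) a" by simp
      then have "(\<integral>\<^sup>+x. ennreal x \<partial>\<nu>) = ennreal a"
        by (subst nn_integral_eq_integral) (auto simp: has_bochner_integral_iff space_Rplus[OF sets] intro!: AE_I2)
      moreover have "ennreal (C (Suc l)) * neg_moment_sum \<eta> lam \<mu> (Suc l) {0..} = (\<integral>\<^sup>+x. ennreal x \<partial>\<nu>)"
        unfolding neg'[OF l \<nu>(2) all order_refl]
        by (rule nn_integral_cong) (simp add: space_Rplus[OF sets])
      moreover have "C (Suc l) = a * C l" by (simp add: C_def a_def norm_mult power_mult_distrib)
      ultimately have "ennreal a * (ennreal (C l) * neg_moment_sum \<eta> lam \<mu> (l + 1) {0..}) = ennreal a * 1"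
        using a by (simp add: ennreal_mult' mult.assoc)
      then show ?thesis using a unfolding ennreal_mult_cancel_left by simp
    qed
    have nu: "\<exists>\<nu>. borel_prob_Rplus \<nu> \<and>
         (\<forall>n\<in>J_set \<kappa>. has_bochner_integral \<nu> (\<lambda>s. s ^ n) ((cmod (\<Prod>j=k-n..k-1. lam (Trunk j)))\<^sup>2)) \<and>
         (\<forall>\<sigma>\<in>sets Rplus_borel. (\<integral>\<^sup>+s\<in>\<sigma>. ennreal (s ^ k) \<partial>\<nu>) =
            ennreal (C k) * neg_moment_sum \<eta> lam \<mu> 1 \<sigma>)" if k: "\<kappa> = enat k" "0 < k" for k
    proof -
      have k': "enat k \<le> \<kappa>" using k by simp
      obtain \<nu> where \<nu>: "prob_space \<nu>" "represents \<nu> (\<tau> (Trunk k))" using nu_ex[OF k'] by blast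
      show ?thesis
      proof (intro exI[of _ \<nu>] conjI ballI)
        show "borel_prob_Rplus \<nu>" using \<nu> by (simp add: borel_prob_Rplus_def represents_def)
        fix n assume "n \<in> J_set \<kappa>"
        then have "n \<le> k" by (simp add: J_set_def k)
        moreover have "{k - n..<k} = {k - n..k - 1}" using k by auto
        moreover have "has_bochner_integral \<nu> (\<lambda>x. x ^ n) (\<tau> (Trunk k) n)"
          using \<nu>(2) unfolding represents_def by blast
        ultimately show "has_bochner_integral \<nu> (\<lambda>s. s ^ n) ((cmod (\<Prod>j=k-n..k-1. lam (Trunk j)))\<^sup>2)"
          using tau_Trunk_le[OF k'] by simp
      next
        fix \<sigma> assume "\<sigma> \<in> sets Rplus_borel"
        then show "(\<integral>\<^sup>+s\<in>\<sigma>. ennreal (s ^ k) \<partial>\<nu>) = ennreal (C k) * neg_moment_sum \<eta> lam \<mu> 1 \<sigma>"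
          using neg'[OF k' \<nu>(2), of \<sigma> 1] k by simp
      qed
    qed
    show ?thesis
      using le1 eq1 nu le1[of 0] by (auto simp: C_def zero_enat_def[symmetric])
  qed

  have conds: "cond_2 \<eta> lam \<mu> \<and> cond_3 \<eta> \<kappa> lam \<mu>" if "cond_D \<eta> lam" "0 < \<kappa>"
  proof
    have eq1: "ennreal (C l) * neg_moment_sum \<eta> lam \<mu> (l + 1) {0..} = 1" if "enat (Suc l) \<le> \<kappa>" for l
      using main[OF \<open>cond_D \<eta> lam\<close>] that by blast
    have "enat (Suc 0) \<le> \<kappa>" using \<open>0 < \<kappa>\<close> by (cases \<kappa>) (auto simp: zero_enat_def)
    then show "cond_2 \<eta> lam \<mu>" using eq1[of 0] by (simp add: cond_2_def C_def)
    have "enat (Suc l) \<le> \<kappa>" if "l \<in> J_set (\<kappa> - 1)" for l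
      using that by (cases \<kappa>) (auto simp: J_set_def one_enat_def)
    then show "cond_3 \<eta> \<kappa> lam \<mu>" using eq1 by (simp add: cond_3_def C_def)
  qed
  show ?thesis
  proof (intro conjI impI allI)
    assume D: "cond_D \<eta> lam"
    show "\<exists>\<mu>. (\<forall>i\<in>J_set \<eta>. borel_prob_Rplus (\<mu> i)) \<and> cond_1 \<eta> lam \<mu> \<and>
        neg_moment_sum \<eta> lam \<mu> 1 {0..} \<le> 1" if "\<kappa> = 0"
      using main[OF D] prob cond1 that by blast
    show "\<exists>\<mu>. (\<forall>i\<in>J_set \<eta>. borel_prob_Rplus (\<mu> i)) \<and>
        cond_1 \<eta> lam \<mu> \<and> cond_2 \<eta> lam \<mu> \<and> cond_3 \<eta> \<kappa> lam \<mu>" if "\<kappa> = \<infinity>"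
      using conds[OF D] prob cond1 that by (intro exI[of _ \<mu>]) auto
    fix k assume k: "\<kappa> = enat k \<and> 0 < k"
    then have "0 < \<kappa>" by (simp add: zero_enat_def)
    have last: "ennreal ((cmod (\<Prod>j<k. lam (Trunk j)))\<^sup>2) * neg_moment_sum \<eta> lam \<mu> (k + 1) {0..} \<le> 1"
      using main[OF D] k unfolding C_def by blast
    show "\<exists>\<mu>. (\<forall>i\<in>J_set \<eta>. borel_prob_Rplus (\<mu> i)) \<and>
        cond_1 \<eta> lam \<mu> \<and> cond_2 \<eta> lam \<mu> \<and> cond_3 \<eta> \<kappa> lam \<mu> \<and>
        ennreal ((cmod (\<Prod>j<k. lam (Trunk j)))\<^sup>2) * neg_moment_sum \<eta> lam \<mu> (k + 1) {0..} \<le> 1"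
      using last conds[OF D \<open>0 < \<kappa>\<close>] prob cond1 by blast
    obtain \<nu> where "borel_prob_Rplus \<nu>"
      "\<forall>n\<in>J_set \<kappa>. has_bochner_integral \<nu> (\<lambda>s. s ^ n) ((cmod (\<Prod>j=k-n..k-1. lam (Trunk j)))\<^sup>2)"
      "\<forall>\<sigma>\<in>sets Rplus_borel. (\<integral>\<^sup>+s\<in>\<sigma>. ennreal (s ^ k) \<partial>\<nu>) =
        ennreal ((cmod (\<Prod>j<k. lam (Trunk j)))\<^sup>2) * neg_moment_sum \<eta> lam \<mu> 1 \<sigma>"
      using main[OF D] k unfolding C_def by blast
    with prob cond1 show "\<exists>\<mu> \<nu>. (\<forall>i\<in>J_set \<eta>. borel_prob_Rplus (\<mu> i)) \<and> borel_prob_Rplus \<nu> \<and>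
        cond_1 \<eta> lam \<mu> \<and>
        (\<forall>n\<in>J_set \<kappa>. has_bochner_integral \<nu> (\<lambda>s. s ^ n)
                        ((cmod (\<Prod>j=k-n..k-1. lam (Trunk j)))\<^sup>2)) \<and>
        (\<forall>\<sigma>\<in>sets Rplus_borel.
           (\<integral>\<^sup>+s\<in>\<sigma>. ennreal (s ^ k) \<partial>\<nu>) =
           ennreal ((cmod (\<Prod>j<k. lam (Trunk j)))\<^sup>2) * neg_moment_sum \<eta> lam \<mu> 1 \<sigma>)"
      by (intro exI[of _ \<mu>] exI[of _ \<nu>]) blast
  next
    show "unit_vec (Trunk 0) \<in> quasi_analytic (ell2 (tree_V \<eta> \<kappa>)) (weighted_shift \<eta> \<kappa> lam) \<longleftrightarrow>
       (\<Sum>n. inverse (ennreal (root (2 * Suc n)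
          (\<Sum>\<^sub>\<infinity>i\<in>J_set \<eta>. (cmod (\<Prod>j=1..Suc n. lam (Branch i j)))\<^sup>2)))) = \<infinity>"
      using quasi unfolding V_def s_def .
  next
    assume "unit_vec (Trunk 0) \<in> quasi_analytic (ell2 (tree_V \<eta> \<kappa>)) (weighted_shift \<eta> \<kappa> lam)"
    then show "cond_D \<eta> lam" using carleman unfolding V_def by blast
  qed
qed

end
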